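(* If $\mathsf{M}$ is a sparse paving matroid, then Speyer's polynomial $g_{\mathsf{M}}(t)$ has non-negative coefficients.
   Context: All matroids have finite ground sets contained in the positive integers. A matroid is paving if all its dependent sets have size at least its rank; it is sparse paving if both it and its dual are paving. Speyer's $g$-polynomial: the base polytope of a matroid $\mathsf{M}$ on $E$ with bases $\mathscr{B}$ is $\mathscr{P}(\mathsf{M})=\operatorname{conv}\{\sum_{i\in B}e_i : B\in\mathscr{B}\}\subseteq\mathbb{R}^E$, with indicator function $\mathbf{1}_{\mathscr{P}(\mathsf{M})}$. A map $f$ from matroids to an abelian group is a valuation if $\sum_i a_if(\mathsf{M}_i)=0$ whenever $\mathsf{M}_1,\dots,\mathsf{M}_s$ are matroids on a common ground set and $a_i\in\mathbb{Z}$ satisfy $\sum_i a_i\mathbf{1}_{\mathscr{P}(\mathsf{M}_i)}=0$. A map $f$ is a covaluation if $\mathsf{M}\mapsto(-1)^{c(\mathsf{M})}f(\mathsf{M})$ is a valuation, where $c(\mathsf{M})$ is the number of connected components of $\mathsf{M}$. Series-parallel matroids are the matroids obtained from the uniform matroid $\mathsf{U}_{1,2}$ by a sequence of series and parallel extensions, together with $\mathsf{U}_{0,1}$ and $\mathsf{U}_{1,1}$ (in particular they are connected). The map $\mathsf{M}\mapsto g_{\mathsf{M}}(t)\in\mathbb{Z}[t]$ is the unique isomorphism invariant of matroids such that (a) $g$ is covaluative; (b) $g_{\mathsf{M}}(t)=0$ if $\mathsf{M}$ has loops or coloops; (c) $g_{\mathsf{M}}(t)=t^m$ if $\mathsf{M}$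 is loopless and coloopless and is isomorphic to a direct sum of $m$ series-parallel matroids. *)

theory Defs
  imports
    "HOL-Analysis.Analysis"
    "HOL-Analysis.Finite_Function_Topology"
    "HOL-Computational_Algebra.Polynomial"
begin

section \<open>Matroids on finite sets of positive integers\<close>

definition matroid_bases :: "nat set \<Rightarrow> nat set set \<Rightarrow> bool" where
  "matroid_bases E \<B> \<longleftrightarrow>
     finite E \<and> 0 \<notin> E \<and> \<B> \<noteq> {} \<and> (\<forall>B\<in>\<B>. B \<subseteq> E) \<and>
     (\<forall>A\<in>\<B>. \<forall>B\<in>\<B>. \<forall>x\<in>A - B. \<exists>y\<in>B - A. insert y (A - {x}) \<in> \<B>)"

typedef matroid = "{(E, \<B>). matroid_bases E \<B>}"
  by (rule exI[of _ "({}, {{}})"]) (simp add: matroid_bases_def)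

definition ground :: "matroid \<Rightarrow> nat set" where
  "ground M = fst (Rep_matroid M)"

definition bases :: "matroid \<Rightarrow> nat set set" where
  "bases M = snd (Rep_matroid M)"

lemma matroid_bases_matroid: "matroid_bases (ground M) (bases M)"
  using Rep_matroid[of M] by (simp add: ground_def bases_def case_prod_unfold)

lemma matroid_eqI: "ground M = ground N \<Longrightarrow> bases M = bases N \<Longrightarrow> M = N"
  by (simp add: ground_def bases_def Rep_matroid_inject[symmetric] prod_eq_iff)

lemma matroid_of_bases:
  assumes "matroid_bases E \<B>"
  shows "ground (Abs_matroid (E, \<B>)) = E" "bases (Abs_matroid (E, \<B>)) = \<B>"
  using assms by (simp_all add: ground_def bases_def Abs_matroid_inverse)

lemma finite_ground: "finite (ground M)"
  using matroid_bases_matroid[of M] by (simp add: matroid_bases_def)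

lemma zero_notin_ground: "0 \<notin> ground M"
  using matroid_bases_matroid[of M] by (simp add: matroid_bases_def)

lemma bases_nonempty: "bases M \<noteq> {}"
  using matroid_bases_matroid[of M] by (simp add: matroid_bases_def)

lemma bases_subset_ground: "B \<in> bases M \<Longrightarrow> B \<subseteq> ground M"
  using matroid_bases_matroid[of M] by (simp add: matroid_bases_def)

lemma matroid_bases_exchange:
  assumes "matroid_bases E \<B>" "A \<in> \<B>" "B \<in> \<B>" "x \<in> A - B"
  shows "\<exists>y\<in>B - A. insert y (A - {x}) \<in> \<B>"
  using assms by (simp add: matroid_bases_def)

lemma matroid_bases_finite: "matroid_bases E \<B> \<Longrightarrow> B \<in> \<B> \<Longrightarrow> finite B"
  by (rule finite_subset[of B E]) (simp_all add: matroid_bases_def)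

lemma matroid_bases_card_le:
  assumes M: "matroid_bases E \<B>" and A: "A \<in> \<B>" and B: "B \<in> \<B>"
  shows "card A \<le> card B"
  using A
proof (induction "card (A - B)" arbitrary: A rule: less_induct)
  case less
  have fin: "finite A" "finite B"
    using matroid_bases_finite[OF M] less.prems B by blast+
  show ?case
  proof (cases "A \<subseteq> B")
    case True
    then show ?thesis using fin by (simp add: card_mono)
  next
    case False
    then obtain x where x: "x \<in> A - B" by blast
    then obtain y where y: "y \<in> B - A" and A': "insert y (A - {x}) \<in> \<B>"
      using matroid_bases_exchange[OF M less.prems B] by blast
    have "insert y (A - {x}) - B = (A - B) - {x}" using y by auto
    then have "insert y (A - {x}) - B \<subset> A - B" using x by auto
    then have "card (insert y (A - {x}) - B) < card (A - B)"
      using fin by (simp add: psubset_card_mono)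
    then have "card (insert y (A - {x})) \<le> card B" using less.hyps A' by blast
    moreover have "card (insert y (A - {x})) = card A"
      using x y fin card.remove[of A x] by simp
    ultimately show ?thesis by simp
  qed
qed

lemma matroid_bases_card_eq:
  assumes "matroid_bases E \<B>" "A \<in> \<B>" "B \<in> \<B>"
  shows "card A = card B"
  using matroid_bases_card_le assms by (meson le_antisym)

lemma matroid_bases_dual_exchange:
  assumes M: "matroid_bases E \<B>" and A: "A \<in> \<B>" and B: "B \<in> \<B>" and x: "x \<in> B - A"
  shows "\<exists>y\<in>A - B. insert x (A - {y}) \<in> \<B>"
proof -
  define P where "P C \<longleftrightarrow> C \<in> \<B> \<and> x \<in> C \<and> A \<inter> B \<subseteq> C" for C
  have "P B" using B x by (auto simp: P_def)
  then obtain C where C: "P C" and min: "\<And>D. P D \<Longrightarrow> card (C - A) \<le> card (D - A)"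
    using ex_has_least_nat[of P B "\<lambda>C. card (C - A)"] by auto
  have fin: "finite A" "finite C"
    using matroid_bases_finite[OF M] A C by (simp_all add: P_def)
  have CA: "C - A = {x}"
  proof (rule ccontr)
    assume "C - A \<noteq> {x}"
    moreover have "x \<in> C - A" using C x by (simp add: P_def)
    ultimately obtain z where z: "z \<in> C - A" "z \<noteq> x" by blast
    then obtain w where w: "w \<in> A - C" "insert w (C - {z}) \<in> \<B>"
      using matroid_bases_exchange[OF M _ A z(1)] C unfolding P_def by blast
    have "x \<in> C" "A \<inter> B \<subseteq> C" using C by (simp_all add: P_def)
    then have "x \<in> insert w (C - {z})" "A \<inter> B \<subseteq> insert w (C - {z})" using z by blast+
    then have "P (insert w (C - {z}))" using w(2) by (simp add: P_def)
    moreover have "insert w (C - {z}) - A = (C - A) - {z}" using w(1) by auto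
    then have "insert w (C - {z}) - A \<subset> C - A" using z(1) by auto
    then have "card (insert w (C - {z}) - A) < card (C - A)"
      using fin by (simp add: psubset_card_mono)
    ultimately show False using min by (simp add: leD)
  qed
  have CB: "C \<in> \<B>" "A \<inter> B \<subseteq> C" using C by (simp_all add: P_def)
  have "card C = card A" by (rule matroid_bases_card_eq[OF M CB(1) A])
  then have "card (A - C) = card (C - A)"
    using fin by (metis card_Diff_subset_Int finite_Int inf_commute)
  then have "card (A - C) = 1" using CA by simp
  then obtain y where y: "A - C = {y}" by (auto simp: card_1_singleton_iff)
  have "C = insert x (A - {y})" using CA y by blast
  moreover have "y \<in> A - B" using y CB(2) by blast
  ultimately show ?thesis using CB(1) by metis
qed

definition dual :: "matroid \<Rightarrow> matroid" where
  "dual M = Abs_matroid (ground M, (\<lambda>B. ground M - B) ` bases M)"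

lemma matroid_bases_dual: "matroid_bases (ground M) ((\<lambda>B. ground M - B) ` bases M)"
proof -
  let ?E = "ground M"
  have "\<exists>y\<in>(?E - B) - (?E - A). insert y ((?E - A) - {x}) \<in> (\<lambda>B. ?E - B) ` bases M"
    if A: "A \<in> bases M" and B: "B \<in> bases M" and x: "x \<in> (?E - A) - (?E - B)" for A B x
  proof -
    have "x \<in> B - A" using x by blast
    then obtain y where y: "y \<in> A - B" "insert x (A - {y}) \<in> bases M"
      using matroid_bases_dual_exchange[OF matroid_bases_matroid A B] by blast
    have "y \<in> ?E" using y(1) A bases_subset_ground by blast
    then have "insert y ((?E - A) - {x}) = ?E - insert x (A - {y})"
      using x y(1) by blast
    moreover have "y \<in> (?E - B) - (?E - A)" using y(1) \<open>y \<in> ?E\<close> by blast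
    ultimately show ?thesis using y(2) by (metis imageI)
  qed
  then show ?thesis
    unfolding matroid_bases_def ball_simps
    by (intro conjI ballI) (simp_all add: finite_ground zero_notin_ground bases_nonempty)
qed

lemma ground_dual: "ground (dual M) = ground M"
  and bases_dual: "bases (dual M) = (\<lambda>B. ground M - B) ` bases M"
  by (simp_all add: dual_def matroid_of_bases[OF matroid_bases_dual])

definition indep :: "matroid \<Rightarrow> nat set \<Rightarrow> bool" where
  "indep M X \<longleftrightarrow> (\<exists>B\<in>bases M. X \<subseteq> B)"

definition dependent_set :: "matroid \<Rightarrow> nat set \<Rightarrow> bool" where
  "dependent_set M X \<longleftrightarrow> X \<subseteq> ground M \<and> \<not> indep M X"

definition circuit :: "matroid \<Rightarrow> nat set \<Rightarrow> bool" where
  "circuit M C \<longleftrightarrow> dependent_set M C \<and> (\<forall>X. X \<subset> C \<longrightarrow> indep M X)"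

definition loop :: "matroid \<Rightarrow> nat \<Rightarrow> bool" where
  "loop M e \<longleftrightarrow> circuit M {e}"

definition coloop :: "matroid \<Rightarrow> nat \<Rightarrow> bool" where
  "coloop M e \<longleftrightarrow> loop (dual M) e"

definition matroid_rank :: "matroid \<Rightarrow> nat" where
  "matroid_rank M = Max (card ` bases M)"

lemma card_basis: "B \<in> bases M \<Longrightarrow> card B = matroid_rank M"
proof -
  assume B: "B \<in> bases M"
  then have "card ` bases M = {card B}"
    using matroid_bases_card_eq[OF matroid_bases_matroid] by blast
  then show ?thesis by (simp add: matroid_rank_def)
qed

definition paving :: "matroid \<Rightarrow> bool" where
  "paving M \<longleftrightarrow> (\<forall>X. dependent_set M X \<longrightarrow> matroid_rank M \<le> card X)"

definition sparse_paving :: "matroid \<Rightarrow> bool" where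
  "sparse_paving M \<longleftrightarrow> paving M \<and> paving (dual M)"

definition matroid_iso :: "matroid \<Rightarrow> matroid \<Rightarrow> bool" where
  "matroid_iso M N \<longleftrightarrow>
     (\<exists>\<phi>. bij_betw \<phi> (ground M) (ground N) \<and> bases N = (\<lambda>B. \<phi> ` B) ` bases M)"

definition connection_rel :: "matroid \<Rightarrow> (nat \<times> nat) set" where
  "connection_rel M =
     {(x, y). x \<in> ground M \<and> y \<in> ground M \<and> (x = y \<or> (\<exists>C. circuit M C \<and> x \<in> C \<and> y \<in> C))}"

text \<open>The classes of \<^term>\<open>connection_rel M\<close> are the ground sets of the connected components
  of \<open>M\<close>; loops and coloops form singleton classes, and the empty matroid has no component.\<close>

definition num_components :: "matroid \<Rightarrow> nat" where
  "num_components M = card (ground M // connection_rel M)"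

definition is_direct_sum :: "matroid \<Rightarrow> nat \<Rightarrow> (nat \<Rightarrow> matroid) \<Rightarrow> bool" where
  "is_direct_sum N m Ms \<longleftrightarrow>
     disjoint_family_on (\<lambda>i. ground (Ms i)) {..<m} \<and>
     ground N = (\<Union>i<m. ground (Ms i)) \<and>
     bases N = {\<Union>i<m. B i |B. \<forall>i<m. B i \<in> bases (Ms i)}"


section \<open>Series-parallel matroids\<close>

text \<open>\<open>is_uniform k n M\<close>: \<open>M\<close> is a copy of \<open>U\<^sub>k\<^sub>,\<^sub>n\<close> on some ground set of size \<open>n\<close>.\<close>

definition is_uniform :: "nat \<Rightarrow> nat \<Rightarrow> matroid \<Rightarrow> bool" where
  "is_uniform k n M \<longleftrightarrow> card (ground M) = n \<and> bases M = {B. B \<subseteq> ground M \<and> card B = k}"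

definition is_deletion :: "matroid \<Rightarrow> nat \<Rightarrow> matroid \<Rightarrow> bool" where
  "is_deletion N e M \<longleftrightarrow>
     ground M = ground N - {e} \<and> (\<forall>X. indep M X \<longleftrightarrow> indep N X \<and> e \<notin> X)"

text \<open>\<open>N\<close> extends \<open>M\<close> by one new element \<open>e\<close>, parallel to an element \<open>f\<close> of \<open>M\<close>.\<close>

definition parallel_extension :: "matroid \<Rightarrow> matroid \<Rightarrow> bool" where
  "parallel_extension M N \<longleftrightarrow>
     (\<exists>e f. e \<noteq> f \<and> circuit N {e, f} \<and> is_deletion N e M)"

text \<open>Dually, \<open>{e, f}\<close> is a cocircuit of \<open>N\<close> and \<open>M\<close> is the contraction \<open>N / e\<close>.\<close>

definition series_extension :: "matroid \<Rightarrow> matroid \<Rightarrow> bool" where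
  "series_extension M N \<longleftrightarrow> parallel_extension (dual M) (dual N)"

inductive series_parallel_built :: "matroid \<Rightarrow> bool" where
  start: "is_uniform 1 2 M \<Longrightarrow> series_parallel_built M"
| series: "series_parallel_built M \<Longrightarrow> series_extension M N \<Longrightarrow> series_parallel_built N"
| parallel: "series_parallel_built M \<Longrightarrow> parallel_extension M N \<Longrightarrow> series_parallel_built N"

definition series_parallel :: "matroid \<Rightarrow> bool" where
  "series_parallel M \<longleftrightarrow> series_parallel_built M \<or> is_uniform 0 1 M \<or> is_uniform 1 1 M"


section \<open>Base polytopes and valuations\<close>

text \<open>\<open>\<real>\<^sup>E\<close> is embedded in the space of finitely supported real functions on \<^typ>\<open>nat\<close>, with
  unit vectors \<^term>\<open>Poly_Mapping.single i 1\<close>. Since valuations only involve matroids on a common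
  ground set, and base polytopes lie in \<open>\<real>\<^sup>E\<close>, testing a linear relation between their
  indicator functions on the larger space is the same as testing it on \<open>\<real>\<^sup>E\<close>.\<close>

definition indicator_vec :: "nat set \<Rightarrow> (nat \<Rightarrow>\<^sub>0 real)" where
  "indicator_vec B = (\<Sum>i\<in>B. Poly_Mapping.single i 1)"

definition base_polytope :: "matroid \<Rightarrow> (nat \<Rightarrow>\<^sub>0 real) set" where
  "base_polytope M = convex hull (indicator_vec ` bases M)"

text \<open>The target is taken to be the additive group of a ring, so that integer multiples
  can be written with \<^const>\<open>of_int\<close>.\<close>

definition valuation :: "(matroid \<Rightarrow> 'a::ring_1) \<Rightarrow> bool" where
  "valuation f \<longleftrightarrow>
     (\<forall>(s::nat) (Ms :: nat \<Rightarrow> matroid) (a :: nat \<Rightarrow> int) E.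
        (\<forall>i<s. ground (Ms i) = E) \<longrightarrow>
        (\<forall>x. (\<Sum>i<s. a i * indicator (base_polytope (Ms i)) x) = 0) \<longrightarrow>
        (\<Sum>i<s. of_int (a i) * f (Ms i)) = 0)"

definition covaluation :: "(matroid \<Rightarrow> 'a::ring_1) \<Rightarrow> bool" where
  "covaluation f \<longleftrightarrow> valuation (\<lambda>M. (- 1) ^ num_components M * f M)"


section \<open>Speyer's polynomial\<close>

text \<open>The properties that characterise the assignment \<open>M \<mapsto> g\<^sub>M(t)\<close>. The value \<open>m = 0\<close> is
  included: it gives \<open>g\<^sub>M(t) = 1\<close> for the empty matroid, the empty direct sum.\<close>

definition speyer_g :: "(matroid \<Rightarrow> int poly) \<Rightarrow> bool" where
  "speyer_g g \<longleftrightarrow>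
     (\<forall>M N. matroid_iso M N \<longrightarrow> g M = g N) \<and>
     covaluation g \<and>
     (\<forall>M. (\<exists>e. loop M e \<or> coloop M e) \<longrightarrow> g M = 0) \<and>
     (\<forall>M N m Ms. (\<nexists>e. loop M e \<or> coloop M e) \<longrightarrow>
        matroid_iso M N \<longrightarrow> is_direct_sum N m Ms \<longrightarrow> (\<forall>i<m. series_parallel (Ms i)) \<longrightarrow>
        g M = monom 1 m)"

end

(*
Ordering the ground set makes every basis a lattice path, and the hyperplanes on which a prefix sum
of the coordinates is an integer cut the hypersimplex into base polytopes of lattice path matroids.
A cell either has a loop or a coloop, or is a direct sum of m snakes, which are series-parallel; it
then contributes t^m, and the signs of inclusion-exclusion cancel those of the covaluation. So g of
a uniform matroid counts cells by their number of summands. Relaxing a circuit-hyperplane adds a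
snake glued along a direct sum of two snakes, i.e. t + t^2 to g. A sparse paving matroid of rank k
on n elements with c circuit-hyperplanes is thus governed by g(U_{k,n}) - c (t + t^2) when it is
connected. Circuit-hyperplanes pairwise meet in at most k - 2 elements, so c is smaller than
binomial(n-2, k-1) for n >= 5, hence at most the coefficients of t and t^2 in g(U_{k,n}). The only
disconnected exception is U_{1,2} + U_{1,2}.
*)

theory Submission
  imports Defs
begin

text \<open>The axioms evaluate \<open>g\<close> only on matroids with loops or coloops and on
  direct sums of series-parallel matroids; covaluativity is the only bridge to all others. Every
  comparison is therefore an identity between indicator functions of polytopes, accompanied by a
  count of components on both sides. Two obstacles follow. The cells must be base polytopes, so
  integer bounds on prefix sums must not create fractional vertices (\<open>hull_lp\<close>); and
  the number of components must be computed from circuits, for snakes as well as for the sparse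
  paving matroid itself. Signs: a cell with m summands has m + 1 pinches, both ends included, each
  with sign -1, and covaluativity adds (-1)^m. It contributes -t^m, and the connected uniform
  matroid contributes -g. Strictness of the bound on c is essential: the cells with two summands
  constructed here number (n - 3) binomial(n - 4, k - 2), which for k = 2 or k = n - 2 is n - 3, one
  less than binomial(n - 2, k - 1). For n = 4 two disjoint pairs already reach binomial(2, 1), hence
  the exception.\<close>

section \<open>Lattice path matroids\<close>

text \<open>The bounds are integers because duality turns them into \<open>i - u i\<close> and \<open>i - l i\<close>.\<close>

definition lp :: "nat list \<Rightarrow> (nat \<Rightarrow> int) \<Rightarrow> (nat \<Rightarrow> int) \<Rightarrow> nat set set" where
  "lp xs l u = {B. B \<subseteq> set xs \<and>
     (\<forall>i\<le>length xs. l i \<le> int (card (B \<inter> set (take i xs))) \<and>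
                    int (card (B \<inter> set (take i xs))) \<le> u i)}"

lemma lp_I:
  assumes "B \<subseteq> set xs"
    and "\<And>i. i \<le> length xs \<Longrightarrow> l i \<le> int (card (B \<inter> set (take i xs)))"
    and "\<And>i. i \<le> length xs \<Longrightarrow> int (card (B \<inter> set (take i xs))) \<le> u i"
  shows "B \<in> lp xs l u"
  using assms by (simp add: lp_def)

lemma lp_D:
  assumes "B \<in> lp xs l u"
  shows "B \<subseteq> set xs"
    and "i \<le> length xs \<Longrightarrow> l i \<le> int (card (B \<inter> set (take i xs)))"
    and "i \<le> length xs \<Longrightarrow> int (card (B \<inter> set (take i xs))) \<le> u i"
  using assms by (auto simp: lp_def)

lemma card_take_Suc:
  assumes "distinct xs" "i < length xs"
  shows "card (B \<inter> set (take (Suc i) xs))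
    = card (B \<inter> set (take i xs)) + (if xs ! i \<in> B then 1 else 0)"
proof -
  have "xs ! i \<notin> set (take i xs)"
    using assms by (auto simp: in_set_conv_nth nth_eq_iff_index_eq)
  then show ?thesis using assms(2) by (simp add: take_Suc_conv_app_nth)
qed

lemma nth_mem_take_iff:
  assumes "distinct xs" "j < length xs" "i \<le> length xs"
  shows "xs ! j \<in> set (take i xs) \<longleftrightarrow> j < i"
  using assms by (auto simp: in_set_conv_nth nth_eq_iff_index_eq)

lemma card_swap_take:
  assumes xs: "distinct xs" "j < length xs" "r < length xs"
    and A: "xs ! j \<in> A" "xs ! r \<notin> A" and i: "i \<le> length xs"
  shows "int (card (insert (xs ! r) (A - {xs ! j}) \<inter> set (take i xs)))
    = int (card (A \<inter> set (take i xs))) - (if j < i then 1 else 0) + (if r < i then 1 else 0)"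
  using i
proof (induction i)
  case (Suc i)
  then have i: "i < length xs" by simp
  have "j \<noteq> r" using A by auto
  then show ?case using Suc A i xs
    by (auto simp: card_take_Suc[OF xs(1) i] nth_eq_iff_index_eq less_Suc_eq)
qed simp

text \<open>Let a and b be the prefix counts of \<open>A\<close> and \<open>B\<close>, with
  \<open>x\<close> at position \<open>j\<close>. If a is not below b at \<open>j\<close>, the first
  later return of a to b supplies \<open>y\<close>: in between a exceeds b, so lowering a by one
  stays above \<open>l\<close>. Otherwise the last earlier position with a not below b supplies
  \<open>y\<close>, and raising a by one stays below \<open>u\<close>. In both cases
  \<open>B\<close> itself certifies the bound.\<close>

lemma lp_exchange:
  assumes xs: "distinct xs" and lu: "l (length xs) = u (length xs)"
    and A: "A \<in> lp xs l u" and B: "B \<in> lp xs l u" and x: "x \<in> A - B"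
  shows "\<exists>y\<in>B - A. insert y (A - {x}) \<in> lp xs l u"
proof -
  define n where "n = length xs"
  define a where "a i = int (card (A \<inter> set (take i xs)))" for i
  define b where "b i = int (card (B \<inter> set (take i xs)))" for i
  have al: "l i \<le> a i" "a i \<le> u i" and bl: "l i \<le> b i" "b i \<le> u i" if "i \<le> n" for i
    using lp_D(2,3)[OF A, of i] lp_D(2,3)[OF B, of i] that by (auto simp: a_def b_def n_def)
  have aS: "a (Suc i) = a i + (if xs ! i \<in> A then 1 else 0)"
    and bS: "b (Suc i) = b i + (if xs ! i \<in> B then 1 else 0)" if "i < n" for i
    using that by (simp_all add: a_def b_def n_def card_take_Suc[OF xs])
  have z: "a 0 = 0" "b 0 = 0" by (simp_all add: a_def b_def)
  have e: "a n = b n" using al[of n] bl[of n] lu by (simp add: n_def)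
  obtain j where j: "j < n" "x = xs ! j"
    using x lp_D(1)[OF A] by (metis DiffD1 in_set_conv_nth n_def subsetD)
  have jA: "xs ! j \<in> A" "xs ! j \<notin> B" using x j by auto
  have jS: "a (Suc j) = a j + 1" "b (Suc j) = b j" using aS bS j jA by simp_all
  have goal: ?thesis if r: "r < n" "xs ! r \<in> B - A"
    and bd: "\<And>i. i \<le> n \<Longrightarrow> l i \<le> a i - (if j < i then 1 else 0) + (if r < i then 1 else 0)
      \<and> a i - (if j < i then 1 else 0) + (if r < i then 1 else 0) \<le> u i" for r
  proof (rule bexI[OF _ r(2)], rule lp_I)
    show "insert (xs ! r) (A - {x}) \<subseteq> set xs" using lp_D(1)[OF A] r(1) by (auto simp: n_def)
  next
    fix i assume i: "i \<le> length xs"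
    have *: "int (card (insert (xs ! r) (A - {x}) \<inter> set (take i xs)))
      = a i - (if j < i then 1 else 0) + (if r < i then 1 else 0)"
      unfolding a_def j(2) using j r jA i xs by (intro card_swap_take) (auto simp: n_def)
    show "l i \<le> int (card (insert (xs ! r) (A - {x}) \<inter> set (take i xs)))"
      "int (card (insert (xs ! r) (A - {x}) \<inter> set (take i xs))) \<le> u i"
      using bd[of i] i unfolding * by (auto simp: n_def)
  qed
  show ?thesis
  proof (cases "a j \<ge> b j")
    case True
    define R where "R = {r. j < r \<and> r < n \<and> a (Suc r) \<le> b (Suc r)}"
    have "Suc j \<noteq> n" using jS e True by auto
    then have "n - 1 \<in> R" using j e by (auto simp: R_def)
    moreover have fin: "finite R" by (simp add: R_def)
    ultimately have mem: "Min R \<in> R" by (intro Min_in) auto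
    define r where "r = Min R"
    have r: "j < r" "r < n" "a (Suc r) \<le> b (Suc r)" using mem by (auto simp: R_def r_def)
    have gt: "a i > b i" if "j < i" "i \<le> r" for i
    proof (rule ccontr)
      assume *: "\<not> a i > b i"
      then have "i \<noteq> Suc j" using jS True by auto
      define i' where "i' = i - 1"
      have i': "i = Suc i'" "j < i'" using that \<open>i \<noteq> Suc j\<close> by (auto simp: i'_def)
      then have "i' \<in> R" using * that r by (auto simp: R_def)
      then have "r \<le> i'" unfolding r_def using fin by (rule Min_le[rotated])
      then show False using i' that by simp
    qed
    have "xs ! r \<in> B - A" using gt[of r] r aS[of r] bS[of r] by (auto split: if_splits)
    then show ?thesis
    proof (rule goal[OF r(2)], goal_cases)
      case (1 i)
      show ?case using al[OF 1] bl[OF 1] gt[of i] r(1) by (cases "j < i"; cases "r < i") auto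
    qed
  next
    case False
    define R where "R = {r. r < j \<and> a r \<ge> b r}"
    have "j \<noteq> 0" using False z by (cases j) auto
    then have "0 \<in> R" using z by (auto simp: R_def)
    moreover have fin: "finite R" by (simp add: R_def)
    ultimately have mem: "Max R \<in> R" by (intro Max_in) auto
    define r where "r = Max R"
    have r: "r < j" "a r \<ge> b r" using mem by (auto simp: R_def r_def)
    have lt: "a i < b i" if "r < i" "i \<le> j" for i
    proof (rule ccontr)
      assume *: "\<not> a i < b i"
      then have "i \<noteq> j" using False by auto
      then have "i \<in> R" using * that by (auto simp: R_def)
      then have "i \<le> r" unfolding r_def using fin by (rule Max_ge[rotated])
      then show False using that by simp
    qed
    have "xs ! r \<in> B - A" using lt[of "Suc r"] r j aS[of r] bS[of r] by (auto split: if_splits)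
    moreover have "r < n" using r j by simp
    ultimately show ?thesis
    proof (intro goal[of r], goal_cases)
      case (3 i)
      show ?case using al[OF 3(3)] bl[OF 3(3)] lt[of i] r(1) by (cases "j < i"; cases "r < i") auto
    qed auto
  qed
qed

lemma lp_matroid:
  assumes "distinct xs" "0 \<notin> set xs" "l (length xs) = u (length xs)" "lp xs l u \<noteq> {}"
  shows "matroid_bases (set xs) (lp xs l u)"
  unfolding matroid_bases_def
  using assms lp_exchange[OF assms(1), of l u, OF assms(3)] by (auto dest: lp_D(1))

text \<open>Inverse to taking prefix counts. Bases are built from here on by prescribing a height
  function with steps 0 and 1.\<close>

definition path_set :: "nat list \<Rightarrow> (nat \<Rightarrow> int) \<Rightarrow> nat set" where
  "path_set xs q = {xs ! i | i. i < length xs \<and> q (Suc i) = q i + 1}"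

lemma nth_mem_path_set:
  assumes "distinct xs" "i < length xs"
  shows "xs ! i \<in> path_set xs q \<longleftrightarrow> q (Suc i) = q i + 1"
  using assms by (auto simp: path_set_def nth_eq_iff_index_eq)

lemma card_path_set:
  assumes "distinct xs" "q 0 = 0"
    and "\<And>i. i < length xs \<Longrightarrow> q (Suc i) = q i \<or> q (Suc i) = q i + 1"
  shows "i \<le> length xs \<Longrightarrow> int (card (path_set xs q \<inter> set (take i xs))) = q i"
proof (induction i)
  case (Suc i)
  then have "i < length xs" by simp
  then show ?case
    using Suc assms(3)[of i] by (auto simp: card_take_Suc[OF assms(1)] nth_mem_path_set[OF assms(1)])
qed (simp add: assms)

lemma path_set_in_lp:
  assumes "distinct xs" "q 0 = 0"
    and "\<And>i. i < length xs \<Longrightarrow> q (Suc i) = q i \<or> q (Suc i) = q i + 1"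
    and "\<And>i. i \<le> length xs \<Longrightarrow> l i \<le> q i \<and> q i \<le> u i"
  shows "path_set xs q \<in> lp xs l u"
proof (rule lp_I)
  show "path_set xs q \<subseteq> set xs" by (auto simp: path_set_def)
qed (use card_path_set[OF assms(1,2,3)] assms(4) in auto)

lemma lp_complement:
  assumes "distinct xs"
  shows "(\<lambda>B. set xs - B) ` lp xs l u = lp xs (\<lambda>i. int i - u i) (\<lambda>i. int i - l i)"
proof -
  have *: "set xs - B \<in> lp xs (\<lambda>i. int i - u i) (\<lambda>i. int i - l i)" if B: "B \<in> lp xs l u" for B l u
  proof -
    have "int (card ((set xs - B) \<inter> set (take i xs))) = int i - int (card (B \<inter> set (take i xs)))"
      if i: "i \<le> length xs" for i
    proof -
      have "(set xs - B) \<inter> set (take i xs) = set (take i xs) - B \<inter> set (take i xs)"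
        using set_take_subset[of i xs] by blast
      moreover have "card (set (take i xs)) = i"
        using assms i by (simp add: distinct_card)
      moreover have "card (B \<inter> set (take i xs)) \<le> card (set (take i xs))"
        by (rule card_mono) auto
      ultimately show ?thesis by (simp add: card_Diff_subset of_nat_diff)
    qed
    then show ?thesis using lp_D(2,3)[OF B] by (intro lp_I) auto
  qed
  show ?thesis
  proof
    show "lp xs (\<lambda>i. int i - u i) (\<lambda>i. int i - l i) \<subseteq> (\<lambda>B. set xs - B) ` lp xs l u"
    proof
      fix B assume B: "B \<in> lp xs (\<lambda>i. int i - u i) (\<lambda>i. int i - l i)"
      have "set xs - B \<in> lp xs l u" using *[OF B] by simp
      moreover have "B = set xs - (set xs - B)" using lp_D(1)[OF B] by blast
      ultimately show "B \<in> (\<lambda>B. set xs - B) ` lp xs l u" by blast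
    qed
  qed (use * in auto)
qed

section \<open>Base polytopes of lattice path matroids\<close>

definition psum :: "nat list \<Rightarrow> (nat \<Rightarrow>\<^sub>0 real) \<Rightarrow> nat \<Rightarrow> real" where
  "psum xs p i = (\<Sum>e\<in>set (take i xs). Poly_Mapping.lookup p e)"

definition lp_polytope :: "nat list \<Rightarrow> (nat \<Rightarrow> int) \<Rightarrow> (nat \<Rightarrow> int) \<Rightarrow> (nat \<Rightarrow>\<^sub>0 real) set" where
  "lp_polytope xs l u = {p. (\<forall>e. 0 \<le> Poly_Mapping.lookup p e \<and> Poly_Mapping.lookup p e \<le> 1) \<and>
     (\<forall>e. e \<notin> set xs \<longrightarrow> Poly_Mapping.lookup p e = 0) \<and>
     (\<forall>i\<le>length xs. real_of_int (l i) \<le> psum xs p i \<and> psum xs p i \<le> real_of_int (u i))}"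

lemma psum_0: "psum xs p 0 = 0"
  by (simp add: psum_def)

lemma psum_Suc:
  assumes "distinct xs" "i < length xs"
  shows "psum xs p (Suc i) = psum xs p i + Poly_Mapping.lookup p (xs ! i)"
proof -
  have "xs ! i \<notin> set (take i xs)"
    using assms by (simp add: nth_mem_take_iff)
  then show ?thesis using assms(2) by (simp add: psum_def take_Suc_conv_app_nth)
qed

lemma lookup_indicator_vec:
  assumes "finite B"
  shows "Poly_Mapping.lookup (indicator_vec B) e = (if e \<in> B then 1 else 0)"
  using assms by (simp add: indicator_vec_def lookup_sum lookup_single when_def)

lemma sum_indicator_vec:
  assumes "finite B" "finite S"
  shows "(\<Sum>e\<in>S. Poly_Mapping.lookup (indicator_vec B) e) = real (card (B \<inter> S))"
  using assms by (simp add: lookup_indicator_vec sum.If_cases Int_commute)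

lemma lookup_scaleR: "Poly_Mapping.lookup (c *\<^sub>R p) e = c *\<^sub>R Poly_Mapping.lookup p e"
proof -
  have "finite {i. c *\<^sub>R Poly_Mapping.lookup p i \<noteq> 0}"
    by (rule finite_subset[OF _ finite_lookup[of p]]) auto
  then show ?thesis by (simp add: scaleR_poly_mapping_def Abs_poly_mapping_inverse)
qed

lemma sum_lookup_combination:
  fixes p q :: "nat \<Rightarrow>\<^sub>0 real"
  shows "(\<Sum>e\<in>S. Poly_Mapping.lookup (a *\<^sub>R p + b *\<^sub>R q) e)
    = a * (\<Sum>e\<in>S. Poly_Mapping.lookup p e) + b * (\<Sum>e\<in>S. Poly_Mapping.lookup q e)"
  by (simp add: lookup_add lookup_scaleR sum.distrib sum_distrib_left)

lemma convex_lookup_sum_bounds: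
  fixes L U :: real and S :: "nat set"
  shows "convex {p. L \<le> (\<Sum>e\<in>S. Poly_Mapping.lookup p e) \<and> (\<Sum>e\<in>S. Poly_Mapping.lookup p e) \<le> U}"
proof (rule convexI)
  fix p q :: "nat \<Rightarrow>\<^sub>0 real" and a b :: real
  assume p: "p \<in> {p. L \<le> (\<Sum>e\<in>S. Poly_Mapping.lookup p e) \<and> (\<Sum>e\<in>S. Poly_Mapping.lookup p e) \<le> U}"
    and q: "q \<in> {p. L \<le> (\<Sum>e\<in>S. Poly_Mapping.lookup p e) \<and> (\<Sum>e\<in>S. Poly_Mapping.lookup p e) \<le> U}"
    and ab: "0 \<le> a" "0 \<le> b" "a + b = 1"
  define P where "P = (\<Sum>e\<in>S. Poly_Mapping.lookup p e)"
  define Q where "Q = (\<Sum>e\<in>S. Poly_Mapping.lookup q e)"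
  have "L \<le> P" "P \<le> U" "L \<le> Q" "Q \<le> U" using p q by (simp_all add: P_def Q_def)
  then have "L \<le> a * P + b * Q \<and> a * P + b * Q \<le> U"
    using convex_bound_le[of P U Q a b] convex_bound_le[of "-P" "-L" "-Q" a b] ab by auto
  then show "a *\<^sub>R p + b *\<^sub>R q
      \<in> {p. L \<le> (\<Sum>e\<in>S. Poly_Mapping.lookup p e) \<and> (\<Sum>e\<in>S. Poly_Mapping.lookup p e) \<le> U}"
    unfolding mem_Collect_eq sum_lookup_combination P_def Q_def .
qed

lemma convex_lp_polytope: "convex (lp_polytope xs l u)"
proof -
  \<comment> \<open>Vanishing outside the ground set is written as a pair of inequalities with both
    bounds 0, so that all constraints are slabs covered by
    \<open>convex_lookup_sum_bounds\<close>.\<close>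
  have eq: "lp_polytope xs l u =
    (\<Inter>e. {p. 0 \<le> (\<Sum>e\<in>{e}. Poly_Mapping.lookup p e) \<and> (\<Sum>e\<in>{e}. Poly_Mapping.lookup p e) \<le> 1}) \<inter>
    (\<Inter>e\<in>- set xs. {p. 0 \<le> (\<Sum>e\<in>{e}. Poly_Mapping.lookup p e) \<and> (\<Sum>e\<in>{e}. Poly_Mapping.lookup p e) \<le> 0}) \<inter>
    (\<Inter>i\<in>{..length xs}. {p. real_of_int (l i) \<le> (\<Sum>e\<in>set (take i xs). Poly_Mapping.lookup p e) \<and>
       (\<Sum>e\<in>set (take i xs). Poly_Mapping.lookup p e) \<le> real_of_int (u i)})"
    unfolding lp_polytope_def psum_def by (auto intro: order_antisym)
  show ?thesis
    unfolding eq by (intro convex_Int convex_INT ballI convex_lookup_sum_bounds)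
qed

section \<open>Fractional lattice paths and integrality of the polytope\<close>

definition path_vec :: "nat list \<Rightarrow> (nat \<Rightarrow> real) \<Rightarrow> (nat \<Rightarrow>\<^sub>0 real)" where
  "path_vec xs Y = (\<Sum>i<length xs. Poly_Mapping.single (xs ! i) (Y (Suc i) - Y i))"

lemma lookup_path_vec:
  assumes "distinct xs"
  shows "i < length xs \<Longrightarrow> Poly_Mapping.lookup (path_vec xs Y) (xs ! i) = Y (Suc i) - Y i"
    and "e \<notin> set xs \<Longrightarrow> Poly_Mapping.lookup (path_vec xs Y) e = 0"
proof -
  show "Poly_Mapping.lookup (path_vec xs Y) (xs ! i) = Y (Suc i) - Y i" if i: "i < length xs"
  proof -
    have "Poly_Mapping.lookup (path_vec xs Y) (xs ! i)
        = (\<Sum>j<length xs. if j = i then Y (Suc j) - Y j else 0)"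
      unfolding path_vec_def lookup_sum using assms i
      by (intro sum.cong) (auto simp: lookup_single when_def nth_eq_iff_index_eq)
    then show ?thesis using i by simp
  qed
  show "Poly_Mapping.lookup (path_vec xs Y) e = 0" if "e \<notin> set xs"
    unfolding path_vec_def lookup_sum using that
    by (intro sum.neutral) (auto simp: lookup_single when_def)
qed

lemma path_vec_eqI:
  assumes "distinct xs"
    and "\<And>e. e \<notin> set xs \<Longrightarrow> Poly_Mapping.lookup p e = 0"
    and "\<And>i. i < length xs \<Longrightarrow> Poly_Mapping.lookup p (xs ! i) = Y (Suc i) - Y i"
  shows "path_vec xs Y = p"
proof (rule poly_mapping_eqI)
  fix e show "Poly_Mapping.lookup (path_vec xs Y) e = Poly_Mapping.lookup p e"
    by (cases "e \<in> set xs") (auto simp: in_set_conv_nth lookup_path_vec[OF assms(1)] assms(2,3))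
qed

definition real_path :: "nat \<Rightarrow> (nat \<Rightarrow> int) \<Rightarrow> (nat \<Rightarrow> int) \<Rightarrow> (nat \<Rightarrow> real) \<Rightarrow> bool" where
  "real_path n l u Y \<longleftrightarrow> Y 0 = 0 \<and> (\<forall>i<n. Y i \<le> Y (Suc i) \<and> Y (Suc i) \<le> Y i + 1) \<and>
     (\<forall>i\<le>n. real_of_int (l i) \<le> Y i \<and> Y i \<le> real_of_int (u i))"

text \<open>Two consecutive fractional heights move together, so their difference is unchanged. A
  fractional height next to an integral one lies in a unit interval ending at that integer and stays
  in it, as \<open>c\<close> never carries a height past its neighbouring integers. The bounds are
  integers, hence respected for the same reason.\<close>

lemma real_path_shift:
  assumes Y: "real_path n l u Y"
    and c: "\<And>i. i \<le> n \<Longrightarrow> Y i \<notin> \<int> \<Longrightarrow> real_of_int \<lfloor>Y i\<rfloor> \<le> Y i + c \<and> Y i + c \<le> real_of_int \<lfloor>Y i\<rfloor> + 1"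
  shows "real_path n l u (\<lambda>i. if Y i \<in> \<int> then Y i else Y i + c)"
  unfolding real_path_def
proof (intro conjI allI impI)
  show "(if Y 0 \<in> \<int> then Y 0 else Y 0 + c) = 0" using Y by (simp add: real_path_def)
next
  fix i assume "i < n"
  then have i: "Y i \<le> Y (Suc i)" "Y (Suc i) \<le> Y i + 1" "i \<le> n" "Suc i \<le> n"
    using Y by (auto simp: real_path_def)
  have I: "real_of_int \<lfloor>Y j\<rfloor> = Y j" if "Y j \<in> \<int>" for j using that by (simp add: of_int_floor_cancel)
  have N: "real_of_int \<lfloor>Y j\<rfloor> < Y j" if "Y j \<notin> \<int>" for j
    using that by (metis Ints_of_int of_int_floor_le order_le_less)
  consider "Y i \<in> \<int>" "Y (Suc i) \<in> \<int>" | "Y i \<notin> \<int>" "Y (Suc i) \<notin> \<int>"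
    | "Y i \<in> \<int>" "Y (Suc i) \<notin> \<int>" | "Y i \<notin> \<int>" "Y (Suc i) \<in> \<int>" by blast
  then have "(if Y i \<in> \<int> then Y i else Y i + c) \<le> (if Y (Suc i) \<in> \<int> then Y (Suc i) else Y (Suc i) + c) \<and>
    (if Y (Suc i) \<in> \<int> then Y (Suc i) else Y (Suc i) + c) \<le> (if Y i \<in> \<int> then Y i else Y i + c) + 1"
  proof cases
    case 3
    then have "\<lfloor>Y (Suc i)\<rfloor> = \<lfloor>Y i\<rfloor>" using i I[of i] N[of "Suc i"]
      by (smt (verit) floor_correct floor_mono of_int_1 of_int_add of_int_less_iff)
    then show ?thesis using c[OF i(4)] 3 I[of i] by auto
  next
    case 4
    then have "Y (Suc i) = real_of_int \<lfloor>Y i\<rfloor> + 1" using i I[of "Suc i"] N[of i]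
      by (smt (verit) floor_correct floor_mono of_int_1 of_int_add of_int_less_iff)
    then show ?thesis using c[OF i(3)] 4 by auto
  qed (use i in auto)
  then show "(if Y i \<in> \<int> then Y i else Y i + c) \<le> (if Y (Suc i) \<in> \<int> then Y (Suc i) else Y (Suc i) + c)"
    "(if Y (Suc i) \<in> \<int> then Y (Suc i) else Y (Suc i) + c) \<le> (if Y i \<in> \<int> then Y i else Y i + c) + 1"
    by blast+
next
  fix i assume "i \<le> n"
  then have i: "real_of_int (l i) \<le> Y i" "Y i \<le> real_of_int (u i)" "i \<le> n"
    using Y by (auto simp: real_path_def)
  have "l i \<le> \<lfloor>Y i\<rfloor>" using i by (simp add: le_floor_iff)
  then have 1: "real_of_int (l i) \<le> real_of_int \<lfloor>Y i\<rfloor>" by simp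
  have 2: "real_of_int \<lfloor>Y i\<rfloor> + 1 \<le> real_of_int (u i)" if "Y i \<notin> \<int>"
  proof -
    have "Y i < real_of_int (u i)" using that i by (metis Ints_of_int order_le_less)
    then have "\<lfloor>Y i\<rfloor> < u i" by (simp add: floor_less_iff)
    then show ?thesis by linarith
  qed
  show "real_of_int (l i) \<le> (if Y i \<in> \<int> then Y i else Y i + c)"
    "(if Y i \<in> \<int> then Y i else Y i + c) \<le> real_of_int (u i)"
    using i 1 2 c[of i] by (auto intro: order_trans)
qed

lemma path_vec_combination:
  assumes "distinct xs" "a + b = 1"
    and "\<And>i. i \<le> length xs \<Longrightarrow> Y i = a * Y1 i + b * Y2 i"
  shows "path_vec xs Y = a *\<^sub>R path_vec xs Y1 + b *\<^sub>R path_vec xs Y2"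
  using assms by (intro path_vec_eqI) (auto simp: lookup_add lookup_scaleR lookup_path_vec algebra_simps)

text \<open>Moving all fractional prefix sums simultaneously up, or simultaneously down, until one of
  them becomes an integer keeps the path admissible; this replaces total unimodularity.\<close>

lemma path_vec_in_hull:
  assumes xs: "distinct xs" and Y: "real_path (length xs) l u Y"
  shows "path_vec xs Y \<in> convex hull (indicator_vec ` lp xs l u)"
  using Y
proof (induction "card {i. i \<le> length xs \<and> Y i \<notin> \<int>}" arbitrary: Y rule: less_induct)
  case less
  define n where "n = length xs"
  define I where "I = {i. i \<le> n \<and> Y i \<notin> \<int>}"
  have fin: "finite I" by (simp add: I_def)
  note Y = less.prems[folded n_def]
  show ?case
  proof (cases "I = {}")
    case True
    \<comment> \<open>With all heights integral the path is an honest lattice path, and its vector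
      is the vertex of a basis.\<close>
    define q where "q i = \<lfloor>Y i\<rfloor>" for i
    have q: "Y i = real_of_int (q i)" if "i \<le> n" for i
      using True that by (auto simp: I_def q_def of_int_floor_cancel)
    have step: "q (Suc i) = q i \<or> q (Suc i) = q i + 1" if i: "i < length xs" for i
    proof -
      have "real_of_int (q i) \<le> real_of_int (q (Suc i))" "real_of_int (q (Suc i)) \<le> real_of_int (q i + 1)"
        using Y q[of i] q[of "Suc i"] i by (auto simp: real_path_def n_def)
      then show ?thesis by (simp only: of_int_le_iff) linarith
    qed
    have bd: "l i \<le> q i \<and> q i \<le> u i" if i: "i \<le> length xs" for i
      using Y q[of i] i by (auto simp: real_path_def n_def)
    have q0: "q 0 = 0" using Y by (simp add: real_path_def q_def)
    have "path_set xs q \<in> lp xs l u" using path_set_in_lp[of xs q l u] xs q0 step bd by blast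
    moreover have "path_vec xs Y = indicator_vec (path_set xs q)"
    proof (rule path_vec_eqI[OF xs])
      have sub: "path_set xs q \<subseteq> set xs" by (auto simp: path_set_def)
      then have "finite (path_set xs q)" by (rule finite_subset) simp
      note * = lookup_indicator_vec[OF this]
      show "Poly_Mapping.lookup (indicator_vec (path_set xs q)) e = 0" if "e \<notin> set xs" for e
        using that sub by (auto simp: *)
      show "Poly_Mapping.lookup (indicator_vec (path_set xs q)) (xs ! i) = Y (Suc i) - Y i"
        if "i < length xs" for i
        using that step[OF that] q[of i] q[of "Suc i"] by (auto simp: * nth_mem_path_set[OF xs] n_def)
    qed
    ultimately show ?thesis by (simp add: hull_inc)
  next
    case False
    \<comment> \<open>The largest common shifts allowed: \<open>t\<close> downwards and
      \<open>s\<close> upwards. Each makes at least one fractional height integral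
      (\<open>it\<close> and \<open>si\<close>) and no integral height fractional, so the induction
      measure drops.\<close>
    define t where "t = Min ((\<lambda>i. frac (Y i)) ` I)"
    define s where "s = Min ((\<lambda>i. 1 - frac (Y i)) ` I)"
    have "t \<in> (\<lambda>i. frac (Y i)) ` I" unfolding t_def using fin False by (intro Min_in) auto
    then obtain it where it: "it \<in> I" "t = frac (Y it)" by blast
    have "s \<in> (\<lambda>i. 1 - frac (Y i)) ` I" unfolding s_def using fin False by (intro Min_in) auto
    then obtain si where si: "si \<in> I" "s = 1 - frac (Y si)" by blast
    have tle: "t \<le> frac (Y i)" and sle: "s \<le> 1 - frac (Y i)" if "i \<in> I" for i
      using fin that by (auto simp: t_def s_def)
    have pos: "t > 0" "s > 0"
      using it si by (auto simp: I_def frac_gt_0_iff frac_lt_1)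
    define Y1 where "Y1 i = (if Y i \<in> \<int> then Y i else Y i + s)" for i
    define Y2 where "Y2 i = (if Y i \<in> \<int> then Y i else Y i + - t)" for i
    have p1: "real_path n l u Y1" unfolding Y1_def
    proof (rule real_path_shift[OF Y])
      fix i assume "i \<le> n" "Y i \<notin> \<int>"
      then have "s \<le> 1 - frac (Y i)" using sle by (simp add: I_def)
      then show "real_of_int \<lfloor>Y i\<rfloor> \<le> Y i + s \<and> Y i + s \<le> real_of_int \<lfloor>Y i\<rfloor> + 1"
        using pos frac_ge_0[of "Y i"] unfolding frac_def by linarith
    qed
    have p2: "real_path n l u Y2" unfolding Y2_def
    proof (rule real_path_shift[OF Y])
      fix i assume "i \<le> n" "Y i \<notin> \<int>"
      then have "t \<le> frac (Y i)" using tle by (simp add: I_def)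
      then show "real_of_int \<lfloor>Y i\<rfloor> \<le> Y i + - t \<and> Y i + - t \<le> real_of_int \<lfloor>Y i\<rfloor> + 1"
        using pos frac_lt_1[of "Y i"] unfolding frac_def by linarith
    qed
    have "Y si + s = real_of_int (\<lfloor>Y si\<rfloor> + 1)" using si by (simp add: frac_def)
    then have "Y si + s \<in> \<int>" by (metis Ints_of_int)
    then have "{i. i \<le> n \<and> Y1 i \<notin> \<int>} \<subseteq> I - {si}" by (auto simp: I_def Y1_def)
    then have c1: "card {i. i \<le> n \<and> Y1 i \<notin> \<int>} < card I"
      using si(1) fin by (meson card_Diff1_less card_mono finite_Diff le_less_trans)
    have "Y it + - t = real_of_int \<lfloor>Y it\<rfloor>" using it by (simp add: frac_def)
    then have "Y it + - t \<in> \<int>" by (metis Ints_of_int)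
    then have "{i. i \<le> n \<and> Y2 i \<notin> \<int>} \<subseteq> I - {it}" by (auto simp: I_def Y2_def)
    then have c2: "card {i. i \<le> n \<and> Y2 i \<notin> \<int>} < card I"
      using it(1) fin by (meson card_Diff1_less card_mono finite_Diff le_less_trans)
    have h1: "path_vec xs Y1 \<in> convex hull (indicator_vec ` lp xs l u)"
      using less.hyps[of Y1] c1 p1 by (simp add: I_def n_def)
    have h2: "path_vec xs Y2 \<in> convex hull (indicator_vec ` lp xs l u)"
      using less.hyps[of Y2] c2 p2 by (simp add: I_def n_def)
    \<comment> \<open>The weights are crosswise: moving up by \<open>s\<close> with weight
      \<open>t / (s + t)\<close> cancels moving down by \<open>t\<close> with weight
      \<open>s / (s + t)\<close>.\<close>
    have one: "t / (s + t) + s / (s + t) = 1" using pos by (simp add: add.commute[of s t] flip: add_divide_distrib)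
    have "Y i = t / (s + t) * Y1 i + s / (s + t) * Y2 i" for i
    proof (cases "Y i \<in> \<int>")
      case True
      have "t / (s + t) * Y1 i + s / (s + t) * Y2 i = (t / (s + t) + s / (s + t)) * Y i"
        using True unfolding distrib_right by (simp add: Y1_def Y2_def)
      then show ?thesis using one by simp
    next
      case False
      have "t / (s + t) * Y1 i + s / (s + t) * Y2 i = (t / (s + t) + s / (s + t)) * Y i"
        using False by (simp add: Y1_def Y2_def field_split_simps)
      then show ?thesis using one by simp
    qed
    then have "path_vec xs Y = (t / (s + t)) *\<^sub>R path_vec xs Y1 + (s / (s + t)) *\<^sub>R path_vec xs Y2"
      by (intro path_vec_combination[OF xs one])
    then show ?thesis
      using h1 h2 pos one convexD[OF convex_convex_hull h1 h2, of "t / (s + t)" "s / (s + t)"] by simp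
  qed
qed

text \<open>A point of the polytope is the \<open>path_vec\<close> of its own prefix sums, which
  form a fractional lattice path; this gives the hard inclusion. The equality lets pieces of the
  hypersimplex be handled by inequalities while remaining base polytopes.\<close>

lemma hull_lp:
  assumes xs: "distinct xs"
  shows "convex hull (indicator_vec ` lp xs l u) = lp_polytope xs l u"
proof
  show "convex hull (indicator_vec ` lp xs l u) \<subseteq> lp_polytope xs l u"
  proof (rule hull_minimal[where S = convex, OF _ convex_lp_polytope], clarify)
    fix B assume B: "B \<in> lp xs l u"
    have fin: "finite B" using lp_D(1)[OF B] finite_subset by auto
    show "indicator_vec B \<in> lp_polytope xs l u"
      unfolding lp_polytope_def
    proof (intro CollectI conjI allI impI)
      fix i assume i: "i \<le> length xs"
      have *: "psum xs (indicator_vec B) i = real_of_int (int (card (B \<inter> set (take i xs))))"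
        unfolding psum_def by (subst sum_indicator_vec[OF fin]) auto
      show "real_of_int (l i) \<le> psum xs (indicator_vec B) i"
        "psum xs (indicator_vec B) i \<le> real_of_int (u i)"
        unfolding * of_int_le_iff using lp_D[OF B] i by auto
    qed (use lp_D(1)[OF B] in \<open>auto simp: lookup_indicator_vec[OF fin]\<close>)
  qed
next
  show "lp_polytope xs l u \<subseteq> convex hull (indicator_vec ` lp xs l u)"
  proof
    fix p assume p: "p \<in> lp_polytope xs l u"
    have "path_vec xs (psum xs p) = p"
      using p by (intro path_vec_eqI xs) (auto simp: lp_polytope_def psum_Suc[OF xs])
    moreover have "real_path (length xs) l u (psum xs p)"
      using p by (auto simp: real_path_def psum_0 psum_Suc[OF xs] lp_polytope_def)
    ultimately show "p \<in> convex hull (indicator_vec ` lp xs l u)"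
      using path_vec_in_hull[OF xs] by metis
  qed
qed

section \<open>Circuits and direct sums\<close>

lemma loop_iff: "loop M e \<longleftrightarrow> e \<in> ground M \<and> (\<forall>B\<in>bases M. e \<notin> B)"
  using bases_nonempty[of M]
  by (auto simp: loop_def circuit_def dependent_set_def indep_def psubset_eq subset_singleton_iff)

lemma coloop_iff: "coloop M e \<longleftrightarrow> e \<in> ground M \<and> (\<forall>B\<in>bases M. e \<in> B)"
  by (auto simp: coloop_def loop_iff ground_dual bases_dual)

lemma dual_dual: "dual (dual M) = M"
proof (rule matroid_eqI)
  have "ground M - (ground M - B) = B" if "B \<in> bases M" for B
    using bases_subset_ground[OF that] by blast
  then show "bases (dual (dual M)) = bases M"
    by (auto simp: bases_dual ground_dual image_image)
qed (simp add: ground_dual)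

text \<open>The fundamental circuit of \<open>x\<close> with respect to \<open>B\<close>, found as a
  smallest dependent subset of \<open>insert x B\<close>. It contains \<open>x\<close> because
  \<open>B\<close> is independent, and \<open>y\<close> because \<open>insert x (B - {y})\<close>
  is. All connectivity proofs below rest on such a pair of adjacent bases.\<close>

lemma common_circuit:
  assumes B: "B \<in> bases M" "y \<in> B" "x \<notin> B" "insert x (B - {y}) \<in> bases M"
  shows "\<exists>C. circuit M C \<and> x \<in> C \<and> y \<in> C"
proof -
  have finB: "finite B" using B(1) bases_subset_ground finite_ground finite_subset by metis
  have x: "x \<in> ground M" using B(4) bases_subset_ground by blast
  have "\<not> indep M (insert x B)"
  proof
    assume "indep M (insert x B)"
    then obtain B' where B': "B' \<in> bases M" "insert x B \<subseteq> B'" by (auto simp: indep_def)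
    then have "card (insert x B) \<le> card B'"
      using bases_subset_ground finite_ground finite_subset card_mono by metis
    then show False using finB B(1,3) B'(1) by (simp add: card_basis)
  qed
  then have dep: "dependent_set M (insert x B)"
    using x bases_subset_ground[OF B(1)] by (simp add: dependent_set_def)
  define P where "P C \<longleftrightarrow> C \<subseteq> insert x B \<and> dependent_set M C" for C
  have "P (insert x B)" using dep by (simp add: P_def)
  then obtain C where C: "P C" and min: "\<And>D. P D \<Longrightarrow> card C \<le> card D"
    using ex_has_least_nat[of P _ card] by auto
  have "indep M X" if X: "X \<subset> C" for X
  proof (rule ccontr)
    assume "\<not> indep M X"
    then have "P X" using X C by (auto simp: P_def dependent_set_def)
    moreover have "finite C" using C finB finite_subset by (auto simp: P_def)
    then have "card X < card C" using X by (rule psubset_card_mono)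
    ultimately show False using min[of X] by simp
  qed
  moreover have "x \<in> C" "y \<in> C"
    using C B(1,4) by (auto simp: P_def dependent_set_def indep_def)
  ultimately show ?thesis using C by (auto simp: circuit_def P_def)
qed

section \<open>Circuits and components of direct sums\<close>

context
  fixes N :: matroid and m :: nat and Ms :: "nat \<Rightarrow> matroid"
  assumes sum: "is_direct_sum N m Ms"
begin

lemma direct_sum_ground: "ground N = (\<Union>i<m. ground (Ms i))"
  using sum by (simp add: is_direct_sum_def)

lemma direct_sum_disjoint:
  "i < m \<Longrightarrow> j < m \<Longrightarrow> x \<in> ground (Ms i) \<Longrightarrow> x \<in> ground (Ms j) \<Longrightarrow> i = j"
  using sum by (auto simp: is_direct_sum_def disjoint_family_on_def)

lemma direct_sum_indep_iff:
  assumes "X \<subseteq> ground N"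
  shows "indep N X \<longleftrightarrow> (\<forall>i<m. indep (Ms i) (X \<inter> ground (Ms i)))"
proof
  assume "indep N X"
  then obtain B where B: "\<forall>i<m. B i \<in> bases (Ms i)" "X \<subseteq> (\<Union>i<m. B i)"
    using sum by (auto simp: indep_def is_direct_sum_def)
  show "\<forall>i<m. indep (Ms i) (X \<inter> ground (Ms i))"
  proof (intro allI impI)
    fix i assume i: "i < m"
    have "X \<inter> ground (Ms i) \<subseteq> B i"
    proof
      fix x assume x: "x \<in> X \<inter> ground (Ms i)"
      then obtain j where j: "j < m" "x \<in> B j" using B(2) by blast
      then have "x \<in> ground (Ms j)" using B(1) bases_subset_ground by blast
      then show "x \<in> B i" using direct_sum_disjoint[OF i j(1)] x j by blast
    qed
    then show "indep (Ms i) (X \<inter> ground (Ms i))" using B(1) i by (auto simp: indep_def)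
  qed
next
  assume "\<forall>i<m. indep (Ms i) (X \<inter> ground (Ms i))"
  then obtain B where B: "\<And>i. i < m \<Longrightarrow> B i \<in> bases (Ms i) \<and> X \<inter> ground (Ms i) \<subseteq> B i"
    unfolding indep_def by metis
  then have "(\<Union>i<m. B i) \<in> bases N" using sum by (auto simp: is_direct_sum_def)
  moreover have "X \<subseteq> (\<Union>i<m. B i)" using B assms direct_sum_ground by blast
  ultimately show "indep N X" by (auto simp: indep_def)
qed

lemma direct_sum_circuit:
  assumes i: "i < m" and C: "circuit (Ms i) C"
  shows "circuit N C"
proof -
  have sub: "C \<subseteq> ground (Ms i)" using C by (simp add: circuit_def dependent_set_def)
  then have subN: "C \<subseteq> ground N" using i direct_sum_ground by blast
  have empty: "X \<inter> ground (Ms j) = {}" if "j < m" "j \<noteq> i" "X \<subseteq> C" for X j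
    using direct_sum_disjoint[OF i that(1)] that sub by blast
  have emptyI: "indep (Ms j) {}" for j using bases_nonempty by (auto simp: indep_def)
  have *: "indep N X \<longleftrightarrow> indep (Ms i) X" if X: "X \<subseteq> C" for X
  proof -
    have "X \<inter> ground (Ms i) = X" using X sub by blast
    then show ?thesis
      using X subN i emptyI empty[OF _ _ X] by (subst direct_sum_indep_iff) force+
  qed
  show ?thesis
    using C subN * by (auto simp: circuit_def dependent_set_def)
qed

lemma direct_sum_circuit_subset:
  assumes C: "circuit N C" and x: "x \<in> C" "x \<in> ground (Ms i)" "i < m"
  shows "C \<subseteq> ground (Ms i)"
proof (rule ccontr)
  assume *: "\<not> C \<subseteq> ground (Ms i)"
  have subN: "C \<subseteq> ground N" using C by (simp add: circuit_def dependent_set_def)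
  have "indep (Ms j) (C \<inter> ground (Ms j))" if j: "j < m" for j
  proof -
    \<comment> \<open>For \<open>j = i\<close> the trace is proper by the assumption refuted here,
      and for any other \<open>j\<close> because it misses \<open>x\<close>. So every trace is
      independent, and with them \<open>C\<close>.\<close>
    have "C \<inter> ground (Ms j) \<subset> C" using * x direct_sum_disjoint[OF x(3) j x(2)] by blast
    then have "indep N (C \<inter> ground (Ms j))" using C by (simp add: circuit_def)
    then have "indep (Ms j) (C \<inter> ground (Ms j) \<inter> ground (Ms j))"
      using j subN by (subst (asm) direct_sum_indep_iff) auto
    then show ?thesis by simp
  qed
  then have "indep N C" using subN by (simp add: direct_sum_indep_iff)
  then show False using C by (simp add: circuit_def dependent_set_def)
qed

text \<open>No circuit straddles two summands, and circuits of a summand remain circuits of the sum.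
  Thus the class of a point is exactly the ground set of its summand, and nonempty disjoint ground
  sets give distinct classes.\<close>

lemma num_components_direct_sum:
  assumes ne: "\<And>i. i < m \<Longrightarrow> ground (Ms i) \<noteq> {}"
    and conn: "\<And>i x y. i < m \<Longrightarrow> x \<in> ground (Ms i) \<Longrightarrow> y \<in> ground (Ms i) \<Longrightarrow> x \<noteq> y
      \<Longrightarrow> \<exists>C. circuit (Ms i) C \<and> x \<in> C \<and> y \<in> C"
  shows "num_components N = m"
proof -
  have cls: "connection_rel N `` {x} = ground (Ms i)" if x: "x \<in> ground (Ms i)" "i < m" for x i
  proof -
    have "(x, y) \<in> connection_rel N \<longleftrightarrow> y \<in> ground (Ms i)" for y
    proof
      assume "(x, y) \<in> connection_rel N"
      then show "y \<in> ground (Ms i)"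
        using direct_sum_circuit_subset[OF _ _ x] x by (auto simp: connection_rel_def)
    next
      assume y: "y \<in> ground (Ms i)"
      then have "x \<in> ground N" "y \<in> ground N" using x direct_sum_ground by blast+
      then show "(x, y) \<in> connection_rel N"
        using conn[OF x(2) x(1) y] direct_sum_circuit[OF x(2)]
        unfolding connection_rel_def by blast
    qed
    then show ?thesis by blast
  qed
  have "ground N // connection_rel N = (\<lambda>i. ground (Ms i)) ` {..<m}"
  proof
    show "ground N // connection_rel N \<subseteq> (\<lambda>i. ground (Ms i)) ` {..<m}"
      using cls by (auto simp: quotient_def direct_sum_ground)
    show "(\<lambda>i. ground (Ms i)) ` {..<m} \<subseteq> ground N // connection_rel N"
    proof clarsimp
      fix i assume i: "i < m"
      then obtain x where x: "x \<in> ground (Ms i)" using ne by blast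
      then have "x \<in> ground N" using i direct_sum_ground by blast
      then show "ground (Ms i) \<in> ground N // connection_rel N"
        using cls[OF x i] by (auto simp: quotient_def)
    qed
  qed
  moreover have "inj_on (\<lambda>i. ground (Ms i)) {..<m}"
    using ne direct_sum_disjoint by (fastforce intro!: inj_onI)
  ultimately show ?thesis by (simp add: num_components_def card_image)
qed

end

lemma is_direct_sum_append:
  assumes N: "is_direct_sum N m Ms" and g: "ground N' = ground N \<union> ground K"
    and dis: "ground N \<inter> ground K = {}"
    and b: "bases N' = {A \<union> B |A B. A \<in> bases N \<and> B \<in> bases K}"
  shows "is_direct_sum N' (Suc m) (Ms(m := K))"
  unfolding is_direct_sum_def
proof (intro conjI)
  have gN: "ground N = (\<Union>i<m. ground (Ms i))" using N by (simp add: is_direct_sum_def)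
  then have "ground (Ms i) \<inter> ground K = {}" if "i < m" for i using dis that by blast
  then show "disjoint_family_on (\<lambda>i. ground ((Ms(m := K)) i)) {..<Suc m}"
    using direct_sum_disjoint[OF N] unfolding disjoint_family_on_def
    by (auto simp: less_Suc_eq disjoint_iff)
  show "ground N' = (\<Union>i<Suc m. ground ((Ms(m := K)) i))"
    using g gN by (auto simp: lessThan_Suc)
  have bN: "bases N = {\<Union>i<m. B i |B. \<forall>i<m. B i \<in> bases (Ms i)}"
    using N by (simp add: is_direct_sum_def)
  show "bases N' = {\<Union>i<Suc m. B i |B. \<forall>i<Suc m. B i \<in> bases ((Ms(m := K)) i)}" (is "_ = ?R")
  proof
    show "bases N' \<subseteq> ?R"
    proof
      fix X assume "X \<in> bases N'"
      then obtain B C where X: "X = (\<Union>i<m. B i) \<union> C" "\<forall>i<m. B i \<in> bases (Ms i)" "C \<in> bases K"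
        unfolding b bN by blast
      then have "X = (\<Union>i<Suc m. (B(m := C)) i) \<and> (\<forall>i<Suc m. (B(m := C)) i \<in> bases ((Ms(m := K)) i))"
        by (auto simp: lessThan_Suc less_Suc_eq)
      then show "X \<in> ?R" by blast
    qed
    show "?R \<subseteq> bases N'"
    proof
      fix X assume "X \<in> ?R"
      then obtain B where X: "X = (\<Union>i<Suc m. B i)" "\<forall>i<Suc m. B i \<in> bases ((Ms(m := K)) i)" by blast
      have "X = (\<Union>i<m. B i) \<union> B m" using X by (auto simp: lessThan_Suc)
      moreover have "(\<Union>i<m. B i) \<in> bases N" unfolding bN using X(2)
        by (auto intro!: exI[of _ B] simp: less_Suc_eq)
      moreover have "B m \<in> bases K" using X(2) by auto
      ultimately show "X \<in> bases N'" unfolding b by blast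
    qed
  qed
qed

section \<open>Snakes\<close>

text \<open>For bounds at distance at most one, this excludes exactly the loops and coloops.
  A position with \<open>l i = u i\<close> splits the matroid into a direct sum; a snake has none in its interior.\<close>

definition lp_valid :: "nat \<Rightarrow> (nat \<Rightarrow> int) \<Rightarrow> (nat \<Rightarrow> int) \<Rightarrow> bool" where
  "lp_valid n l u \<longleftrightarrow> l 0 = 0 \<and> u 0 = 0 \<and> l n = u n \<and>
     (\<forall>i\<le>n. l i \<le> u i \<and> u i \<le> l i + 1) \<and> (\<forall>i<n. l (Suc i) \<le> u i \<and> l i < u (Suc i))"

text \<open>The last four facts say that both bounds are themselves lattice paths. They come from
  the gap condition: \<open>l (Suc i) \<le> u i \<le> l i + 1\<close> and
  \<open>l i < u (Suc i) \<le> l (Suc i) + 1\<close>, and likewise for \<open>u\<close>.\<close>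

lemma lp_validD:
  assumes "lp_valid n l u"
  shows "l 0 = 0" "u 0 = 0" "l n = u n"
    and "i \<le> n \<Longrightarrow> l i \<le> u i" and "i \<le> n \<Longrightarrow> u i \<le> l i + 1"
    and "i < n \<Longrightarrow> l (Suc i) \<le> u i" and "i < n \<Longrightarrow> l i < u (Suc i)"
    and "i < n \<Longrightarrow> l i \<le> l (Suc i)" and "i < n \<Longrightarrow> l (Suc i) \<le> l i + 1"
    and "i < n \<Longrightarrow> u i \<le> u (Suc i)" and "i < n \<Longrightarrow> u (Suc i) \<le> u i + 1"
proof -
  show "l 0 = 0" "u 0 = 0" "l n = u n" using assms by (simp_all add: lp_valid_def)
  show "i \<le> n \<Longrightarrow> l i \<le> u i" "i \<le> n \<Longrightarrow> u i \<le> l i + 1"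
    "i < n \<Longrightarrow> l (Suc i) \<le> u i" "i < n \<Longrightarrow> l i < u (Suc i)"
    using assms by (simp_all add: lp_valid_def)
  assume i: "i < n"
  have "l i \<le> u i" "u i \<le> l i + 1" "l (Suc i) \<le> u (Suc i)" "u (Suc i) \<le> l (Suc i) + 1"
    "l (Suc i) \<le> u i" "l i < u (Suc i)" using assms i by (simp_all add: lp_valid_def)
  then show "l i \<le> l (Suc i)" "l (Suc i) \<le> l i + 1" "u i \<le> u (Suc i)" "u (Suc i) \<le> u i + 1"
    by linarith+
qed

lemma lp_valid_mono:
  assumes v: "lp_valid n l u" and ij: "i \<le> j" "j \<le> n"
  shows "l i \<le> l j" "u i \<le> u j"
  using ij
proof (induction j rule: dec_induct)
  case (step j)
  { case 1 then show ?case using step lp_validD(8)[OF v, of j] by simp }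
  { case 2 then show ?case using step lp_validD(10)[OF v, of j] by simp }
qed simp_all

lemma lp_valid_nonempty:
  assumes "distinct xs" "lp_valid (length xs) l u"
  shows "lp xs l u \<noteq> {}"
proof -
  have "path_set xs l \<in> lp xs l u"
  proof (rule path_set_in_lp[OF assms(1)])
    show "l (Suc i) = l i \<or> l (Suc i) = l i + 1" if "i < length xs" for i
      using lp_validD(8,9)[OF assms(2) that] by linarith
  qed (use lp_validD[OF assms(2)] in auto)
  then show ?thesis by blast
qed

text \<open>Clamping the upper or the lower bound at a constant keeps unit steps. This yields bases with
  prescribed behaviour between the positions \<open>a\<close> and \<open>b\<close>.\<close>

definition detour ::
  "(nat \<Rightarrow> int) \<Rightarrow> (nat \<Rightarrow> int) \<Rightarrow> nat \<Rightarrow> int \<Rightarrow> (nat \<Rightarrow> int) \<Rightarrow> nat \<Rightarrow> int \<Rightarrow> nat \<Rightarrow> int" where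
  "detour l u a c h b d t = (if t \<le> a then min (u t) c else if t \<le> b then h t else max (l t) d)"

lemma detour_step:
  assumes v: "lp_valid n l u" and ab: "a \<le> b" "b < n" and i: "i < n"
    and c: "l a \<le> c" "c \<le> u a" and d: "l (Suc b) \<le> d" "d \<le> u (Suc b)"
    and h: "\<And>t. a < t \<Longrightarrow> t < b \<Longrightarrow> h (Suc t) = h t \<or> h (Suc t) = h t + 1"
    and ha: "a < b \<Longrightarrow> h (Suc a) = c \<or> h (Suc a) = c + 1"
    and hb: "a < b \<Longrightarrow> d = h b \<or> d = h b + 1"
    and cd: "a = b \<Longrightarrow> d = c \<or> d = c + 1"
  shows "detour l u a c h b d (Suc i) = detour l u a c h b d i
    \<or> detour l u a c h b d (Suc i) = detour l u a c h b d i + 1"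
proof -
  note st = lp_validD(8-11)[OF v i]
  consider "i < a" | "i = a" "a < b" | "i = a" "a = b" | "a < i" "i < b" | "a < i" "i = b" | "b < i"
    using ab by linarith
  then show ?thesis
  proof cases
    case 1 then show ?thesis using st by (simp add: detour_def min_def) linarith
  next
    case 2 then show ?thesis using ha c by (simp add: detour_def)
  next
    case 3 then show ?thesis using cd c d by (simp add: detour_def)
  next
    case 4 then show ?thesis using h by (simp add: detour_def)
  next
    case 5 then show ?thesis using hb d by (simp add: detour_def)
  next
    case 6 then show ?thesis using ab st by (simp add: detour_def max_def) linarith
  qed
qed

text \<open>Up to \<open>a\<close> the height is \<open>u\<close> capped at \<open>c\<close>, which
  stays above \<open>l\<close> because \<open>l\<close> has not yet passed
  \<open>l a \<le> c\<close>. Beyond \<open>b\<close> it is \<open>l\<close> raised to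
  \<open>d\<close>, which stays below \<open>u\<close> because \<open>u\<close> is already at least
  \<open>u (Suc b) \<ge> d\<close>. In between \<open>h\<close> is free; for \<open>a = b\<close>
  that range is empty and the path steps directly from \<open>c\<close> to \<open>d\<close>.\<close>

lemma detour_in_lp:
  assumes xs: "distinct xs" and v: "lp_valid (length xs) l u" and ab: "a \<le> b" "b < length xs"
    and c: "l a \<le> c" "c \<le> u a" and d: "l (Suc b) \<le> d" "d \<le> u (Suc b)"
    and h: "\<And>t. a < t \<Longrightarrow> t < b \<Longrightarrow> h (Suc t) = h t \<or> h (Suc t) = h t + 1"
    and hbd: "\<And>t. a < t \<Longrightarrow> t \<le> b \<Longrightarrow> l t \<le> h t \<and> h t \<le> u t"
    and ha: "a < b \<Longrightarrow> h (Suc a) = c \<or> h (Suc a) = c + 1"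
    and hb: "a < b \<Longrightarrow> d = h b \<or> d = h b + 1"
    and cd: "a = b \<Longrightarrow> d = c \<or> d = c + 1"
  shows "path_set xs (detour l u a c h b d) \<in> lp xs l u"
proof (rule path_set_in_lp[OF xs])
  have "0 \<le> c" using c lp_valid_mono(1)[OF v, of 0 a] ab lp_validD(1)[OF v] by simp
  then show "detour l u a c h b d 0 = 0" using lp_validD(2)[OF v] by (simp add: detour_def)
  show "detour l u a c h b d (Suc i) = detour l u a c h b d i
    \<or> detour l u a c h b d (Suc i) = detour l u a c h b d i + 1" if "i < length xs" for i
    using detour_step[OF v ab that c d h ha hb cd] by blast
  show "l i \<le> detour l u a c h b d i \<and> detour l u a c h b d i \<le> u i" if i: "i \<le> length xs" for i
  proof -
    have "l i \<le> c" if "i \<le> a" using lp_valid_mono(1)[OF v that] c ab by simp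
    moreover have "d \<le> u i" if "b < i" using lp_valid_mono(2)[OF v, of "Suc b" i] i d that by simp
    ultimately show ?thesis using hbd[of i] lp_validD(4)[OF v i] by (simp add: detour_def)
  qed
qed

text \<open>The two step conditions of \<open>lp_valid\<close> are what is used:
  \<open>l i < u (Suc i)\<close> leaves room to climb from \<open>l i\<close> at step
  \<open>i\<close>, and \<open>l (Suc i) \<le> u i\<close> leaves room to pass it at the constant
  height \<open>l (Suc i)\<close>.\<close>

lemma lp_valid_mem:
  assumes xs: "distinct xs" and v: "lp_valid (length xs) l u" and i: "i < length xs"
  shows "\<exists>B\<in>lp xs l u. xs ! i \<in> B" "\<exists>B\<in>lp xs l u. xs ! i \<notin> B"
proof -
  note vi = lp_validD(4-11)[OF v]
  have "path_set xs (detour l u i (l i) l i (l i + 1)) \<in> lp xs l u"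
    using i vi[of i] by (intro detour_in_lp[OF xs v]) auto
  moreover have "xs ! i \<in> path_set xs (detour l u i (l i) l i (l i + 1))"
    using i vi[of i] by (simp add: nth_mem_path_set[OF xs] detour_def)
  ultimately show "\<exists>B\<in>lp xs l u. xs ! i \<in> B" by blast
  have "path_set xs (detour l u i (l (Suc i)) l i (l (Suc i))) \<in> lp xs l u"
    using i vi[of i] vi(1)[of "Suc i"] by (intro detour_in_lp[OF xs v]) auto
  moreover have "xs ! i \<notin> path_set xs (detour l u i (l (Suc i)) l i (l (Suc i)))"
    using i vi[of i] by (simp add: nth_mem_path_set[OF xs] detour_def)
  ultimately show "\<exists>B\<in>lp xs l u. xs ! i \<notin> B" by blast
qed

lemma lp_valid_no_loop:
  assumes "distinct xs" "lp_valid (length xs) l u" "ground N = set xs" "bases N = lp xs l u"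
  shows "\<not> loop N e" "\<not> coloop N e"
  using lp_valid_mem[OF assms(1,2)] assms(3,4)
  by (auto simp: loop_iff coloop_iff in_set_conv_nth)

text \<open>A nonempty family has \<open>l \<le> u\<close>, so validity can only fail at some step.
  If \<open>u i < l (Suc i)\<close> every path must climb there, which makes a coloop; if
  \<open>u (Suc i) \<le> l i\<close> none can, which makes a loop.\<close>

lemma lp_invalid_loop:
  assumes xs: "distinct xs" and N: "ground N = set xs" "bases N = lp xs l u"
    and ends: "l 0 = 0" "u 0 = 0" "l (length xs) = u (length xs)"
    and gap: "\<And>i. i \<le> length xs \<Longrightarrow> u i \<le> l i + 1"
    and nv: "\<not> lp_valid (length xs) l u"
  shows "\<exists>e. loop N e \<or> coloop N e"
proof -
  obtain B where B: "B \<in> lp xs l u" using bases_nonempty[of N] N by auto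
  have "l i \<le> u i" if "i \<le> length xs" for i
    using lp_D(2,3)[OF B that] by linarith
  then obtain i where i: "i < length xs" "u i < l (Suc i) \<or> u (Suc i) \<le> l i"
    using nv ends gap by (auto simp: lp_valid_def not_less not_le)
  have card: "int (card (C \<inter> set (take (Suc i) xs)))
      = int (card (C \<inter> set (take i xs))) + (if xs ! i \<in> C then 1 else 0)" for C
    using card_take_Suc[OF xs i(1)] by simp
  have bd: "l i \<le> int (card (C \<inter> set (take i xs)))" "int (card (C \<inter> set (take i xs))) \<le> u i"
    "l (Suc i) \<le> int (card (C \<inter> set (take (Suc i) xs)))"
    "int (card (C \<inter> set (take (Suc i) xs))) \<le> u (Suc i)" if "C \<in> lp xs l u" for C
    using lp_D(2,3)[OF that, of i] lp_D(2,3)[OF that, of "Suc i"] i(1) by simp_all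
  have mem: "xs ! i \<in> ground N" using N i by simp
  from i(2) show ?thesis
  proof
    assume *: "u i < l (Suc i)"
    have "xs ! i \<in> C" if "C \<in> lp xs l u" for C
      using bd[OF that] * card[of C] by (auto split: if_splits)
    then show ?thesis using mem N by (auto simp: coloop_iff)
  next
    assume *: "u (Suc i) \<le> l i"
    have "xs ! i \<notin> C" if "C \<in> lp xs l u" for C
      using bd[OF that] * card[of C] by (auto split: if_splits)
    then show ?thesis using mem N by (auto simp: loop_iff)
  qed
qed

section \<open>Snakes are connected and series-parallel\<close>

definition snake :: "nat \<Rightarrow> (nat \<Rightarrow> int) \<Rightarrow> (nat \<Rightarrow> int) \<Rightarrow> bool" where
  "snake n l u \<longleftrightarrow> lp_valid n l u \<and> 0 < n \<and> (\<forall>i. 0 < i \<and> i < n \<longrightarrow> l i < u i)"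

lemma snakeD:
  assumes "snake n l u"
  shows "lp_valid n l u" "2 \<le> n" "0 < i \<Longrightarrow> i < n \<Longrightarrow> u i = l i + 1"
proof -
  show v: "lp_valid n l u" using assms by (simp add: snake_def)
  \<comment> \<open>Length one contradicts the common end:
    \<open>l 1 \<le> u 0 = 0 = l 0 < u 1\<close>, whereas \<open>l 1 = u 1\<close>.\<close>
  have "n \<noteq> 1" using lp_validD(1-3)[OF v] lp_validD(6,7)[OF v, of 0] by auto
  then show "2 \<le> n" using assms by (simp add: snake_def)
  show "0 < i \<Longrightarrow> i < n \<Longrightarrow> u i = l i + 1"
    using assms lp_validD(4,5)[OF v, of i] by (force simp: snake_def)
qed

text \<open>For positions \<open>i < j\<close> take two paths that agree up to \<open>i\<close> and
  after \<open>j\<close> and run along \<open>l\<close> and along \<open>u = l + 1\<close> in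
  between. One climbs at \<open>j\<close> and not at \<open>i\<close>, the other at \<open>i\<close>
  and not at \<open>j\<close>, and all other steps coincide. They are therefore adjacent bases, and
  \<open>common_circuit\<close> applies.\<close>

lemma snake_connected:
  assumes xs: "distinct xs" and s: "snake (length xs) l u"
    and N: "ground N = set xs" "bases N = lp xs l u"
    and x: "x \<in> ground N" and y: "y \<in> ground N" and xy: "x \<noteq> y"
  shows "\<exists>C. circuit N C \<and> x \<in> C \<and> y \<in> C"
proof -
  have main: "\<exists>C. circuit N C \<and> xs ! i \<in> C \<and> xs ! j \<in> C" if ij: "i < j" "j < length xs" for i j
  proof -
    note v = snakeD(1)[OF s] and sd = snakeD(3)[OF s] and vd = lp_validD(4-11)[OF snakeD(1)[OF s]]
    define p where "p = detour l u i (l (Suc i)) l j (l j + 1)"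
    define q where "q = detour l u i (l (Suc i)) u j (l j + 1)"
    have gap: "u t = l t + 1" if "i < t" "t \<le> j" for t using sd[of t] that ij by simp
    have step: "l (Suc t) = l t \<or> l (Suc t) = l t + 1" if "t < j" for t
      using vd(5,6)[of t] that ij by fastforce
    have P: "path_set xs p \<in> lp xs l u" unfolding p_def
      using ij vd[of i] vd[of j] vd(1)[of "Suc i"] vd(1)
      by (intro detour_in_lp[OF xs v]) (auto simp: gap dest: step)
    have Q: "path_set xs q \<in> lp xs l u" unfolding q_def
      using ij vd[of i] vd[of j] vd(1)[of "Suc i"] vd(1)
      by (intro detour_in_lp[OF xs v]) (auto simp: gap dest: step)
    have pq: "p t = q t" if "t \<le> i \<or> j < t" for t using that ij by (auto simp: p_def q_def detour_def)
    have pq1: "q t = p t + 1" if "i < t" "t \<le> j" for t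
      using that by (auto simp: p_def q_def detour_def gap)
    have m: "xs ! t \<in> path_set xs w \<longleftrightarrow> w (Suc t) = w t + 1" if "t < length xs" for t w
      by (rule nth_mem_path_set[OF xs that])
    have pi: "p i = l (Suc i)" "p (Suc i) = l (Suc i)" "p j = l j" "p (Suc j) = l j + 1"
      using ij vd[of i] vd[of j] by (auto simp: p_def detour_def)
    have qi: "q i = l (Suc i)" "q (Suc i) = l (Suc i) + 1" "q j = l j + 1" "q (Suc j) = l j + 1"
      using pq[of i] pq1[of "Suc i"] pq1[of j] pq[of "Suc j"] pi ij by auto
    have "path_set xs q = insert (xs ! i) (path_set xs p - {xs ! j})"
    proof (rule set_eqI)
      fix z
      show "z \<in> path_set xs q \<longleftrightarrow> z \<in> insert (xs ! i) (path_set xs p - {xs ! j})"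
      proof (cases "z \<in> set xs")
        case False
        then show ?thesis using ij by (auto simp: path_set_def)
      next
        case True
        then obtain t where t: "t < length xs" "z = xs ! t" by (auto simp: in_set_conv_nth)
        have e: "xs ! t = xs ! i \<longleftrightarrow> t = i" "xs ! t = xs ! j \<longleftrightarrow> t = j"
          using t ij xs by (auto simp: nth_eq_iff_index_eq)
        have "q (Suc t) = q t + 1 \<longleftrightarrow> t = i \<or> p (Suc t) = p t + 1 \<and> t \<noteq> j"
        proof -
          consider "t = i" | "t = j" | "t < i \<or> j < t" | "i < t" "t < j" by linarith
          then show ?thesis
          proof cases
            case 3
            then have "q t = p t" "q (Suc t) = p (Suc t)" "t \<noteq> i" "t \<noteq> j"
              using pq[of t] pq[of "Suc t"] ij by auto
            then show ?thesis by simp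
          next
            case 4
            then have "q t = p t + 1" "q (Suc t) = p (Suc t) + 1" "t \<noteq> i" "t \<noteq> j"
              using pq1[of t] pq1[of "Suc t"] by auto
            then show ?thesis by auto
          qed (use qi pi ij in simp_all)
        qed
        then show ?thesis unfolding t(2) insert_iff Diff_iff singleton_iff m[OF t(1)] e by blast
      qed
    qed
    moreover have "xs ! j \<in> path_set xs p" "xs ! i \<notin> path_set xs p"
      using m ij pi by auto
    ultimately show ?thesis
      using common_circuit[of "path_set xs p" N "xs ! j" "xs ! i"] P Q N by simp
  qed
  obtain i j where ij: "x = xs ! i" "y = xs ! j" "i < length xs" "j < length xs"
    using x y N by (auto simp: in_set_conv_nth)
  then have "i \<noteq> j" using xy by auto
  then show ?thesis using main[of i j] main[of j i] ij by (auto simp: neq_iff)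
qed

lemma circuit_pair:
  assumes "{e, f} \<subseteq> ground M" "indep M {e}" "indep M {f}" "\<not> indep M {e, f}"
  shows "circuit M {e, f}"
proof -
  have "indep M X" if "X \<subset> {e, f}" for X
  proof -
    have "X \<subseteq> {e} \<or> X \<subseteq> {f}" using that by blast
    then show ?thesis using assms(2,3) by (auto simp: indep_def)
  qed
  then show ?thesis using assms by (simp add: circuit_def dependent_set_def)
qed

text \<open>The final height is \<open>l m + 1\<close> and the height at \<open>m\<close> is at
  least \<open>l m\<close>, so no basis contains both of the last two elements: they are parallel.
  Removing the last one leaves a shorter snake.\<close>

lemma snake_parallel_step:
  assumes xs: "distinct xs" "0 \<notin> set xs" and len: "length xs = Suc (Suc m)" and m: "0 < m"
    and s: "snake (length xs) l u" and lm: "l (Suc m) = l m"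
    and N: "ground N = set xs" "bases N = lp xs l u"
  defines "ys \<equiv> take (Suc m) xs"
  obtains M l' where "distinct ys" "snake (length ys) l' u" "ground M = set ys"
    "bases M = lp ys l' u" "parallel_extension M N"
proof -
  define e where "e = xs ! Suc m"
  define f where "f = xs ! m"
  \<comment> \<open>Without \<open>e\<close> the rank \<open>l m + 1\<close> is already attained at
    position \<open>Suc m\<close>, so the lower bound is raised there to meet
    \<open>u\<close>.\<close>
  define l' where "l' = l(Suc m := u (Suc m))"
  note v = snakeD(1)[OF s] and vd = lp_validD[OF snakeD(1)[OF s]] and sd = snakeD(3)[OF s]
  have um: "u m = l m + 1" "u (Suc m) = l m + 1" using sd[of m] sd[of "Suc m"] m len lm by auto
  have top: "l (Suc (Suc m)) = l m + 1" "u (Suc (Suc m)) = l m + 1"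
    using vd(3) vd(6,7)[of "Suc m"] len lm um by auto
  have ys: "length ys = Suc m" "distinct ys" using xs len by (simp_all add: ys_def)
  have tk: "take i ys = take i xs" if "i \<le> Suc m" for i using that by (simp add: ys_def min_def)
  have xs_eq: "set xs = insert e (set ys)" "e \<notin> set ys"
  proof -
    have "take (Suc (Suc m)) xs = take (Suc m) xs @ [xs ! Suc m]"
      using len by (intro take_Suc_conv_app_nth) simp
    then have *: "xs = ys @ [e]" using len by (simp add: ys_def e_def)
    show "set xs = insert e (set ys)" by (subst *) simp
    show "e \<notin> set ys" using xs(1) by (subst (asm) *) simp
  qed
  have cS: "int (card (B \<inter> set (take (Suc m) xs))) = int (card (B \<inter> set (take m xs))) + (if f \<in> B then 1 else 0)"
    "int (card (B \<inter> set (take (Suc (Suc m)) xs))) = int (card (B \<inter> set (take (Suc m) xs))) + (if e \<in> B then 1 else 0)" for B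
    using card_take_Suc[OF xs(1), of m B] card_take_Suc[OF xs(1), of "Suc m" B] len
    by (simp_all add: e_def f_def)
  have ef: "e \<noteq> f" "e \<in> set xs" "f \<in> set xs"
    using xs(1) len by (auto simp: e_def f_def nth_eq_iff_index_eq)
  have bd: "l m \<le> int (card (B \<inter> set (take m xs)))" "int (card (B \<inter> set (take (Suc (Suc m)) xs))) = l m + 1"
    if "B \<in> lp xs l u" for B
    using lp_D(2,3)[OF that, of m] lp_D(2,3)[OF that, of "Suc (Suc m)"] top len by auto
  have not_both: "\<not> (e \<in> B \<and> f \<in> B)" if "B \<in> lp xs l u" for B
    using bd[OF that] cS[of B] by auto
  have lp_ys: "lp ys l' u = {B \<in> lp xs l u. e \<notin> B}"
  proof (intro set_eqI iffI)
    fix B assume B: "B \<in> lp ys l' u"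
    have sub: "B \<subseteq> set ys" using lp_D(1)[OF B] .
    then have eB: "e \<notin> B" using xs_eq by blast
    have a: "l' i \<le> int (card (B \<inter> set (take i xs)))" "int (card (B \<inter> set (take i xs))) \<le> u i"
      if "i \<le> Suc m" for i
      using lp_D(2,3)[OF B, of i] that ys tk by auto
    have "B \<in> lp xs l u"
    proof (rule lp_I)
      show "B \<subseteq> set xs" using sub xs_eq by blast
      fix i assume i: "i \<le> length xs"
      consider "i \<le> m" | "i = Suc m" | "i = Suc (Suc m)" using i len by linarith
      then have "l i \<le> int (card (B \<inter> set (take i xs))) \<and> int (card (B \<inter> set (take i xs))) \<le> u i"
      proof cases
        case 1 then show ?thesis using a[of i] by (simp add: l'_def)
      next
        case 2 then show ?thesis using a[of i] lm um by (simp add: l'_def)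
      next
        case 3 then show ?thesis using a[of "Suc m"] cS(2)[of B] um top eB by (simp add: l'_def)
      qed
      then show "l i \<le> int (card (B \<inter> set (take i xs)))" "int (card (B \<inter> set (take i xs))) \<le> u i" by auto
    qed
    then show "B \<in> {B \<in> lp xs l u. e \<notin> B}" using eB by simp
  next
    fix B assume "B \<in> {B \<in> lp xs l u. e \<notin> B}"
    then have B: "B \<in> lp xs l u" and eB: "e \<notin> B" by auto
    show "B \<in> lp ys l' u"
    proof (rule lp_I)
      show "B \<subseteq> set ys" using lp_D(1)[OF B] eB by (simp add: xs_eq(1) subset_insert)
      fix i assume i: "i \<le> length ys"
      show "l' i \<le> int (card (B \<inter> set (take i ys)))" "int (card (B \<inter> set (take i ys))) \<le> u i"
        using lp_D(2,3)[OF B, of i] i bd(2)[OF B] cS(2)[of B] eB um ys len tk[of i] by (auto simp: l'_def)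
    qed
  qed
  have "lp_valid (Suc m) l' u"
    unfolding lp_valid_def
  proof (intro conjI allI impI)
    show "l' 0 = 0" "u 0 = 0" "l' (Suc m) = u (Suc m)" using vd(1,2) by (simp_all add: l'_def)
  next
    fix i assume "i \<le> Suc m"
    then show "l' i \<le> u i" "u i \<le> l' i + 1" using vd(4,5)[of i] len by (auto simp: l'_def)
  next
    fix i assume i: "i < Suc m"
    then show "l' (Suc i) \<le> u i" "l' i < u (Suc i)"
      using vd(6,7)[of i] len um by (auto simp: l'_def)
  qed
  then have s': "snake (length ys) l' u"
    using s ys len by (auto simp: snake_def l'_def)
  have "lp ys l' u \<noteq> {}" using lp_valid_nonempty[OF ys(2)] snakeD(1)[OF s'] by simp
  moreover have "0 \<notin> set ys" using xs(2) xs_eq by blast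
  ultimately have mb: "matroid_bases (set ys) (lp ys l' u)"
    using lp_validD(3)[OF snakeD(1)[OF s']] ys by (intro lp_matroid) auto
  define M where "M = Abs_matroid (set ys, lp ys l' u)"
  have M: "ground M = set ys" "bases M = lp ys l' u"
    unfolding M_def by (simp_all add: matroid_of_bases[OF mb])
  have "indep N {e}" "indep N {f}"
    using lp_valid_mem(1)[OF xs(1) v, of "Suc m"] lp_valid_mem(1)[OF xs(1) v, of m] len N
    by (auto simp: indep_def e_def f_def)
  moreover have "\<not> indep N {e, f}" using not_both N by (auto simp: indep_def)
  ultimately have "circuit N {e, f}" using ef N by (intro circuit_pair) auto
  moreover have "is_deletion N e M"
    unfolding is_deletion_def
  proof (intro conjI allI)
    show "ground M = ground N - {e}" using M N xs_eq by auto
    fix X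
    show "indep M X \<longleftrightarrow> indep N X \<and> e \<notin> X"
    proof
      assume "indep M X"
      then show "indep N X \<and> e \<notin> X" by (auto simp: indep_def M N lp_ys)
    next
      assume "indep N X \<and> e \<notin> X"
      then obtain B where B: "B \<in> lp xs l u" "X \<subseteq> B" "e \<notin> X" by (auto simp: indep_def N)
      show "indep M X"
      proof (cases "e \<in> B")
        case False
        then show ?thesis using B by (auto simp: indep_def M lp_ys)
      next
        case True
        then have fB: "f \<notin> B" using not_both B by blast
        have cm: "int (card (B \<inter> set (take (Suc m) xs))) = l m" "int (card (B \<inter> set (take m xs))) = l m"
          using bd[OF B(1)] cS[of B] True fB by auto
        \<comment> \<open>A basis through \<open>e\<close> is replaced by the one through its
          parallel element \<open>f\<close>. Only the height at \<open>Suc m\<close> changes, from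
          \<open>l m\<close> to \<open>l m + 1\<close>, which is still
          \<open>u (Suc m)\<close>.\<close>
        have "insert f (B - {e}) \<in> lp xs l u"
        proof (rule lp_I)
          show "insert f (B - {e}) \<subseteq> set xs" using lp_D(1)[OF B(1)] ef by blast
          fix i assume i: "i \<le> length xs"
          have *: "int (card (insert f (B - {e}) \<inter> set (take i xs)))
            = int (card (B \<inter> set (take i xs))) - (if Suc m < i then 1 else 0) + (if m < i then 1 else 0)"
            unfolding e_def f_def using True fB i len xs(1)
            by (intro card_swap_take) (auto simp: e_def f_def)
          show "l i \<le> int (card (insert f (B - {e}) \<inter> set (take i xs)))"
            "int (card (insert f (B - {e}) \<inter> set (take i xs))) \<le> u i"
            unfolding * using lp_D(2,3)[OF B(1) i] cm um i len
            by (cases "i = Suc m"; auto)+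
        qed
        moreover have "X \<subseteq> insert f (B - {e})" "e \<notin> insert f (B - {e})" using B ef by auto
        ultimately show ?thesis by (auto simp: indep_def M lp_ys)
      qed
    qed
  qed
  ultimately have "parallel_extension M N" unfolding parallel_extension_def using ef by blast
  then show thesis using that[OF ys(2) s' M] by blast
qed

lemma snake_complement:
  assumes "snake n l u"
  shows "snake n (\<lambda>i. int i - u i) (\<lambda>i. int i - l i)"
  unfolding snake_def lp_valid_def
proof (intro conjI allI impI)
  note v = lp_validD[OF snakeD(1)[OF assms]]
  show "int 0 - u 0 = 0" "int 0 - l 0 = 0" "int n - u n = int n - l n" using v(1-3) by simp_all
  show "0 < n" using assms by (simp add: snake_def)
  fix i
  show "i \<le> n \<Longrightarrow> int i - u i \<le> int i - l i" "i \<le> n \<Longrightarrow> int i - l i \<le> int i - u i + 1"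
    "i < n \<Longrightarrow> int (Suc i) - u (Suc i) \<le> int i - l i" "i < n \<Longrightarrow> int i - u i < int (Suc i) - l (Suc i)"
    "0 < i \<and> i < n \<Longrightarrow> int i - u i < int i - l i"
    using v(4-7)[of i] snakeD(3)[OF assms, of i] by auto
qed

lemma dual_lp:
  assumes "distinct xs" "ground N = set xs" "bases N = lp xs l u"
  shows "bases (dual N) = lp xs (\<lambda>i. int i - u i) (\<lambda>i. int i - l i)"
  using lp_complement[OF assms(1)] assms by (simp add: bases_dual)

text \<open>Snakes are peeled from the right. If \<open>l\<close> is flat at the last interior step,
  the last element is a parallel extension; otherwise the complementary snake is flat there, which
  gives a series extension. The process ends at length 2 with a copy of
  \<open>U\<^sub>1\<^sub>,\<^sub>2\<close>.\<close>

lemma snake_series_parallel: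
  assumes "distinct xs" "snake (length xs) l u" "ground N = set xs" "bases N = lp xs l u"
  shows "series_parallel_built N"
  using assms
proof (induction "length xs" arbitrary: xs l u N rule: less_induct)
  case less
  note xs = less.prems(1) and s = less.prems(2) and N = less.prems(3,4)
  have z: "0 \<notin> set xs" using zero_notin_ground[of N] N by simp
  note vd = lp_validD[OF snakeD(1)[OF s]]
  consider "length xs = 2" | m where "length xs = Suc (Suc m)" "0 < m"
  proof -
    assume a: "length xs = 2 \<Longrightarrow> thesis" "\<And>m. length xs = Suc (Suc m) \<Longrightarrow> 0 < m \<Longrightarrow> thesis"
    show thesis
      using a(1) a(2)[of "length xs - 2"] snakeD(2)[OF s] by (cases "length xs = 2") auto
  qed
  then show ?case
  proof cases
    case 1
    have b: "l 1 = 0" "u 1 = 1" "l 2 = 1" "u 2 = 1"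
      using vd(3) vd(6-9)[of 0] vd(6-9)[of 1] vd(1,2) snakeD(3)[OF s, of 1] 1
      by (auto simp: numeral_2_eq_2)
    have "B \<in> lp xs l u \<longleftrightarrow> B \<subseteq> set xs \<and> card B = 1" for B
    proof
      assume B: "B \<in> lp xs l u"
      have "B \<inter> set xs = B" using lp_D(1)[OF B] by blast
      then show "B \<subseteq> set xs \<and> card B = 1" using lp_D(1)[OF B] lp_D(2,3)[OF B, of 2] b 1 by simp
    next
      assume B: "B \<subseteq> set xs \<and> card B = 1"
      then have B': "B \<inter> set xs = B" by blast
      show "B \<in> lp xs l u"
      proof (rule lp_I)
        fix i assume "i \<le> length xs"
        then consider "i = 0" | "i = 1" | "i = 2" using 1 by linarith
        then have "l i \<le> int (card (B \<inter> set (take i xs))) \<and> int (card (B \<inter> set (take i xs))) \<le> u i"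
        proof cases
          case 2
          have "finite B" using B finite_subset by blast
          then have "card (B \<inter> set (take i xs)) \<le> card B" by (intro card_mono) auto
          then show ?thesis using 2 b B by simp
        next
          case 3 then show ?thesis using b B B' 1 by simp
        qed (use vd(1,2) in simp)
        then show "l i \<le> int (card (B \<inter> set (take i xs)))" "int (card (B \<inter> set (take i xs))) \<le> u i" by auto
      qed (use B in blast)
    qed
    then have "is_uniform 1 2 N" using N 1 xs by (auto simp: is_uniform_def distinct_card)
    then show ?thesis by (rule series_parallel_built.start)
  next
    case 2
    define ys where "ys = take (Suc m) xs"
    have ys: "length ys < length xs" using 2 by (simp add: ys_def)
    show ?thesis
    proof (cases "l (Suc m) = l m")
      case True
      obtain M l' where "distinct ys" "snake (length ys) l' u" "ground M = set ys"
          "bases M = lp ys l' u" "parallel_extension M N"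
        using snake_parallel_step[OF xs z 2 s True N] unfolding ys_def by metis
      then show ?thesis using less.hyps[OF ys] series_parallel_built.parallel by blast
    next
      case False
      then have "l (Suc m) = l m + 1" using vd(8,9)[of m] 2 by simp
      \<comment> \<open>The gap is one at both positions, so \<open>u\<close> climbs along with
        \<open>l\<close>, and the lower bound \<open>int i - u i\<close> of the dual is
        flat.\<close>
      then have *: "int (Suc m) - u (Suc m) = int m - u m"
        using snakeD(3)[OF s, of m] snakeD(3)[OF s, of "Suc m"] 2 by simp
      have gN: "ground (dual N) = set xs" using N by (simp add: ground_dual)
      obtain M l' where M: "distinct ys" "snake (length ys) l' (\<lambda>i. int i - l i)" "ground M = set ys"
          "bases M = lp ys l' (\<lambda>i. int i - l i)" "parallel_extension M (dual N)"
        using snake_parallel_step[OF xs z 2 snake_complement[OF s] * gN dual_lp[OF xs N]]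
        unfolding ys_def by metis
      have "series_parallel_built (dual M)"
        using less.hyps[OF ys M(1) snake_complement[OF M(2)] _ dual_lp[OF M(1,3,4)]] M(3)
        by (simp add: ground_dual)
      moreover have "series_extension (dual M) N"
        using M(5) by (simp add: series_extension_def dual_dual)
      ultimately show ?thesis by (rule series_parallel_built.series)
    qed
  qed
qed

text \<open>At a pinch every basis has exactly \<open>l j\<close> elements in the prefix, so the
  constraints before and after \<open>j\<close> decouple once \<open>l j\<close> is subtracted from
  the later bounds.\<close>

lemma lp_split:
  assumes xs: "distinct xs" and j: "j \<le> length xs" and lu: "l j = u j"
  shows "lp xs l u = {A \<union> B |A B. A \<in> lp (take j xs) l u
    \<and> B \<in> lp (drop j xs) (\<lambda>i. l (j + i) - l j) (\<lambda>i. u (j + i) - l j)}"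
proof -
  define ys where "ys = take j xs"
  define zs where "zs = drop j xs"
  have len: "length ys = j" "length zs = length xs - j" using j by (simp_all add: ys_def zs_def)
  have un: "set xs = set ys \<union> set zs" unfolding ys_def zs_def by (metis append_take_drop_id set_append)
  have dis: "set ys \<inter> set zs = {}" using xs unfolding ys_def zs_def
    by (metis append_take_drop_id distinct_append)
  have tk: "take i ys = take i xs" if "i \<le> j" for i using that by (simp add: ys_def min_def)
  have tk2: "take (j + i) xs = ys @ take i zs" for i by (simp add: take_add ys_def zs_def)
  have c: "card (X \<inter> set (take (j + i) xs)) = card (X \<inter> set ys) + card (X \<inter> set (take i zs))" for X i
  proof -
    have "X \<inter> set (take (j + i) xs) = (X \<inter> set ys) \<union> (X \<inter> set (take i zs))" by (auto simp: tk2)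
    moreover have "set ys \<inter> set (take i zs) = {}" using dis set_take_subset[of i zs] by blast
    ultimately show ?thesis by (simp add: card_Un_disjoint disjoint_iff Int_Un_distrib)
  qed
  show ?thesis unfolding ys_def[symmetric] zs_def[symmetric]
  proof (intro set_eqI iffI)
    fix X assume X: "X \<in> lp xs l u"
    have full: "int (card (X \<inter> set ys)) = l j" using lp_D(2,3)[OF X j] lu c[of X 0] by simp
    have "X \<inter> set ys \<in> lp ys l u"
    proof (rule lp_I)
      fix i assume i: "i \<le> length ys"
      have "X \<inter> set ys \<inter> set (take i ys) = X \<inter> set (take i xs)"
        using set_take_subset[of i ys] tk[of i] i len by auto
      then show "l i \<le> int (card (X \<inter> set ys \<inter> set (take i ys)))"
        "int (card (X \<inter> set ys \<inter> set (take i ys))) \<le> u i"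
        using lp_D(2,3)[OF X, of i] i len j by auto
    qed simp
    moreover have "X \<inter> set zs \<in> lp zs (\<lambda>i. l (j + i) - l j) (\<lambda>i. u (j + i) - l j)"
    proof (rule lp_I)
      fix i assume i: "i \<le> length zs"
      then have ji: "j + i \<le> length xs" using len j by linarith
      have "X \<inter> set zs \<inter> set (take i zs) = X \<inter> set (take i zs)"
        using set_take_subset[of i zs] by auto
      then show "l (j + i) - l j \<le> int (card (X \<inter> set zs \<inter> set (take i zs)))"
        "int (card (X \<inter> set zs \<inter> set (take i zs))) \<le> u (j + i) - l j"
        using lp_D(2,3)[OF X, of "j + i"] i full c[of X i] ji by auto
    qed simp
    moreover have "X = (X \<inter> set ys) \<union> (X \<inter> set zs)" using lp_D(1)[OF X] un by blast
    ultimately show "X \<in> {A \<union> B |A B. A \<in> lp ys l u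
      \<and> B \<in> lp zs (\<lambda>i. l (j + i) - l j) (\<lambda>i. u (j + i) - l j)}" by blast
  next
    fix X assume "X \<in> {A \<union> B |A B. A \<in> lp ys l u
      \<and> B \<in> lp zs (\<lambda>i. l (j + i) - l j) (\<lambda>i. u (j + i) - l j)}"
    then obtain A B where X: "X = A \<union> B" and A: "A \<in> lp ys l u"
      and B: "B \<in> lp zs (\<lambda>i. l (j + i) - l j) (\<lambda>i. u (j + i) - l j)" by blast
    have XA: "X \<inter> set ys = A" "X \<inter> set (take i ys) = A \<inter> set (take i ys)" for i
      using X lp_D(1)[OF A] lp_D(1)[OF B] dis set_take_subset[of i ys] by blast+
    have XB: "X \<inter> set (take i zs) = B \<inter> set (take i zs)" for i
      using X lp_D(1)[OF A] dis set_take_subset[of i zs] by blast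
    have full: "int (card A) = l j"
      using lp_D(2,3)[OF A, of j] len lu lp_D(1)[OF A] by (simp add: Int_absorb2)
    show "X \<in> lp xs l u"
    proof (rule lp_I)
      show "X \<subseteq> set xs" using X un lp_D(1)[OF A] lp_D(1)[OF B] by blast
      fix i assume i: "i \<le> length xs"
      have "l i \<le> int (card (X \<inter> set (take i xs))) \<and> int (card (X \<inter> set (take i xs))) \<le> u i"
      proof (cases "i \<le> j")
        case True
        then show ?thesis using lp_D(2,3)[OF A, of i] XA(2)[of i] tk[of i] len by simp
      next
        case False
        then obtain t where t: "i = j + t" using le_Suc_ex nat_le_linear by blast
        then have "t \<le> length zs" using i len by linarith
        then show ?thesis using lp_D(2,3)[OF B, of t] t c[of X t] XA(1) XB[of t] full by auto
      qed
      then show "l i \<le> int (card (X \<inter> set (take i xs)))" "int (card (X \<inter> set (take i xs))) \<le> u i" by auto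
    qed
  qed
qed

definition snake_matroid :: "matroid \<Rightarrow> bool" where
  "snake_matroid M \<longleftrightarrow> (\<exists>ys l u. distinct ys \<and> snake (length ys) l u \<and>
     ground M = set ys \<and> bases M = lp ys l u)"

text \<open>Cutting at the last pinch \<open>j\<close> before the end makes the suffix a snake,
  while the prefix has one pinch fewer, \<open>j\<close> having become its end. Position 0 is always
  a pinch of a nonempty list and accounts for the first summand.\<close>

lemma lp_direct_sum:
  assumes "distinct xs" "lp_valid (length xs) l u" "ground N = set xs" "bases N = lp xs l u"
  shows "\<exists>Ms. is_direct_sum N (card {i. i < length xs \<and> l i = u i}) Ms \<and>
    (\<forall>i<card {i. i < length xs \<and> l i = u i}. snake_matroid (Ms i))"
  using assms
proof (induction "length xs" arbitrary: xs N rule: less_induct)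
  case less
  note xs = less.prems(1) and v = less.prems(2) and N = less.prems(3,4)
  have z: "0 \<notin> set xs" using zero_notin_ground[of N] N by simp
  note vd = lp_validD[OF v]
  show ?case
  proof (cases "xs = []")
    case True
    then have "bases N = {{}}" using N vd(1,2) by (auto simp: lp_def)
    then show ?thesis using True N by (auto simp: is_direct_sum_def disjoint_family_on_def)
  next
    case False
    define P where "P = {i. i < length xs \<and> l i = u i}"
    have fin: "finite P" by (simp add: P_def)
    have "0 \<in> P" using False vd(1,2) by (simp add: P_def)
    then have "Max P \<in> P" using fin by (intro Max_in) auto
    moreover define j where "j = Max P"
    ultimately have j: "j < length xs" "l j = u j" by (auto simp: P_def)
    have above: "l i < u i" if "j < i" "i < length xs" for i
    proof -
      have "i \<notin> P" using fin that(1) unfolding j_def by (meson Max_ge leD)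
      then show ?thesis using vd(4)[of i] that by (simp add: P_def)
    qed
    have Pj: "P = insert j {i. i < j \<and> l i = u i}"
      using above j by (auto simp: P_def) (metis less_irrefl linorder_neqE_nat)
    have cP: "card P = Suc (card {i. i < j \<and> l i = u i})" unfolding Pj by simp
    define ys where "ys = take j xs"
    define zs where "zs = drop j xs"
    define l' where "l' i = l (j + i) - l j" for i
    define u' where "u' i = u (j + i) - l j" for i
    have len: "length ys = j" "length zs = length xs - j" using j by (simp_all add: ys_def zs_def)
    have un: "set xs = set ys \<union> set zs" unfolding ys_def zs_def by (metis append_take_drop_id set_append)
    have dis: "distinct ys" "distinct zs" "set ys \<inter> set zs = {}" using xs unfolding ys_def zs_def
      by (metis append_take_drop_id distinct_append)+
    have vy: "lp_valid (length ys) l u" using vd j unfolding lp_valid_def len by simp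
    have sz: "snake (length zs) l' u'"
      unfolding snake_def lp_valid_def
    proof (intro conjI allI impI)
      show "l' 0 = 0" "u' 0 = 0" "l' (length zs) = u' (length zs)" "0 < length zs"
        using j vd(3) len by (simp_all add: l'_def u'_def)
      fix i
      show "i \<le> length zs \<Longrightarrow> l' i \<le> u' i" "i \<le> length zs \<Longrightarrow> u' i \<le> l' i + 1"
        using vd(4,5)[of "j + i"] len j by (simp_all add: l'_def u'_def)
      show "i < length zs \<Longrightarrow> l' (Suc i) \<le> u' i" "i < length zs \<Longrightarrow> l' i < u' (Suc i)"
        using vd(6,7)[of "j + i"] len j by (simp_all add: l'_def u'_def)
      show "0 < i \<and> i < length zs \<Longrightarrow> l' i < u' i"
        using above[of "j + i"] len by (simp add: l'_def u'_def less_diff_conv add.commute)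
    qed
    have mby: "matroid_bases (set ys) (lp ys l u)"
      using z un lp_validD(3)[OF vy] lp_valid_nonempty[OF dis(1) vy] by (intro lp_matroid dis) auto
    have mbz: "matroid_bases (set zs) (lp zs l' u')"
      using z un lp_validD(3)[OF snakeD(1)[OF sz]] lp_valid_nonempty[OF dis(2) snakeD(1)[OF sz]]
      by (intro lp_matroid dis) auto
    define A where "A = Abs_matroid (set ys, lp ys l u)"
    define K where "K = Abs_matroid (set zs, lp zs l' u')"
    have A: "ground A = set ys" "bases A = lp ys l u"
      unfolding A_def by (simp_all add: matroid_of_bases[OF mby])
    have K: "ground K = set zs" "bases K = lp zs l' u'"
      unfolding K_def by (simp_all add: matroid_of_bases[OF mbz])
    have sK: "snake_matroid K" unfolding snake_matroid_def using dis sz K by blast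
    define m where "m = card {i. i < j \<and> l i = u i}"
    obtain Ms where Ms: "is_direct_sum A m Ms" "\<forall>i<m. snake_matroid (Ms i)"
      using less.hyps[OF _ dis(1) vy A] len j unfolding m_def by auto
    have "bases N = {X \<union> Y |X Y. X \<in> bases A \<and> Y \<in> bases K}"
      using lp_split[of xs j l u, OF xs less_imp_le[OF j(1)] j(2)] unfolding N A K ys_def zs_def l'_def[abs_def] u'_def[abs_def]
      by simp
    then have "is_direct_sum N (Suc m) (Ms(m := K))"
      using is_direct_sum_append[OF Ms(1), of N K] A K N un dis(3) by simp
    moreover have "\<forall>i<Suc m. snake_matroid ((Ms(m := K)) i)" using Ms(2) sK by (auto simp: less_Suc_eq)
    moreover have "card {i. i < length xs \<and> l i = u i} = Suc m"
      using cP by (simp add: P_def m_def)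
    ultimately show ?thesis by metis
  qed
qed

lemma matroid_iso_refl: "matroid_iso M M"
  unfolding matroid_iso_def by (rule exI[of _ id]) auto

text \<open>The exponent and the number of components are the same count of pinches, so that a
  covaluation sees \<open>(- 1) ^ m\<close> times \<open>t ^ m\<close>. That each summand counts as
  one component is \<open>snake_connected\<close>.\<close>

theorem speyer_g_lp_valid:
  assumes g: "speyer_g g" and xs: "distinct xs" and v: "lp_valid (length xs) l u"
    and N: "ground N = set xs" "bases N = lp xs l u"
  shows "g N = monom 1 (card {i. i < length xs \<and> l i = u i})"
    and "num_components N = card {i. i < length xs \<and> l i = u i}"
proof -
  obtain Ms where Ms: "is_direct_sum N (card {i. i < length xs \<and> l i = u i}) Ms"
    "\<And>i. i < card {i. i < length xs \<and> l i = u i} \<Longrightarrow> snake_matroid (Ms i)"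
    using lp_direct_sum[OF xs v N] by blast
  have "series_parallel (Ms i)" if "i < card {i. i < length xs \<and> l i = u i}" for i
    using Ms(2)[OF that] snake_series_parallel by (auto simp: snake_matroid_def series_parallel_def)
  moreover have "\<nexists>e. loop N e \<or> coloop N e" using lp_valid_no_loop[OF xs v N] by blast
  ultimately show "g N = monom 1 (card {i. i < length xs \<and> l i = u i})"
    using g Ms(1) matroid_iso_refl unfolding speyer_g_def by blast
  show "num_components N = card {i. i < length xs \<and> l i = u i}"
  proof (rule num_components_direct_sum[OF Ms(1)])
    fix i assume "i < card {i. i < length xs \<and> l i = u i}"
    then obtain ys l' u' where *: "distinct ys" "snake (length ys) l' u'" "ground (Ms i) = set ys"
      "bases (Ms i) = lp ys l' u'" using Ms(2) unfolding snake_matroid_def by blast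
    show "ground (Ms i) \<noteq> {}" using * by (auto simp: snake_def)
    fix x y assume "x \<in> ground (Ms i)" "y \<in> ground (Ms i)" "x \<noteq> y"
    then show "\<exists>C. circuit (Ms i) C \<and> x \<in> C \<and> y \<in> C" using snake_connected[OF *] by blast
  qed
qed

section \<open>Subdividing the hypersimplex\<close>

lemma valuation_sum:
  fixes f :: "matroid \<Rightarrow> 'a::ring_1" and a :: "'i \<Rightarrow> int"
  assumes f: "valuation f" and I: "finite I" and E: "\<And>i. i \<in> I \<Longrightarrow> ground (Ms i) = E"
    and rel: "\<And>x. (\<Sum>i\<in>I. a i * indicator (base_polytope (Ms i)) x) = 0"
  shows "(\<Sum>i\<in>I. of_int (a i) * f (Ms i)) = 0"
proof -
  obtain h where h: "bij_betw h {..<card I} I"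
    using ex_bij_betw_nat_finite[OF I] by (auto simp: atLeast0LessThan)
  have hI: "h i \<in> I" if "i < card I" for i using h that by (auto simp: bij_betw_def)
  have "(\<Sum>i<card I. a (h i) * indicator (base_polytope (Ms (h i))) x) = 0" for x
    using rel[of x] sum.reindex_bij_betw[OF h, of "\<lambda>i. a i * indicator (base_polytope (Ms i)) x"] by simp
  then have "(\<Sum>i<card I. of_int (a (h i)) * f (Ms (h i))) = 0"
    using f[unfolded valuation_def, rule_format, of "card I" "\<lambda>i. Ms (h i)" E "\<lambda>i. a (h i)"] hI E by simp
  then show ?thesis
    using sum.reindex_bij_betw[OF h, of "\<lambda>i. of_int (a i) * f (Ms i)"] by simp
qed

text \<open>\<open>M\<close> joins the indexed family under the extra index \<open>()\<close> with
  coefficient -1, which turns the decomposition into a linear relation.\<close>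

lemma valuation_decomposition:
  fixes f :: "matroid \<Rightarrow> 'a::ring_1" and a :: "'i \<Rightarrow> int"
  assumes f: "valuation f" and I: "finite I" and E: "\<And>i. i \<in> I \<Longrightarrow> ground (Ms i) = ground M"
    and rel: "\<And>x. indicator (base_polytope M) x = (\<Sum>i\<in>I. a i * indicator (base_polytope (Ms i)) x)"
  shows "f M = (\<Sum>i\<in>I. of_int (a i) * f (Ms i))"
proof -
  define Ns where "Ns = case_sum (\<lambda>_::unit. M) Ms"
  define b where "b = case_sum (\<lambda>_::unit. - 1) a"
  have "(\<Sum>i\<in>{()} <+> I. of_int (b i) * f (Ns i)) = 0"
  proof (rule valuation_sum[OF f])
    show "finite ({()} <+> I)" using I by simp
    show "ground (Ns i) = ground M" if "i \<in> {()} <+> I" for i using that E by (auto simp: Ns_def)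
    show "(\<Sum>i\<in>{()} <+> I. b i * indicator (base_polytope (Ns i)) x) = 0" for x
      using rel[of x] by (subst sum.Plus) (simp_all add: I Ns_def b_def del: sum_mult_indicator)
  qed
  then show ?thesis using I by (simp add: sum.Plus Ns_def b_def)
qed

lemma num_components_connected:
  assumes "ground N \<noteq> {}"
    and "\<And>x y. x \<in> ground N \<Longrightarrow> y \<in> ground N \<Longrightarrow> x \<noteq> y \<Longrightarrow> \<exists>C. circuit N C \<and> x \<in> C \<and> y \<in> C"
  shows "num_components N = 1"
proof (rule num_components_direct_sum[of N 1 "\<lambda>_. N"])
  have "bases N = {\<Union>i<1. B i |B. \<forall>i<(1::nat). B i \<in> bases N}"
  proof (intro set_eqI iffI)
    fix X assume "X \<in> bases N"
    then show "X \<in> {\<Union>i<1. B i |B. \<forall>i<(1::nat). B i \<in> bases N}"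
      by (intro CollectI exI[of _ "\<lambda>_. X"]) auto
  qed (auto simp: lessThan_Suc)
  then show "is_direct_sum N 1 (\<lambda>_. N)"
    by (simp add: is_direct_sum_def disjoint_family_on_def lessThan_Suc)
qed (use assms in auto)

section \<open>Uniform matroids and the cells of the hypersimplex\<close>

definition k_subsets :: "nat set \<Rightarrow> nat \<Rightarrow> nat set set" where
  "k_subsets E k = {B. B \<subseteq> E \<and> card B = k}"

lemma k_subsets_lp:
  assumes "distinct xs"
  shows "k_subsets (set xs) k = lp xs (\<lambda>i. if i = length xs then int k else 0) (\<lambda>_. int k)"
proof (intro set_eqI iffI)
  fix B assume B: "B \<in> k_subsets (set xs) k"
  then have "finite B" unfolding k_subsets_def using finite_subset by auto
  then have "card (B \<inter> set (take i xs)) \<le> card B" for i by (intro card_mono) auto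
  moreover have "B \<inter> set xs = B" using B by (auto simp: k_subsets_def)
  ultimately show "B \<in> lp xs (\<lambda>i. if i = length xs then int k else 0) (\<lambda>_. int k)"
    using B by (intro lp_I) (auto simp: k_subsets_def)
next
  fix B assume B: "B \<in> lp xs (\<lambda>i. if i = length xs then int k else 0) (\<lambda>_. int k)"
  have "B \<inter> set xs = B" using lp_D(1)[OF B] by blast
  then show "B \<in> k_subsets (set xs) k"
    using lp_D(1)[OF B] lp_D(2,3)[OF B, of "length xs"] by (simp add: k_subsets_def)
qed

lemma uniform_num_components:
  assumes U: "bases U = k_subsets (ground U) k" and k: "0 < k" "k < card (ground U)"
  shows "num_components U = 1"
proof (rule num_components_connected)
  show "ground U \<noteq> {}" using k by auto
  fix x y assume xy: "x \<in> ground U" "y \<in> ground U" "x \<noteq> y"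
  have "card (ground U - {x, y}) = card (ground U) - 2"
    using xy by (simp add: card_Diff_subset)
  then have "k - 1 \<le> card (ground U - {x, y})" using k by simp
  then obtain S where S: "S \<subseteq> ground U - {x, y}" "card S = k - 1" "finite S"
    by (rule obtain_subset_with_card_n)
  have "insert y S \<in> bases U" "insert x S \<in> bases U"
  proof -
    have "x \<notin> S" "y \<notin> S" using S by blast+
    then show "insert y S \<in> bases U" "insert x S \<in> bases U"
      using S xy k unfolding U k_subsets_def by (auto simp: card_insert_disjoint)
  qed
  moreover have "insert x (insert y S - {y}) = insert x S" using S by blast
  moreover have "x \<notin> insert y S" using S xy by blast
  ultimately show "\<exists>C. circuit U C \<and> x \<in> C \<and> y \<in> C"
    using common_circuit[of "insert y S" U y x] by simp
qed

text \<open>The hypersimplex is cut along all hyperplanes on which a prefix sum is an integer. At each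
  position a cell either confines the prefix sum to a unit interval or fixes it (a pinch); by
  inclusion-exclusion every pinch contributes a sign. The two ends always count as pinches, and
  \<open>pinch_count\<close> includes position \<open>0\<close>, so that it equals the number of direct summands.\<close>

definition cell_choices :: "nat \<Rightarrow> nat \<Rightarrow> nat \<Rightarrow> (int \<times> int) set" where
  "cell_choices n k i = (if i = 0 then {(0, 0)} else if i = n then {(int k, int k)}
     else (\<lambda>a. (int a, int a + 1)) ` {..<k} \<union> (\<lambda>a. (int a, int a)) ` {1..<k})"

definition cell_sign :: "int \<times> int \<Rightarrow> int" where
  "cell_sign c = (if fst c = snd c then - 1 else 1)"

definition in_cell :: "int \<times> int \<Rightarrow> real \<Rightarrow> int" where
  "in_cell c y = of_bool (real_of_int (fst c) \<le> y \<and> y \<le> real_of_int (snd c))"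

lemma finite_cell_choices: "finite (cell_choices n k i)"
  by (simp add: cell_choices_def)

text \<open>An interior integer lies in two of the closed unit intervals and is subtracted once;
  every other point of the range lies in just one. \<open>Suc K\<close> keeps the number of
  intervals positive: with none, the point 0 would be missed.\<close>

lemma interval_subdivision:
  fixes y :: real
  assumes "0 \<le> y"
  shows "(\<Sum>a<Suc K. of_bool (real a \<le> y \<and> y \<le> real a + 1))
    - (\<Sum>a\<in>{1..<Suc K}. of_bool (real a = y)) = (of_bool (y \<le> real (Suc K)) :: int)"
proof (induction K)
  case 0
  then show ?case using assms by simp
next
  case (Suc K)
  define P :: "nat \<Rightarrow> int" where "P a = of_bool (real a \<le> y \<and> y \<le> real a + 1)" for a
  define Q :: "nat \<Rightarrow> int" where "Q a = of_bool (real a = y)" for a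
  have "sum P {..<Suc (Suc K)} - sum Q {1..<Suc (Suc K)}
      = (sum P {..<Suc K} - sum Q {1..<Suc K}) + P (Suc K) - Q (Suc K)"
    by simp
  also have "\<dots> = of_bool (y \<le> real (Suc K)) + P (Suc K) - Q (Suc K)"
    using Suc.IH unfolding P_def Q_def by simp
  also have "\<dots> = of_bool (y \<le> real (Suc (Suc K)))"
    unfolding P_def Q_def by (simp add: of_bool_def)
  finally show ?case unfolding P_def Q_def .
qed

lemma cell_subdivision:
  assumes i: "0 < i" "i < n" and k: "0 < k" and y: "0 \<le> y" "y \<le> real k"
  shows "(\<Sum>c\<in>cell_choices n k i. cell_sign c * in_cell c y) = 1"
proof -
  have "(\<Sum>c\<in>cell_choices n k i. cell_sign c * in_cell c y)
      = (\<Sum>c\<in>(\<lambda>a. (int a, int a + 1)) ` {..<k}. cell_sign c * in_cell c y)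
      + (\<Sum>c\<in>(\<lambda>a. (int a, int a)) ` {1..<k}. cell_sign c * in_cell c y)"
    using i by (simp add: cell_choices_def) (intro sum.union_disjoint, auto)
  also have "\<dots> = (\<Sum>a<k. of_bool (real a \<le> y \<and> y \<le> real a + 1))
      - (\<Sum>a\<in>{1..<k}. of_bool (real a = y))"
  proof -
    have "(\<Sum>c\<in>(\<lambda>a. (int a, int a + 1)) ` {..<k}. cell_sign c * in_cell c y)
      = (\<Sum>a<k. of_bool (real a \<le> y \<and> y \<le> real a + 1))"
      by (subst sum.reindex)
        (simp add: inj_on_def, intro sum.cong refl, simp add: cell_sign_def in_cell_def)
    moreover have "(\<Sum>c\<in>(\<lambda>a. (int a, int a)) ` {1..<k}. cell_sign c * in_cell c y)
      = (\<Sum>a\<in>{1..<k}. - of_bool (real a = y))"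
      by (subst sum.reindex)
        (simp add: inj_on_def, intro sum.cong refl, auto simp: cell_sign_def in_cell_def)
    ultimately show ?thesis unfolding sum_negf by linarith
  qed
  also have "\<dots> = 1"
    using interval_subdivision[OF y(1), of "k - 1"] k y by simp
  finally show ?thesis .
qed

definition cell_paths :: "nat \<Rightarrow> nat \<Rightarrow> (nat \<Rightarrow> int \<times> int) set" where
  "cell_paths n k = {s \<in> PiE {..n} (cell_choices n k). lp_valid n (\<lambda>i. fst (s i)) (\<lambda>i. snd (s i))}"

definition pinch_count :: "nat \<Rightarrow> (nat \<Rightarrow> int \<times> int) \<Rightarrow> nat" where
  "pinch_count n s = card {i. i < n \<and> fst (s i) = snd (s i)}"

lemma finite_cell_paths: "finite (cell_paths n k)"
proof -
  have "finite (PiE {..n} (cell_choices n k))"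
    by (intro finite_PiE finite_cell_choices) simp
  then show ?thesis by (simp add: cell_paths_def)
qed

lemma cell_choices_gap: "c \<in> cell_choices n k i \<Longrightarrow> snd c \<le> fst c + 1"
  by (auto simp: cell_choices_def split: if_splits)

lemma cell_choices_ends:
  "c \<in> cell_choices n k 0 \<Longrightarrow> c = (0, 0)"
  "0 < n \<Longrightarrow> c \<in> cell_choices n k n \<Longrightarrow> c = (int k, int k)"
  by (auto simp: cell_choices_def)

text \<open>The indicator of a cell factors over the positions, up to the common box constraints.
  Distributing the product of the one-dimensional subdivisions over all choice functions
  (\<open>prod_sum_PiE\<close>) therefore yields the signed sum over all cells at once.\<close>

lemma hypersimplex_subdivision:
  assumes xs: "distinct xs" and k: "0 < k" and n: "0 < length xs"
  shows "indicator (convex hull (indicator_vec ` k_subsets (set xs) k)) p =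
    (\<Sum>s\<in>PiE {..length xs} (cell_choices (length xs) k). (\<Prod>i\<le>length xs. cell_sign (s i))
      * (indicator (lp_polytope xs (\<lambda>i. fst (s i)) (\<lambda>i. snd (s i))) p :: int))"
proof -
  define n where "n = length xs"
  note n_pos = n[folded n_def]
  define box where "box \<longleftrightarrow> (\<forall>e. 0 \<le> Poly_Mapping.lookup p e \<and> Poly_Mapping.lookup p e \<le> 1)
    \<and> (\<forall>e. e \<notin> set xs \<longrightarrow> Poly_Mapping.lookup p e = 0)"
  define Y where "Y = psum xs p"
  have hull: "convex hull (indicator_vec ` k_subsets (set xs) k)
      = lp_polytope xs (\<lambda>i. if i = n then int k else 0) (\<lambda>_. int k)"
    unfolding k_subsets_lp[OF xs] hull_lp[OF xs] n_def ..
  have ind: "(indicator (lp_polytope xs l u) p :: int)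
      = of_bool box * (\<Prod>i\<le>n. in_cell (l i, u i) (Y i))" for l u
  proof -
    have "(\<Prod>i\<le>n. in_cell (l i, u i) (Y i))
        = of_bool (\<forall>i\<le>n. real_of_int (l i) \<le> Y i \<and> Y i \<le> real_of_int (u i))"
    proof (cases "\<forall>i\<le>n. real_of_int (l i) \<le> Y i \<and> Y i \<le> real_of_int (u i)")
      case True
      then show ?thesis by (simp add: in_cell_def)
    next
      case False
      then obtain i where "i \<le> n" "\<not> (real_of_int (l i) \<le> Y i \<and> Y i \<le> real_of_int (u i))" by blast
      then have "(\<Prod>i\<le>n. in_cell (l i, u i) (Y i)) = 0"
        by (intro prod_zero) (auto simp: in_cell_def)
      moreover have "of_bool (\<forall>i\<le>n. real_of_int (l i) \<le> Y i \<and> Y i \<le> real_of_int (u i)) = (0 :: int)"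
        using False by (simp only: of_bool_eq_0_iff not_False_eq_True)
      ultimately show ?thesis by (rule trans[OF _ sym])
    qed
    moreover have "p \<in> lp_polytope xs l u \<longleftrightarrow>
        box \<and> (\<forall>i\<le>n. real_of_int (l i) \<le> Y i \<and> Y i \<le> real_of_int (u i))"
      unfolding lp_polytope_def box_def Y_def n_def by blast
    ultimately show ?thesis
      by (simp only: indicator_def of_bool_conj)
  qed
  have Y0: "Y 0 = 0" by (simp add: Y_def psum_0)
  have prod: "(\<Sum>s\<in>PiE {..n} (cell_choices n k). (\<Prod>i\<le>n. cell_sign (s i))
      * (\<Prod>i\<le>n. in_cell (s i) (Y i)))
    = (\<Prod>i\<le>n. \<Sum>c\<in>cell_choices n k i. cell_sign c * in_cell c (Y i))"
    by (simp add: prod_sum_PiE finite_cell_choices prod.distrib)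
  have main: "of_bool box * (\<Prod>i\<le>n. \<Sum>c\<in>cell_choices n k i. cell_sign c * in_cell c (Y i))
    = (indicator (lp_polytope xs (\<lambda>i. if i = n then int k else 0) (\<lambda>_. int k)) p :: int)"
  proof (cases "box \<and> Y n = real k")
    case False
    then show ?thesis
    proof (cases box)
      case True
      then have "Y n \<noteq> real k" using False by simp
      then have "(\<Sum>c\<in>cell_choices n k n. cell_sign c * in_cell c (Y n)) = 0"
        using n_pos by (auto simp: cell_choices_def in_cell_def)
      then have "(\<Prod>i\<le>n. \<Sum>c\<in>cell_choices n k i. cell_sign c * in_cell c (Y i)) = 0"
        by (intro prod_zero) auto
      moreover have "p \<notin> lp_polytope xs (\<lambda>i. if i = n then int k else 0) (\<lambda>_. int k)"
        using \<open>Y n \<noteq> real k\<close> by (auto simp: lp_polytope_def Y_def n_def)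
      ultimately show ?thesis by simp
    next
      case False
      then have "p \<notin> lp_polytope xs (\<lambda>i. if i = n then int k else 0) (\<lambda>_. int k)"
        unfolding lp_polytope_def box_def by blast
      then show ?thesis using False by simp
    qed
  next
    case True
    then have box: box and Yn: "Y n = real k" by auto
    have YS: "Y i \<le> Y (Suc i)" if "i < n" for i
      using box that psum_Suc[OF xs, of i p] by (simp add: Y_def n_def box_def)
    have Ynonneg: "0 \<le> Y i" for i unfolding Y_def psum_def using box by (intro sum_nonneg) (simp add: box_def)
    have Yle: "Y i \<le> real k" if "i \<le> n" for i
    proof -
      have "Y i \<le> Y n" using that YS by (induction i rule: inc_induct) (auto intro: order_trans)
      then show ?thesis using Yn by simp
    qed
    have eq: "(\<Sum>c\<in>cell_choices n k i. cell_sign c * in_cell c (Y i)) = (if i = 0 \<or> i = n then -1 else 1)"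
      if i: "i \<le> n" for i
    proof -
      consider "i = 0" | "i = n" "i \<noteq> 0" | "0 < i" "i < n" using i by linarith
      then show ?thesis
      proof cases
        case 3
        then show ?thesis using cell_subdivision[OF 3 k Ynonneg Yle[OF i]] by simp
      qed (auto simp: cell_choices_def cell_sign_def in_cell_def Y0 Yn)
    qed
    have "(\<Prod>i\<le>n. \<Sum>c\<in>cell_choices n k i. cell_sign c * in_cell c (Y i))
      = (\<Prod>i\<le>n. if i = 0 \<or> i = n then -1 else 1)" by (intro prod.cong) (auto simp: eq)
    \<comment> \<open>The ends carry only a pinch and contribute -1 each; they are distinct since
      \<open>n\<close> is positive, so the two signs cancel.\<close>
    also have "\<dots> = (\<Prod>i\<in>{0, n}. -1)"
      by (rule prod.mono_neutral_cong_right) auto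
    also have "\<dots> = 1" using n_pos by simp
    finally have "(\<Prod>i\<le>n. \<Sum>c\<in>cell_choices n k i. cell_sign c * in_cell c (Y i)) = 1" .
    moreover have "p \<in> lp_polytope xs (\<lambda>i. if i = n then int k else 0) (\<lambda>_. int k)"
      using box Yn Yle Ynonneg by (auto simp: lp_polytope_def box_def Y_def n_def)
    ultimately show ?thesis using box by simp
  qed
  show ?thesis
    unfolding hull n_def[symmetric] main[symmetric] prod[symmetric] ind
    by (simp add: sum_distrib_left mult.assoc mult.left_commute)
qed

lemma speyer_g_uniform:
  assumes g: "speyer_g g" and U: "bases U = k_subsets (ground U) k"
    and k: "0 < k" "k < card (ground U)"
  shows "g U = (\<Sum>s\<in>cell_paths (card (ground U)) k. monom 1 (pinch_count (card (ground U)) s))"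
proof -
  define n where "n = card (ground U)"
  define xs where "xs = sorted_list_of_set (ground U)"
  have xs: "distinct xs" "set xs = ground U" "length xs = n"
    by (simp_all add: xs_def finite_ground n_def)
  have z: "0 \<notin> set xs" using xs zero_notin_ground by simp
  define L where "L s = (\<lambda>i. fst ((s :: nat \<Rightarrow> int \<times> int) i))" for s
  define R where "R s = (\<lambda>i. snd ((s :: nat \<Rightarrow> int \<times> int) i))" for s
  define T where "T = PiE {..n} (cell_choices n k)"
  have finT: "finite T" unfolding T_def by (intro finite_PiE finite_cell_choices) simp
  \<comment> \<open>Only nonempty families are bases of a matroid, so \<open>Abs_matroid\<close> is
    meaningful just on \<open>I\<close>. Cells outside have empty polytope and drop out of the
    relation.\<close>
  define I where "I = {s \<in> T. lp xs (L s) (R s) \<noteq> {}}"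
  have finI: "finite I" using finT by (simp add: I_def)
  define Ms where "Ms s = Abs_matroid (set xs, lp xs (L s) (R s))" for s
  define sg where "sg s = (\<Prod>i\<le>n. cell_sign (s i))" for s
  have ends: "s 0 = (0, 0)" "s n = (int k, int k)" if "s \<in> T" for s
  proof -
    have "s 0 \<in> cell_choices n k 0" "s n \<in> cell_choices n k n" using that by (auto simp: T_def PiE_iff)
    then show "s 0 = (0, 0)" "s n = (int k, int k)"
      using cell_choices_ends(1)[of "s 0" n k] cell_choices_ends(2)[of n "s n" k] k n_def by auto
  qed
  have Ms: "ground (Ms s) = set xs" "bases (Ms s) = lp xs (L s) (R s)" if "s \<in> I" for s
  proof -
    have "matroid_bases (set xs) (lp xs (L s) (R s))"
      using that ends[of s] z xs by (intro lp_matroid) (auto simp: I_def L_def R_def)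
    from matroid_of_bases[OF this] show "ground (Ms s) = set xs" "bases (Ms s) = lp xs (L s) (R s)"
      by (simp_all add: Ms_def)
  qed
  define v where "v M = (-1) ^ num_components M * g M" for M
  have val: "valuation v" using g by (simp add: speyer_g_def covaluation_def v_def[abs_def])
  have bp: "base_polytope (Ms s) = lp_polytope xs (L s) (R s)" if "s \<in> I" for s
    using Ms(2)[OF that] by (simp add: base_polytope_def hull_lp[OF xs(1)])
  have "v U = (\<Sum>s\<in>I. of_int (sg s) * v (Ms s))"
  proof (rule valuation_decomposition[OF val finI])
    show "ground (Ms s) = ground U" if "s \<in> I" for s using Ms(1)[OF that] xs by simp
    fix p
    have "(indicator (base_polytope U) p :: int) = (\<Sum>s\<in>T. sg s * indicator (lp_polytope xs (L s) (R s)) p)"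
      using hypersimplex_subdivision[OF xs(1) k(1), of p] k n_def
      by (simp add: base_polytope_def U xs sg_def T_def L_def R_def)
    also have "\<dots> = (\<Sum>s\<in>I. sg s * indicator (lp_polytope xs (L s) (R s)) p)"
    proof (rule sum.mono_neutral_right[OF finT])
      show "\<forall>s\<in>T - I. sg s * indicator (lp_polytope xs (L s) (R s)) p = 0"
        by (auto simp: I_def hull_lp[OF xs(1), symmetric])
    qed (auto simp: I_def)
    finally show "(indicator (base_polytope U) p :: int)
        = (\<Sum>s\<in>I. sg s * indicator (base_polytope (Ms s)) p)" using bp by simp
  qed
  also have "\<dots> = (\<Sum>s\<in>cell_paths n k. of_int (sg s) * v (Ms s))"
  proof (rule sum.mono_neutral_right[OF finI])
    show "cell_paths n k \<subseteq> I"
    proof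
      fix s assume "s \<in> cell_paths n k"
      then show "s \<in> I"
        using lp_valid_nonempty[OF xs(1), of "L s" "R s"] xs(3)
        by (auto simp: cell_paths_def I_def T_def L_def[abs_def] R_def[abs_def])
    qed
    \<comment> \<open>A nonempty cell that is not valid has a loop or a coloop, where
      \<open>g\<close> vanishes.\<close>
    show "\<forall>s\<in>I - cell_paths n k. of_int (sg s) * v (Ms s) = 0"
    proof
      fix s assume s: "s \<in> I - cell_paths n k"
      then have sI: "s \<in> I" and sT: "s \<in> T" and nv: "\<not> lp_valid n (L s) (R s)"
        by (auto simp: cell_paths_def I_def T_def L_def R_def)
      have "R s i \<le> L s i + 1" if "i \<le> n" for i
        using sT that cell_choices_gap[of "s i" n k i] by (auto simp: T_def PiE_iff L_def R_def)
      then have "\<exists>e. loop (Ms s) e \<or> coloop (Ms s) e"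
        using ends[OF sT] nv xs
        by (intro lp_invalid_loop[OF xs(1) Ms[OF sI]]) (auto simp: L_def R_def)
      then have "g (Ms s) = 0" using g unfolding speyer_g_def by blast
      then show "of_int (sg s) * v (Ms s) = 0" by (simp add: v_def)
    qed
  qed
  also have "\<dots> = (\<Sum>s\<in>cell_paths n k. - monom 1 (pinch_count n s))"
  proof (rule sum.cong[OF refl])
    fix s assume s: "s \<in> cell_paths n k"
    then have valid: "lp_valid (length xs) (L s) (R s)" and sT: "s \<in> T"
      using xs by (auto simp: cell_paths_def T_def L_def R_def)
    have sI: "s \<in> I" using sT lp_valid_nonempty[OF xs(1) valid] by (simp add: I_def)
    have pc: "pinch_count n s = card {i. i < length xs \<and> L s i = R s i}"
      by (simp add: pinch_count_def xs L_def R_def)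
    have "sg s = (\<Prod>i\<in>{i. i \<le> n \<and> fst (s i) = snd (s i)}. -1)"
      unfolding sg_def by (rule prod.mono_neutral_cong_right) (auto simp: cell_sign_def)
    \<comment> \<open>The sign also sees the pinch at \<open>n\<close>, which
      \<open>pinch_count\<close> leaves out. This one extra -1 survives the cancellation and matches
      the sign of the connected uniform matroid.\<close>
    also have "{i. i \<le> n \<and> fst (s i) = snd (s i)} = insert n {i. i < n \<and> fst (s i) = snd (s i)}"
      using ends[OF sT] by auto
    finally have "sg s = - ((-1) ^ pinch_count n s)" by (simp add: pinch_count_def)
    moreover have "v (Ms s) = (-1) ^ pinch_count n s * monom 1 (pinch_count n s)"
      using speyer_g_lp_valid[OF g xs(1) valid Ms[OF sI]] by (simp add: v_def pc)
    ultimately show "of_int (sg s) * v (Ms s) = - monom 1 (pinch_count n s)"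
      by (simp add: mult.assoc[symmetric] power_mult_distrib[symmetric])
  qed
  finally show ?thesis
    using uniform_num_components[OF U k] by (simp add: v_def n_def sum_negf)
qed

lemma coeff_cell_sum:
  "coeff (\<Sum>s\<in>cell_paths n k. monom (1::int) (pinch_count n s)) j
    = int (card {s \<in> cell_paths n k. pinch_count n s = j})"
proof -
  have "int (card {s \<in> cell_paths n k. pinch_count n s = j})
      = (\<Sum>s\<in>{s \<in> cell_paths n k. pinch_count n s = j}. 1)" by simp
  also have "\<dots> = (\<Sum>s\<in>cell_paths n k. if pinch_count n s = j then 1 else 0)"
    by (rule sum.inter_filter[OF finite_cell_paths])
  finally show ?thesis by (simp only: coeff_sum coeff_monom)
qed

section \<open>Counting cells with one or two summands\<close>

text \<open>The lower bound of a valid cell, encoded by the set \<open>A\<close> of steps at which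
  it climbs. Validity forces the intervals next to the ends to be [0, 1] and [k - 1, k], leaving the
  steps 1 to \<open>n - 2\<close>. A pinch at \<open>m\<close> must be the top of the preceding
  interval and the bottom of the following one: the bound climbs by one into \<open>m\<close> and is
  flat out of it. That rise is the summand for \<open>m \<le> i\<close>, and the steps
  \<open>m - 1\<close> and \<open>m\<close> are no longer free.\<close>

definition word_height :: "nat \<Rightarrow> nat set \<Rightarrow> nat \<Rightarrow> int" where
  "word_height m A i = int (card (A \<inter> {1..<i})) + (if m \<le> i then 1 else 0)"

definition word_path :: "nat \<Rightarrow> nat \<Rightarrow> nat \<Rightarrow> nat set \<Rightarrow> nat \<Rightarrow> int \<times> int" where
  "word_path n k m A = restrict (\<lambda>i. if i = 0 then (0, 0) else if i = n then (int k, int k)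
     else (word_height m A i, word_height m A i + (if i = m then 0 else 1))) {..n}"

lemma word_height_Suc:
  assumes "1 \<le> i"
  shows "word_height m A (Suc i) = word_height m A i + (if i \<in> A then 1 else 0) + (if Suc i = m then 1 else 0)"
proof -
  have "{1..<Suc i} = insert i {1..<i}" using assms by auto
  then have "card (A \<inter> {1..<Suc i}) = card (A \<inter> {1..<i}) + (if i \<in> A then 1 else 0)" by simp
  then show ?thesis by (auto simp: word_height_def)
qed

text \<open>The case \<open>m = n\<close> encodes the paths without an interior pinch.\<close>

lemma word_path_in_cell_paths:
  assumes A: "A \<subseteq> {1..n - 2} - {m - 1, m}" and n: "2 \<le> n"
    and m: "m = n \<and> card A + 1 = k \<or> 2 \<le> m \<and> m \<le> n - 2 \<and> card A + 2 = k"
  shows "word_path n k m A \<in> cell_paths n k"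
    and "pinch_count n (word_path n k m A) = (if m = n then 1 else 2)"
proof -
  define s where "s = word_path n k m A"
  define h where "h = word_height m A"
  have s: "s 0 = (0, 0)" "s n = (int k, int k)"
    "s i = (h i, h i + (if i = m then 0 else 1))" if "0 < i" "i < n" for i
    using n that by (simp_all add: s_def h_def word_path_def)
  have s0: "s 0 = (0, 0)" "s n = (int k, int k)" using n by (simp_all add: s_def word_path_def)
  have mA: "m \<notin> A" "m - 1 \<notin> A" using A by auto
  have finA: "finite A" using A finite_subset by blast
  have m2: "2 \<le> m" using m n by auto
  have h1: "h 1 = 0" using m2 by (simp add: h_def word_height_def)
  have hS: "h (Suc i) = h i + (if i \<in> A then 1 else 0) + (if Suc i = m then 1 else 0)" if "1 \<le> i" for i
    unfolding h_def by (rule word_height_Suc[OF that])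
  have "x \<in> {1..<n - 1}" if "x \<in> A" for x
  proof -
    have "x \<in> {1..n - 2}" using A that by blast
    then show ?thesis using n by auto
  qed
  then have "A \<inter> {1..<n - 1} = A" by blast
  then have top: "h (n - 1) = int k - 1" using m n by (auto simp: h_def word_height_def)
  have card_le: "card (A \<inter> {1..<i}) \<le> card A" for i using finA by (intro card_mono) auto
  have hpos: "0 \<le> h i" for i by (simp add: h_def word_height_def)
  have hk: "h i < int k" if "i < n" for i
    using card_le[of i] m that by (auto simp: h_def word_height_def)
  have hm: "1 \<le> h m" if "m < n" using that by (simp add: h_def word_height_def)
  have "s \<in> PiE {..n} (cell_choices n k)"
  proof (rule PiE_I)
    show "s i = undefined" if "i \<notin> {..n}" for i using that by (simp add: s_def word_path_def)
    fix i assume "i \<in> {..n}"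
    then consider "i = 0" | "i = n" "0 < i" | "0 < i" "i < n" by (cases "i = 0"; cases "i = n") auto
    then show "s i \<in> cell_choices n k i"
    proof cases
      case 3
      obtain a where a: "h i = int a" using hpos[of i] nonneg_int_cases by blast
      have "a < k" using hk[OF 3(2)] a by simp
      moreover have "1 \<le> a" if "i = m" using hm 3 a that by simp
      moreover have "s i = (int a, if i = m then int a else int a + 1)" using s(3)[OF 3] a by simp
      ultimately have "s i \<in> (\<lambda>a. (int a, int a + 1)) ` {..<k} \<union> (\<lambda>a. (int a, int a)) ` {1..<k}"
        by (cases "i = m") (simp_all add: image_iff)
      then show ?thesis using 3 by (simp add: cell_choices_def)
    qed (auto simp: s0 cell_choices_def)
  qed
  moreover have "lp_valid n (\<lambda>i. fst (s i)) (\<lambda>i. snd (s i))"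
    unfolding lp_valid_def
  proof (intro conjI allI impI)
    fix i
    show "fst (s i) \<le> snd (s i)" "snd (s i) \<le> fst (s i) + 1" if "i \<le> n"
      using that s0 s(3)[of i] by (cases "i = 0"; cases "i = n"; auto)+
    assume i: "i < n"
    consider "i = 0" "Suc i < n" | "i = 0" "Suc i = n" | "0 < i" "Suc i < n" | "0 < i" "Suc i = n" using i by linarith
    then have "fst (s (Suc i)) \<le> snd (s i) \<and> fst (s i) < snd (s (Suc i))"
    proof cases
      case 1
      then show ?thesis using s0 s(3)[of 1] h1 m2 by simp
    next
      case 2
      then show ?thesis using n by simp
    next
      case 3
      then show ?thesis using s(3)[of i] s(3)[of "Suc i"] hS[of i] mA by (auto split: if_splits)
    next
      case 4
      then have "i = n - 1" "i \<noteq> m" using m n by auto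
      then show ?thesis using s(3)[of i] s0 top 4 by simp
    qed
    then show "fst (s (Suc i)) \<le> snd (s i)" "fst (s i) < snd (s (Suc i))" by auto
  qed (simp_all add: s0)
  ultimately show "word_path n k m A \<in> cell_paths n k" by (simp add: cell_paths_def s_def)
  have "{i. i < n \<and> fst (s i) = snd (s i)} = (if m = n then {0} else {0, m})"
  proof -
    have "i < n \<and> fst (s i) = snd (s i) \<longleftrightarrow> i < n \<and> (i = 0 \<or> i = m)" for i
      using s0 s(3)[of i] by (cases "i = 0"; cases "i = m") auto
    then have "{i. i < n \<and> fst (s i) = snd (s i)} = {i. i < n \<and> (i = 0 \<or> i = m)}" by simp
    also have "\<dots> = (if m = n then {0} else {0, m})" using m n by (cases "m = n") auto
    finally show ?thesis .
  qed
  then show "pinch_count n (word_path n k m A) = (if m = n then 1 else 2)"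
    using m2 by (simp add: pinch_count_def s_def)
qed

lemma word_path_inj:
  assumes A: "A \<subseteq> {1..n - 2}" and B: "B \<subseteq> {1..n - 2}"
    and eq: "word_path n k m A = word_path n k m B"
  shows "A = B"
proof -
  have h: "word_height m A i = word_height m B i" if "0 < i" "i < n" for i
    using fun_cong[OF eq, of i] that by (simp add: word_path_def)
  have "i \<in> A \<longleftrightarrow> i \<in> B" if i: "i \<in> {1..n - 2}" for i
  proof -
    have "1 \<le> i" "Suc i < n" using i by auto
    then show ?thesis
      using h[of i] h[of "Suc i"] word_height_Suc[of i m A] word_height_Suc[of i m B]
      by (auto split: if_splits)
  qed
  then show ?thesis using A B by blast
qed

lemma word_path_pinch:
  assumes eq: "word_path n k m A = word_path n k m' B"
    and m: "0 < m" "m < n"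
  shows "m = m'"
  using fun_cong[OF eq, of m] m by (auto simp: word_path_def split: if_splits)

lemma count_one_pinch:
  assumes k: "0 < k" "k < n"
  shows "(n - 2) choose (k - 1) \<le> card {s \<in> cell_paths n k. pinch_count n s = 1}"
proof -
  have sub: "A \<subseteq> {1..n - 2} - {n - 1, n}" if "A \<subseteq> {1..n - 2}" for A
  proof -
    have "n - 1 \<notin> {1..n - 2}" "n \<notin> {1..n - 2}" using k by auto
    then show ?thesis using that by blast
  qed
  have "(n - 2) choose (k - 1) = card {A. A \<subseteq> {1..n - 2} \<and> card A = k - 1}"
    by (simp add: n_subsets)
  also have "\<dots> \<le> card {s \<in> cell_paths n k. pinch_count n s = 1}"
  proof (rule card_inj_on_le[where f = "word_path n k n"])
    show "inj_on (word_path n k n) {A. A \<subseteq> {1..n - 2} \<and> card A = k - 1}"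
    proof (rule inj_onI)
      fix A B assume "A \<in> {A. A \<subseteq> {1..n - 2} \<and> card A = k - 1}"
        "B \<in> {A. A \<subseteq> {1..n - 2} \<and> card A = k - 1}" "word_path n k n A = word_path n k n B"
      then show "A = B" using word_path_inj[of A n B k n] by blast
    qed
    show "word_path n k n ` {A. A \<subseteq> {1..n - 2} \<and> card A = k - 1}
      \<subseteq> {s \<in> cell_paths n k. pinch_count n s = 1}"
    proof (rule image_subsetI)
      fix A assume "A \<in> {A. A \<subseteq> {1..n - 2} \<and> card A = k - 1}"
      then show "word_path n k n A \<in> {s \<in> cell_paths n k. pinch_count n s = 1}"
        using word_path_in_cell_paths[of A n n k] sub[of A] k by simp
    qed
  qed (simp add: finite_cell_paths)
  finally show ?thesis .
qed

text \<open>Pinches next to an end would create a loop or a coloop, so \<open>m\<close> runs over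
  the \<open>n - 3\<close> values from 2 to \<open>n - 2\<close>. Two of the \<open>n - 2\<close>
  free steps and one of the \<open>k - 1\<close> rises are used up by the pinch.\<close>

lemma count_two_pinches:
  assumes k: "2 \<le> k" "k + 2 \<le> n"
  shows "(n - 3) * ((n - 4) choose (k - 2)) \<le> card {s \<in> cell_paths n k. pinch_count n s = 2}"
proof -
  define S where "S m = {A. A \<subseteq> {1..n - 2} - {m - 1, m} \<and> card A = k - 2}" for m
  have S: "finite (S m)" "card (S m) = (n - 4) choose (k - 2)" if "m \<in> {2..n - 2}" for m
  proof -
    have "{m - 1, m} \<subseteq> {1..n - 2}" "m - 1 \<noteq> m" using that by auto
    then have "card ({1..n - 2} - {m - 1, m}) = n - 2 - card {m - 1, m}"
      by (simp add: card_Diff_subset)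
    also have "\<dots> = n - 4" using \<open>m - 1 \<noteq> m\<close> by simp
    finally show "card (S m) = (n - 4) choose (k - 2)" by (simp add: S_def n_subsets)
    show "finite (S m)" by (rule finite_subset[of _ "Pow {1..n - 2}"]) (auto simp: S_def)
  qed
  have "(n - 3) * ((n - 4) choose (k - 2)) = card (Sigma {2..n - 2} S)"
    using S k by (simp add: card_SigmaI)
  also have "\<dots> \<le> card {s \<in> cell_paths n k. pinch_count n s = 2}"
  proof (rule card_inj_on_le[where f = "\<lambda>(m, A). word_path n k m A"])
    show "inj_on (\<lambda>(m, A). word_path n k m A) (Sigma {2..n - 2} S)"
    proof (rule inj_onI, clarify)
      fix m A m' B
      assume *: "m \<in> {2..n - 2}" "A \<in> S m" "m' \<in> {2..n - 2}" "B \<in> S m'"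
        "word_path n k m A = word_path n k m' B"
      have "0 < m" "m < n" using *(1) by auto
      then have "m = m'" using word_path_pinch[OF *(5)] by blast
      moreover have "A \<subseteq> {1..n - 2}" "B \<subseteq> {1..n - 2}" using * by (auto simp: S_def)
      ultimately show "m = m' \<and> A = B" using word_path_inj *(5) by blast
    qed
    show "(\<lambda>(m, A). word_path n k m A) ` Sigma {2..n - 2} S
      \<subseteq> {s \<in> cell_paths n k. pinch_count n s = 2}"
    proof (rule image_subsetI, clarify)
      fix m A assume *: "m \<in> {2..n - 2}" "A \<in> S m"
      have "m \<noteq> n" using * by auto
      then show "word_path n k m A \<in> cell_paths n k \<and> pinch_count n (word_path n k m A) = 2"
        using word_path_in_cell_paths[of A n m k] * k by (auto simp: S_def)
    qed
  qed (simp add: finite_cell_paths)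
  finally show ?thesis .
qed

section \<open>Bounding the number of circuit-hyperplanes\<close>

lemma pairwise_disjoint_pairs:
  assumes "finite E" "\<H> \<subseteq> k_subsets E 2"
    and "\<And>H H'. H \<in> \<H> \<Longrightarrow> H' \<in> \<H> \<Longrightarrow> H \<noteq> H' \<Longrightarrow> H \<inter> H' = {}"
  shows "2 * card \<H> \<le> card E"
proof -
  have fin: "finite \<H>" using assms(1,2) finite_subset[of \<H> "Pow E"] by (auto simp: k_subsets_def)
  have "card (\<Union>\<H>) = (\<Sum>H\<in>\<H>. card H)"
    using assms by (intro card_Union_disjoint) (auto simp: pairwise_def disjnt_def k_subsets_def intro: finite_subset)
  also have "\<dots> = (\<Sum>H\<in>\<H>. 2)" using assms(2) by (intro sum.cong) (auto simp: k_subsets_def)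
  finally have "card (\<Union>\<H>) = 2 * card \<H>" by simp
  moreover have "card (\<Union>\<H>) \<le> card E" using assms(1,2) by (intro card_mono) (auto simp: k_subsets_def)
  ultimately show ?thesis by simp
qed

text \<open>Splitting the family at an element matches Pascal's rule. The inequality is strict because it
  is then also good enough for the coefficient of \<open>t\<^sup>2\<close>.\<close>

lemma sparse_family_bound:
  assumes "finite E" "\<H> \<subseteq> k_subsets E k" "5 \<le> card E" "2 \<le> k" "k + 2 \<le> card E"
    and "\<And>H H'. H \<in> \<H> \<Longrightarrow> H' \<in> \<H> \<Longrightarrow> H \<noteq> H' \<Longrightarrow> card (H \<inter> H') + 2 \<le> k"
  shows "card \<H> < (card E - 2) choose (k - 1)"
  using assms
proof (induction "card E" arbitrary: E \<H> k rule: less_induct)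
  case less
  note fin = less.prems(1) and sub = less.prems(2) and n5 = less.prems(3)
    and k = less.prems(4,5) and sep = less.prems(6)
  have finH: "finite \<H>" using fin sub finite_subset[of \<H> "Pow E"] by (auto simp: k_subsets_def)
  have el: "finite H" "card H = k" "H \<subseteq> E" if "H \<in> \<H>" for H
    using that sub fin by (auto simp: k_subsets_def intro: finite_subset)
  consider "k = 2" | "k + 2 = card E" | "3 \<le> k" "k + 3 \<le> card E" using k by linarith
  then show ?case
  proof cases
    case 1
    have "H \<inter> H' = {}" if "H \<in> \<H>" "H' \<in> \<H>" "H \<noteq> H'" for H H'
      using sep[OF that] el(1)[OF that(1)] 1 by simp
    then have "2 * card \<H> \<le> card E"
      using sub unfolding 1 by (intro pairwise_disjoint_pairs[OF fin])
    then show ?thesis using 1 n5 by simp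
  next
    case 2
    define \<G> where "\<G> = (\<lambda>H. E - H) ` \<H>"
    have "inj_on (\<lambda>H. E - H) \<H>" using el(3) by (auto intro!: inj_onI)
    then have c: "card \<G> = card \<H>" by (simp add: \<G>_def card_image)
    have "\<G> \<subseteq> k_subsets E 2" using el 2 by (auto simp: \<G>_def k_subsets_def card_Diff_subset)
    moreover have "G \<inter> G' = {}" if G: "G \<in> \<G>" "G' \<in> \<G>" "G \<noteq> G'" for G G'
    proof -
      obtain H H' where H: "H \<in> \<H>" "H' \<in> \<H>" "G = E - H" "G' = E - H'" "H \<noteq> H'"
        using G unfolding \<G>_def by blast
      have "card (H \<union> H') + card (H \<inter> H') = k + k"
        using card_Un_Int[of H H'] el H by simp
      \<comment> \<open>The union has at least k + k - (k - 2) = k + 2 elements, hence is all of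
        \<open>E\<close>. So the complements are disjoint pairs and the rank two count applies to
        them.\<close>
      then have "card E \<le> card (H \<union> H')" using sep[OF H(1,2,5)] 2 by simp
      then have "H \<union> H' = E" using el H fin by (intro card_seteq) auto
      then show ?thesis using H by blast
    qed
    ultimately have "2 * card \<H> \<le> card E"
      unfolding c[symmetric] by (intro pairwise_disjoint_pairs[OF fin])
    moreover have "(card E - 2) choose (k - 1) = card E - 2"
    proof -
      have "card E - 2 = Suc (k - 1)" using 2 k by simp
      then show ?thesis by (simp add: binomial_Suc_n)
    qed
    ultimately show ?thesis using n5 by simp
  next
    case 3
    have "E \<noteq> {}" using n5 by auto
    then obtain e where e: "e \<in> E" by blast
    \<comment> \<open>Members avoiding \<open>e\<close> keep size \<open>k\<close>; members through
      \<open>e\<close> lose it and have size \<open>k - 1\<close>, and their pairwise intersections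
      lose one element too. In this case \<open>card E\<close> is at least 6, so both families live
      on at least 5 points.\<close>
    define \<A> where "\<A> = {H \<in> \<H>. e \<notin> H}"
    define \<B> where "\<B> = (\<lambda>H. H - {e}) ` {H \<in> \<H>. e \<in> H}"
    have cE: "card (E - {e}) = card E - 1" using e fin by simp
    have lt: "card (E - {e}) < card E" using card_Diff1_less[OF fin e] .
    have inj: "inj_on (\<lambda>H. H - {e}) {H \<in> \<H>. e \<in> H}" by (auto intro!: inj_onI)
    have "\<H> = \<A> \<union> {H \<in> \<H>. e \<in> H}" "\<A> \<inter> {H \<in> \<H>. e \<in> H} = {}" by (auto simp: \<A>_def)
    then have "card \<H> = card \<A> + card {H \<in> \<H>. e \<in> H}"
      using finH by (metis card_Un_disjoint finite_Un)
    also have "card {H \<in> \<H>. e \<in> H} = card \<B>" using inj by (simp add: \<B>_def card_image)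
    finally have c: "card \<H> = card \<A> + card \<B>" .
    have a: "card \<A> < (card (E - {e}) - 2) choose (k - 1)"
    proof (rule less.hyps[OF lt])
      show "\<A> \<subseteq> k_subsets (E - {e}) k" using el by (fastforce simp: \<A>_def k_subsets_def)
      show "card (H \<inter> H') + 2 \<le> k" if "H \<in> \<A>" "H' \<in> \<A>" "H \<noteq> H'" for H H'
        using that sep by (simp add: \<A>_def)
    qed (use 3 cE fin in auto)
    have b: "card \<B> < (card (E - {e}) - 2) choose (k - 1 - 1)"
    proof (rule less.hyps[OF lt])
      show "\<B> \<subseteq> k_subsets (E - {e}) (k - 1)" using el by (fastforce simp: \<B>_def k_subsets_def)
      fix G G' assume "G \<in> \<B>" "G' \<in> \<B>" "G \<noteq> G'"
      then obtain H H' where H: "H \<in> \<H>" "H' \<in> \<H>" "e \<in> H" "e \<in> H'" "G = H - {e}" "G' = H' - {e}" "H \<noteq> H'"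
        unfolding \<B>_def by blast
      have "G \<inter> G' = H \<inter> H' - {e}" using H by blast
      then have "card (G \<inter> G') = card (H \<inter> H') - 1" using H by simp
      moreover have "0 < card (H \<inter> H')" using H el(1)[OF H(1)] by (auto simp: card_gt_0_iff)
      ultimately show "card (G \<inter> G') + 2 \<le> k - 1" using sep[OF H(1,2,7)] by linarith
    qed (use 3 cE fin in auto)
    have "card E - 2 = Suc (card (E - {e}) - 2)" "k - 1 = Suc (k - 1 - 1)" using 3 cE by auto
    then have "(card E - 2) choose (k - 1) = ((card (E - {e}) - 2) choose (k - 1 - 1)) + ((card (E - {e}) - 2) choose (k - 1))"
      by (metis binomial_Suc_Suc)
    then show ?thesis using a b c by simp
  qed
qed

text \<open>With a = k - 2 and b = n - 2 - k, absorbing twice gives (a + 1) (b + 1) binomial(a + b +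
  2, a + 1) = (a + b + 2) (a + b + 1) binomial(a + b, a), and (a + 1) (b + 1) >= a + b + 2 as soon
  as a and b are positive. For a = 0 or b = 0 the binomial exceeds the right side by exactly one,
  and the strict inequality for \<open>c\<close> makes up for it.\<close>

lemma uniform_coefficient_comparison:
  assumes k: "2 \<le> k" "k + 2 \<le> n" and c: "c < (n - 2) choose (k - 1)"
  shows "c \<le> (n - 3) * ((n - 4) choose (k - 2))"
proof -
  define a where "a = k - 2"
  define b where "b = n - 2 - k"
  have ab: "k = a + 2" "n = a + b + 4" using k by (simp_all add: a_def b_def)
  consider "a = 0" | "b = 0" | "0 < a" "0 < b" by blast
  then show ?thesis
  proof cases
    case 1
    then show ?thesis using c ab by simp
  next
    case 2
    have "Suc (Suc a) choose Suc a = Suc (Suc a)" by (simp add: binomial_Suc_n)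
    then show ?thesis using c ab 2 by simp
  next
    case 3
    have "(a + 1) * ((a + b + 2) choose (a + 1)) = (a + b + 2) * ((a + b + 1) choose a)"
      using binomial_absorption[of a "a + b + 2"] by simp
    moreover have "(b + 1) * ((a + b + 1) choose a) = (a + b + 1) * ((a + b) choose a)"
      using binomial_absorb_comp[of "a + b + 1" a] by simp
    ultimately have *: "(a + 1) * (b + 1) * ((a + b + 2) choose (a + 1))
        = (a + b + 2) * ((a + b + 1) * ((a + b) choose a))"
      by (metis mult.assoc mult.left_commute)
    have "0 < a * b" using 3 by simp
    then have "a + b + 2 \<le> (a + 1) * (b + 1)" by (simp add: algebra_simps)
    then have "(a + b + 2) * ((a + b + 2) choose (a + 1)) \<le> (a + 1) * (b + 1) * ((a + b + 2) choose (a + 1))"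
      by (rule mult_le_mono1)
    then have "(a + b + 2) choose (a + 1) \<le> (a + b + 1) * ((a + b) choose a)"
      unfolding * by (simp only: mult_le_cancel1)
    then show ?thesis using c ab by (simp add: numeral_eq_Suc)
  qed
qed

section \<open>Sparse paving matroids\<close>

text \<open>Among the bases containing \<open>S\<close>, one with the fewest elements outside
  \<open>S \<union> B\<close> has none: any such element could be exchanged for one of
  \<open>B\<close>.\<close>

lemma augment_to_basis:
  assumes S: "S \<subseteq> A" "A \<in> bases M" and B: "B \<in> bases M"
  shows "\<exists>C\<in>bases M. S \<subseteq> C \<and> C \<subseteq> S \<union> B"
proof -
  define P where "P C \<longleftrightarrow> C \<in> bases M \<and> S \<subseteq> C" for C
  have "P A" using S by (simp add: P_def)
  then obtain C where C: "P C" and min: "\<And>D. P D \<Longrightarrow> card (C - (S \<union> B)) \<le> card (D - (S \<union> B))"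
    using ex_has_least_nat[of P A "\<lambda>C. card (C - (S \<union> B))"] by blast
  have "C \<subseteq> S \<union> B"
  proof (rule ccontr)
    assume "\<not> C \<subseteq> S \<union> B"
    then obtain x where x: "x \<in> C" "x \<notin> S" "x \<notin> B" by blast
    then obtain y where y: "y \<in> B - C" "insert y (C - {x}) \<in> bases M"
      using matroid_bases_exchange[OF matroid_bases_matroid _ B, of C x] C by (auto simp: P_def)
    have "P (insert y (C - {x}))" using y x C by (auto simp: P_def)
    moreover have "insert y (C - {x}) - (S \<union> B) = C - (S \<union> B) - {x}" using y by auto
    moreover have "finite C"
      using C finite_subset[OF bases_subset_ground finite_ground, of C M] by (simp add: P_def)
    then have "finite (C - (S \<union> B))" by (rule finite_Diff)
    moreover have "x \<in> C - (S \<union> B)" using x by blast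
    ultimately show False using min card_Diff1_less leD by metis
  qed
  then show ?thesis using C by (auto simp: P_def)
qed

text \<open>In a sparse paving matroid these are the circuit-hyperplanes.\<close>

definition nonbases :: "matroid \<Rightarrow> nat set set" where
  "nonbases M = k_subsets (ground M) (matroid_rank M) - bases M"

lemma bases_subset_k_subsets: "bases M \<subseteq> k_subsets (ground M) (matroid_rank M)"
  using bases_subset_ground card_basis by (auto simp: k_subsets_def)

lemma bases_eq_diff_nonbases: "bases M = k_subsets (ground M) (matroid_rank M) - nonbases M"
  using bases_subset_k_subsets by (auto simp: nonbases_def)

lemma rank_dual: "matroid_rank (dual M) = card (ground M) - matroid_rank M"
proof -
  obtain B where B: "B \<in> bases M" using bases_nonempty by blast
  then have "ground M - B \<in> bases (dual M)" by (simp add: bases_dual)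
  moreover have "finite B" using B bases_subset_ground finite_ground finite_subset by metis
  ultimately show ?thesis
    using card_basis[of "ground M - B" "dual M"] card_basis[OF B] bases_subset_ground[OF B]
    by (simp add: card_Diff_subset)
qed

text \<open>Suppose \<open>H\<close> and \<open>H'\<close> share k - 1 elements. Paving makes the
  intersection independent; paving of the dual makes the complement of the union, too small to be
  dependent there, coindependent, so the union contains a basis. Extending the intersection inside
  the union adds one element of \<open>H\<close> or of \<open>H'\<close>, so one of the two would be
  a basis.\<close>

lemma nonbases_intersection:
  assumes M: "sparse_paving M" and H: "H \<in> nonbases M" "H' \<in> nonbases M" "H \<noteq> H'"
  shows "card (H \<inter> H') + 2 \<le> matroid_rank M"
proof (rule ccontr)
  define k where "k = matroid_rank M"
  assume "\<not> card (H \<inter> H') + 2 \<le> matroid_rank M"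
  then have ge: "k \<le> card (H \<inter> H') + 1" by (simp add: k_def)
  have H1: "H \<subseteq> ground M" "card H = k" "H \<notin> bases M" "H' \<subseteq> ground M" "card H' = k" "H' \<notin> bases M"
    using H by (auto simp: nonbases_def k_subsets_def k_def)
  have fin: "finite H" "finite H'" using H1 finite_ground finite_subset by blast+
  have "card (H \<inter> H') < k"
  proof -
    have "H \<inter> H' \<noteq> H" using card_subset_eq[OF fin(2), of H] H1 H(3) by auto
    then have "H \<inter> H' \<subset> H" by blast
    then show ?thesis using psubset_card_mono[OF fin(1)] H1 by blast
  qed
  then have cI: "card (H \<inter> H') + 1 = k" using ge by simp
  have cU: "card (H \<union> H') = k + 1" using card_Un_Int[OF fin] H1 cI by simp
  have "indep M (H \<inter> H')"
  proof -
    have "\<not> matroid_rank M \<le> card (H \<inter> H')" "H \<inter> H' \<subseteq> ground M"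
      using cI H1 by (auto simp: k_def)
    then show ?thesis using M unfolding sparse_paving_def paving_def dependent_set_def by blast
  qed
  then obtain A where A: "A \<in> bases M" "H \<inter> H' \<subseteq> A" by (auto simp: indep_def)
  have "card (ground M - (H \<union> H')) < matroid_rank (dual M)"
  proof -
    have "card (ground M - (H \<union> H')) = card (ground M) - (k + 1)"
      using cU H1 fin by (simp add: card_Diff_subset)
    moreover have "k + 1 \<le> card (ground M)"
      unfolding cU[symmetric] using H1 finite_ground by (intro card_mono) auto
    ultimately show ?thesis by (simp add: rank_dual k_def)
  qed
  then have "indep (dual M) (ground M - (H \<union> H'))"
    using M unfolding sparse_paving_def paving_def dependent_set_def ground_dual
    by (meson Diff_subset leD)
  then obtain B where B: "B \<in> bases M" "ground M - (H \<union> H') \<subseteq> ground M - B"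
    by (auto simp: indep_def bases_dual)
  then have BU: "B \<subseteq> H \<union> H'" using bases_subset_ground[OF B(1)] by blast
  obtain C where C: "C \<in> bases M" "H \<inter> H' \<subseteq> C" "C \<subseteq> (H \<inter> H') \<union> B"
    using augment_to_basis[OF A(2,1) B(1)] by blast
  have cC: "card C = k" using card_basis[OF C(1)] by (simp add: k_def)
  have finC: "finite C" using C(3) fin BU finite_subset by (metis finite_Int finite_Un)
  have "C \<noteq> H \<inter> H'" using cC cI by auto
  then obtain z where z: "z \<in> C" "z \<notin> H \<inter> H'" using C(2) by blast
  have sub: "insert z (H \<inter> H') \<subseteq> C" using z C by blast
  have "card (insert z (H \<inter> H')) = k" using z fin cI by simp
  then have Ceq: "C = insert z (H \<inter> H')" using card_subset_eq[OF finC sub] cC by simp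
  have "z \<in> H \<or> z \<in> H'" using z C(3) BU by blast
  then have "C \<subseteq> H \<or> C \<subseteq> H'" using Ceq by blast
  then have "C = H \<or> C = H'" using card_subset_eq fin H1 cC by metis
  then show False using C(1) H1 by auto
qed

section \<open>The matroids and polytopes next to a circuit-hyperplane\<close>

lemma lp_restrict:
  assumes "j \<le> length xs" "l j \<le> a" "b \<le> u j"
  shows "lp xs (l(j := a)) (u(j := b)) = {B \<in> lp xs l u.
    a \<le> int (card (B \<inter> set (take j xs))) \<and> int (card (B \<inter> set (take j xs))) \<le> b}" (is "?L = ?R")
proof (intro set_eqI iffI)
  fix B assume B: "B \<in> ?L"
  have j: "a \<le> int (card (B \<inter> set (take j xs)))" "int (card (B \<inter> set (take j xs))) \<le> b"
    using lp_D(2,3)[OF B assms(1)] by simp_all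
  have "B \<in> lp xs l u"
  proof (rule lp_I)
    show "B \<subseteq> set xs" by (rule lp_D(1)[OF B])
    fix i assume i: "i \<le> length xs"
    show "l i \<le> int (card (B \<inter> set (take i xs)))" "int (card (B \<inter> set (take i xs))) \<le> u i"
      using lp_D(2,3)[OF B i] j assms by (cases "i = j"; simp)+
  qed
  then show "B \<in> ?R" using j by simp
next
  fix B assume B: "B \<in> ?R"
  show "B \<in> ?L"
  proof (rule lp_I)
    show "B \<subseteq> set xs" using B lp_D(1) by blast
    fix i assume i: "i \<le> length xs"
    show "(l(j := a)) i \<le> int (card (B \<inter> set (take i xs)))"
      "int (card (B \<inter> set (take i xs))) \<le> (u(j := b)) i"
      using B lp_D(2,3)[of B xs l u i] i by auto
  qed
qed

lemma lp_polytope_restrict: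
  assumes "j \<le> length xs" "l j \<le> a" "b \<le> u j"
  shows "lp_polytope xs (l(j := a)) (u(j := b)) = {p \<in> lp_polytope xs l u.
    real_of_int a \<le> psum xs p j \<and> psum xs p j \<le> real_of_int b}"
proof -
  have "(\<forall>i\<le>length xs. real_of_int ((l(j := a)) i) \<le> psum xs p i \<and> psum xs p i \<le> real_of_int ((u(j := b)) i))
    \<longleftrightarrow> (\<forall>i\<le>length xs. real_of_int (l i) \<le> psum xs p i \<and> psum xs p i \<le> real_of_int (u i))
      \<and> real_of_int a \<le> psum xs p j \<and> psum xs p j \<le> real_of_int b" (is "?L \<longleftrightarrow> ?R") for p
  proof
    assume L: ?L
    have j: "real_of_int a \<le> psum xs p j" "psum xs p j \<le> real_of_int b"
      using L assms(1) by (auto dest: spec[of _ j])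
    moreover have "real_of_int (l j) \<le> real_of_int a" "real_of_int b \<le> real_of_int (u j)"
      using assms by simp_all
    ultimately have "real_of_int (l i) \<le> psum xs p i \<and> psum xs p i \<le> real_of_int (u i)"
      if "i \<le> length xs" for i
      using L[rule_format, OF that] by (cases "i = j") auto
    then show ?R using j by blast
  qed simp
  then show ?thesis unfolding lp_polytope_def by blast
qed

text \<open>Let \<open>H\<close> be a circuit-hyperplane. For \<open>c = k\<close> these are the bases of the matroid whose polytope
  is glued on by relaxing \<open>H\<close>, and for \<open>c = k - 1\<close> those of the common face.\<close>

definition near_subsets :: "nat set \<Rightarrow> nat \<Rightarrow> nat set \<Rightarrow> nat \<Rightarrow> nat set set" where
  "near_subsets E k H c = {B \<in> k_subsets E k. k - 1 \<le> card (B \<inter> H) \<and> card (B \<inter> H) \<le> c}"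

text \<open>Listing \<open>H\<close> first turns the intersection number with \<open>H\<close> into
  the prefix count at position \<open>card H\<close>. The freedom to choose the order of the ground
  set is what brings circuit-hyperplanes within reach of lattice paths.\<close>

lemma list_with_prefix:
  fixes E H :: "nat set"
  assumes "finite E" "H \<subseteq> E"
  obtains xs where "distinct xs" "set xs = E" "set (take (card H) xs) = H" "length xs = card E"
proof
  define xs where "xs = sorted_list_of_set H @ sorted_list_of_set (E - H)"
  have H: "finite H" using assms finite_subset by blast
  show d: "distinct xs" and s: "set xs = E" using assms H by (auto simp: xs_def)
  show "set (take (card H) xs) = H" using H by (simp add: xs_def)
  show "length xs = card E" using distinct_card[OF d] s by simp
qed

lemma near_subsets_lp:
  assumes xs: "distinct xs" "set xs = E" "set (take k xs) = H" and k: "1 \<le> k" "k < length xs" and c: "c \<le> k"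
  shows "near_subsets E k H c =
    lp xs ((\<lambda>i. if i = length xs then int k else 0)(k := int k - 1)) ((\<lambda>_. int k)(k := int c))"
proof -
  have E: "E = set xs" using xs by simp
  show ?thesis
    using k c unfolding near_subsets_def E k_subsets_lp[OF xs(1)]
    by (subst lp_restrict) (auto simp: xs(3))
qed

text \<open>The loose bounds of \<open>near_subsets_lp\<close> are the right ones here: they display
  the polytope as a slab of the hypersimplex, the form in which indicators are compared. The tight
  bounds below serve to evaluate \<open>g\<close>.\<close>

lemma near_subsets_hull:
  assumes E: "finite E" and H: "H \<in> k_subsets E k" and k: "1 \<le> k" "k < card E" and c: "c \<le> k"
  shows "convex hull (indicator_vec ` near_subsets E k H c) =
    {p \<in> convex hull (indicator_vec ` k_subsets E k).
      real k - 1 \<le> (\<Sum>e\<in>H. Poly_Mapping.lookup p e) \<and> (\<Sum>e\<in>H. Poly_Mapping.lookup p e) \<le> real c}"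
proof -
  have H': "H \<subseteq> E" "card H = k" using H by (auto simp: k_subsets_def)
  obtain xs where xs: "distinct xs" "set xs = E" "set (take k xs) = H" "length xs = card E"
    using list_with_prefix[OF E H'(1)] H'(2) by metis
  have k': "k < length xs" using k xs by simp
  have Es: "E = set xs" using xs by simp
  have psum: "psum xs p k = (\<Sum>e\<in>H. Poly_Mapping.lookup p e)" for p by (simp add: psum_def xs)
  have "convex hull (indicator_vec ` near_subsets E k H c) =
      {p \<in> lp_polytope xs (\<lambda>i. if i = length xs then int k else 0) (\<lambda>_. int k).
        real_of_int (int k - 1) \<le> psum xs p k \<and> psum xs p k \<le> real_of_int (int c)}"
    unfolding near_subsets_lp[OF xs(1-3) k(1) k' c] hull_lp[OF xs(1)]
    using k k' c by (intro lp_polytope_restrict) auto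
  then show ?thesis unfolding Es k_subsets_lp[OF xs(1)] hull_lp[OF xs(1)] psum by simp
qed

text \<open>With \<open>H\<close> listed first, a member of \<open>near_subsets\<close> omits at
  most one element of \<open>H\<close>, so its height stays within one of \<open>min i k\<close> at
  every position. These bounds have the gap required by \<open>lp_valid\<close>. Truncated
  subtraction supplies the value 0 at position 0.\<close>

definition near_lower :: "nat \<Rightarrow> nat \<Rightarrow> nat \<Rightarrow> int" where
  "near_lower n k i = (if i = n then int k else int (min (i - 1) (k - 1)))"

definition near_upper :: "nat \<Rightarrow> nat \<Rightarrow> nat \<Rightarrow> nat \<Rightarrow> int" where
  "near_upper n k c i = (if i = k then int c else int (min i k))"

lemma near_subsets_lp_tight:
  assumes xs: "distinct xs" "set xs = E" "set (take k xs) = H" and k: "1 \<le> k" "k < length xs" and c: "c \<le> k"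
  shows "near_subsets E k H c = lp xs (near_lower (length xs) k) (near_upper (length xs) k c)"
proof (intro set_eqI iffI)
  fix B assume B: "B \<in> near_subsets E k H c"
  then have B': "B \<subseteq> set xs" "card B = k" "k - 1 \<le> card (B \<inter> H)" "card (B \<inter> H) \<le> c"
    using xs by (auto simp: near_subsets_def k_subsets_def)
  have finB: "finite B" using B'(1) finite_subset by blast
  have finH: "finite H" using xs(3) by (metis List.finite_set)
  have cH: "card H = k" using distinct_card[of "take k xs"] xs(1,3) k by simp
  show "B \<in> lp xs (near_lower (length xs) k) (near_upper (length xs) k c)"
  proof (rule lp_I[OF B'(1)])
    fix i assume i: "i \<le> length xs"
    have ci: "card (set (take i xs)) = i" using distinct_card[of "take i xs"] xs(1) i by simp
    have le: "card (B \<inter> set (take i xs)) \<le> i" "card (B \<inter> set (take i xs)) \<le> k"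
      using card_mono[of "set (take i xs)" "B \<inter> set (take i xs)"] card_mono[OF finB, of "B \<inter> set (take i xs)"] ci B'(2)
      by auto
    have full: "card (B \<inter> set (take i xs)) = k" if "i = length xs"
      using that B'(1,2) by (simp add: Int_absorb2)
    have eqk: "card (B \<inter> set (take i xs)) = card (B \<inter> H)" if "i = k" using that xs(3) by simp
    have lower: "min (i - 1) (k - 1) \<le> card (B \<inter> set (take i xs))"
    proof (cases "i \<le> k")
      case True
      have "set (take i xs) \<subseteq> H" unfolding xs(3)[symmetric] using True by (rule set_take_subset_set_take)
      then have "card (set (take i xs) - B) \<le> card (H - B)" using finH by (intro card_mono) auto
      moreover have "card (H - B) + card (B \<inter> H) = k"
        using card_Int_Diff[OF finH, of B] cH by (simp add: Int_commute)
      moreover have "card (set (take i xs) - B) + card (B \<inter> set (take i xs)) = i"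
        using card_Int_Diff[of "set (take i xs)" B] ci by (simp add: Int_commute)
      ultimately show ?thesis using B'(3) k by linarith
    next
      case False
      then have "H \<subseteq> set (take i xs)" unfolding xs(3)[symmetric] by (intro set_take_subset_set_take) simp
      then have "card (B \<inter> H) \<le> card (B \<inter> set (take i xs))" using finB by (intro card_mono) auto
      then show ?thesis using B'(3) by simp
    qed
    show "near_lower (length xs) k i \<le> int (card (B \<inter> set (take i xs)))"
      using full lower by (simp add: near_lower_def)
    show "int (card (B \<inter> set (take i xs))) \<le> near_upper (length xs) k c i"
      using le eqk B'(4) by (simp add: near_upper_def)
  qed
next
  fix B assume B: "B \<in> lp xs (near_lower (length xs) k) (near_upper (length xs) k c)"
  note b = lp_D[OF B]
  have "B \<inter> set xs = B" using b(1) by blast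
  then have "card B = k"
    using b(2,3)[of "length xs"] k by (simp add: near_lower_def near_upper_def)
  moreover have "k - 1 \<le> card (B \<inter> H)" "card (B \<inter> H) \<le> c"
    using b(2,3)[of k] k xs(3) by (simp_all add: near_lower_def near_upper_def)
  ultimately show "B \<in> near_subsets E k H c"
    using b(1) xs by (simp add: near_subsets_def k_subsets_def)
qed

lemma near_valid:
  assumes k: "2 \<le> k" "k + 2 \<le> n" and c: "c = k \<or> c = k - 1"
  shows "lp_valid n (near_lower n k) (near_upper n k c)"
    and "card {i. i < n \<and> near_lower n k i = near_upper n k c i} = (if c = k then 1 else 2)"
proof -
  show "lp_valid n (near_lower n k) (near_upper n k c)"
    unfolding lp_valid_def
  proof (intro conjI allI impI)
    fix i
    show "near_lower n k i \<le> near_upper n k c i" "near_upper n k c i \<le> near_lower n k i + 1"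
      if "i \<le> n" using that k c by (auto simp: near_lower_def near_upper_def min_def)
    assume i: "i < n"
    show "near_lower n k (Suc i) \<le> near_upper n k c i" "near_lower n k i < near_upper n k c (Suc i)"
      using i k c by (auto simp: near_lower_def near_upper_def min_def)
  qed (use k in \<open>auto simp: near_lower_def near_upper_def\<close>)
  have "i < n \<and> near_lower n k i = near_upper n k c i \<longleftrightarrow> i = 0 \<or> (i = k \<and> c \<noteq> k)" for i
    using k c by (auto simp: near_lower_def near_upper_def min_def split: if_splits)
  then have "{i. i < n \<and> near_lower n k i = near_upper n k c i} = (if c = k then {0} else {0, k})" by auto
  then show "card {i. i < n \<and> near_lower n k i = near_upper n k c i} = (if c = k then 1 else 2)"
    using k by simp
qed

text \<open>For \<open>c = k\<close> the only pinch before the end is at 0. For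
  \<open>c = k - 1\<close> the upper bound is lowered to the lower one at position \<open>k\<close>,
  a second pinch separating \<open>H\<close> from its complement.\<close>

lemma near_matroid:
  assumes E: "finite E" "0 \<notin> E" and H: "H \<in> k_subsets E k"
    and k: "2 \<le> k" "k + 2 \<le> card E" and c: "c = k \<or> c = k - 1"
  shows "matroid_bases E (near_subsets E k H c)"
    and "speyer_g g \<Longrightarrow> ground N = E \<Longrightarrow> bases N = near_subsets E k H c
      \<Longrightarrow> g N = monom 1 (if c = k then 1 else 2) \<and> num_components N = (if c = k then 1 else 2)"
proof -
  have H': "H \<subseteq> E" "card H = k" using H by (auto simp: k_subsets_def)
  obtain xs where xs: "distinct xs" "set xs = E" "set (take k xs) = H" "length xs = card E"
    using list_with_prefix[OF E(1) H'(1)] H'(2) by metis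
  define l where "l = near_lower (length xs) k"
  define u where "u = near_upper (length xs) k c"
  have v: "lp_valid (length xs) l u" "card {i. i < length xs \<and> l i = u i} = (if c = k then 1 else 2)"
    unfolding l_def u_def using near_valid[OF k(1) _ c] k(2) xs(4) by simp_all
  have near: "near_subsets E k H c = lp xs l u"
    unfolding l_def u_def using k c xs(4) by (intro near_subsets_lp_tight xs) auto
  show "matroid_bases E (near_subsets E k H c)"
  proof -
    have "matroid_bases (set xs) (lp xs l u)"
      using xs E lp_validD(3)[OF v(1)] lp_valid_nonempty[OF xs(1) v(1)] by (intro lp_matroid) auto
    then show ?thesis using near xs(2) by simp
  qed
  show "g N = monom 1 (if c = k then 1 else 2) \<and> num_components N = (if c = k then 1 else 2)"
    if "speyer_g g" "ground N = E" "bases N = near_subsets E k H c"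
    using speyer_g_lp_valid[OF that(1) xs(1) v(1), of N] that xs(2) v(2) near by simp
qed

section \<open>Relaxing circuit-hyperplanes\<close>

lemma hull_lookup_sum_le:
  assumes "\<And>B. B \<in> \<B> \<Longrightarrow> finite B \<and> real (card (B \<inter> H)) \<le> b" "finite H"
    and "p \<in> convex hull (indicator_vec ` \<B>)"
  shows "(\<Sum>e\<in>H. Poly_Mapping.lookup p e) \<le> b"
proof -
  have "convex {p. (\<Sum>e\<in>H. Poly_Mapping.lookup p e) \<le> b}"
  proof (rule convexI)
    fix p q :: "nat \<Rightarrow>\<^sub>0 real" and x y :: real
    assume "p \<in> {p. (\<Sum>e\<in>H. Poly_Mapping.lookup p e) \<le> b}" "q \<in> {p. (\<Sum>e\<in>H. Poly_Mapping.lookup p e) \<le> b}"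
      "0 \<le> x" "0 \<le> y" "x + y = 1"
    then show "x *\<^sub>R p + y *\<^sub>R q \<in> {p. (\<Sum>e\<in>H. Poly_Mapping.lookup p e) \<le> b}"
      unfolding mem_Collect_eq sum_lookup_combination by (intro convex_bound_le)
  qed
  then have "convex hull (indicator_vec ` \<B>) \<subseteq> {p. (\<Sum>e\<in>H. Poly_Mapping.lookup p e) \<le> b}"
    using assms(1,2) by (intro hull_minimal[where S = convex]) (auto simp: sum_indicator_vec)
  then show ?thesis using assms(3) by blast
qed

lemma inter_bound:
  assumes E: "finite E" and H: "H \<in> k_subsets E k" and B: "B \<in> k_subsets E k - {H}"
  shows "finite B \<and> real (card (B \<inter> H)) \<le> real k - 1"
proof -
  have H': "H \<subseteq> E" "card H = k" "finite H" using H E finite_subset by (auto simp: k_subsets_def)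
  have B': "B \<subseteq> E" "card B = k" "B \<noteq> H" using B by (auto simp: k_subsets_def)
  then have finB: "finite B" using E finite_subset by blast
  have "\<not> H \<subseteq> B" using B' card_subset_eq[OF finB, of H] H' by auto
  then have "B \<inter> H \<subset> H" by blast
  then have "card (B \<inter> H) < k" using psubset_card_mono[OF H'(3)] H'(2) by blast
  then show ?thesis using finB by simp
qed

text \<open>If a point of the polytope lies on the side of the hyperplane away from the vertex \<open>H\<close>, then
  the segment from that vertex through it meets the hyperplane inside the common face, so the vertex
  is not needed to express the point.\<close>

lemma hull_remove_vertex:
  assumes E: "finite E" and H: "H \<in> k_subsets E k" and k: "1 \<le> k" "k < card E"
    and \<B>: "\<B> \<subseteq> k_subsets E k - {H}" "near_subsets E k H (k - 1) \<subseteq> \<B>"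
    and p: "p \<in> convex hull (indicator_vec ` insert H \<B>)"
    and le: "(\<Sum>e\<in>H. Poly_Mapping.lookup p e) \<le> real k - 1"
  shows "p \<in> convex hull (indicator_vec ` \<B>)"
proof -
  define s where "s q = (\<Sum>e\<in>H. Poly_Mapping.lookup q e)" for q :: "nat \<Rightarrow>\<^sub>0 real"
  define h where "h = indicator_vec H"
  have H': "H \<subseteq> E" "card H = k" "finite H" using H E finite_subset by (auto simp: k_subsets_def)
  have s_comb: "s (a *\<^sub>R q + b *\<^sub>R r) = a * s q + b * s r" for a b q r
    unfolding s_def by (rule sum_lookup_combination)
  have sh: "s h = real k" using H' by (simp add: s_def h_def sum_indicator_vec)
  have card_lt: "finite B \<and> real (card (B \<inter> H)) \<le> real k - 1" if "B \<in> \<B>" for B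
    using inter_bound[OF E H] that \<B>(1) by blast
  show ?thesis
  proof (cases "\<B> = {}")
    case True
    then have "p = h" using p by (simp add: h_def)
    then show ?thesis using le sh by (simp add: s_def)
  next
    case False
    obtain a b z where z: "z \<in> convex hull (indicator_vec ` \<B>)" "0 \<le> a" "0 \<le> b" "a + b = 1"
      "p = a *\<^sub>R h + b *\<^sub>R z"
      using p False unfolding image_insert h_def by (auto simp: convex_hull_insert)
    have sz: "s z \<le> real k - 1"
      unfolding s_def by (rule hull_lookup_sum_le[OF card_lt H'(3) z(1)])
    have sp: "a * real k + b * s z \<le> real k - 1"
      using le s_comb[of a h b z] z(5) sh by (simp add: s_def)
    \<comment> \<open>Chosen so that the point \<open>q\<close> of the segment from \<open>z\<close>
      to the vertex \<open>h\<close> with weight \<open>t\<close> on \<open>h\<close> satisfies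
      \<open>s q = real k - 1\<close>, that is, lies on the hyperplane.\<close>
    define t where "t = (real k - 1 - s z) / (real k - s z)"
    have pos: "0 < real k - s z" using sz by linarith
    have t: "0 \<le> t" "t \<le> 1" "t * (real k - s z) = real k - 1 - s z"
      using sz pos by (auto simp: t_def)
    have "a * (real k - s z) \<le> t * (real k - s z)"
    proof -
      have b: "b = 1 - a" using z(4) by simp
      have "a * real k + (1 - a) * s z \<le> real k - 1" using sp by (simp only: b)
      then show ?thesis unfolding t(3) by (simp add: algebra_simps)
    qed
    then have at: "a \<le> t" using pos by simp
    show ?thesis
    proof (cases "t = 0")
      case True
      then have "a = 0" "b = 1" using at z by auto
      then show ?thesis using z by simp
    next
      case False
      define q where "q = t *\<^sub>R h + (1 - t) *\<^sub>R z"
      have sq: "s q = real k - 1"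
        unfolding q_def s_comb sh using t(3) by (simp add: algebra_simps)
      have hK: "h \<in> convex hull (indicator_vec ` k_subsets E k)"
        unfolding h_def using H by (intro hull_inc) simp
      have zK: "z \<in> convex hull (indicator_vec ` k_subsets E k)"
        using z(1) \<B>(1) hull_mono[of "indicator_vec ` \<B>" "indicator_vec ` k_subsets E k" convex] by blast
      have "q \<in> convex hull (indicator_vec ` k_subsets E k)"
        unfolding q_def using t by (intro convexD[OF convex_convex_hull hK zK]) auto
      then have "q \<in> convex hull (indicator_vec ` near_subsets E k H (k - 1))"
        using sq k by (subst near_subsets_hull[OF E H k]) (auto simp: s_def)
      then have qB: "q \<in> convex hull (indicator_vec ` \<B>)"
        using hull_mono[of "indicator_vec ` near_subsets E k H (k - 1)" "indicator_vec ` \<B>" convex] \<B>(2) by blast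
      \<comment> \<open>Since \<open>a \<le> t\<close>, the point \<open>p\<close> lies between
        \<open>z\<close> and \<open>q\<close>, and both are already in the smaller hull.\<close>
      have "p = (a / t) *\<^sub>R q + (1 - a / t) *\<^sub>R z"
      proof -
        have "(a / t) *\<^sub>R q + (1 - a / t) *\<^sub>R z = (a / t * t) *\<^sub>R h + (a / t * (1 - t) + (1 - a / t)) *\<^sub>R z"
          by (simp add: q_def scaleR_add_right scaleR_add_left)
        also have "a / t * t = a" using False by simp
        also have "a / t * (1 - t) + (1 - a / t) = b"
        proof -
          have "a / t * (1 - t) = a / t - a" using False by (simp add: right_diff_distrib)
          then show ?thesis using z(4) by linarith
        qed
        finally show ?thesis using z(5) by simp
      qed
      moreover have "0 \<le> a / t" "a / t \<le> 1" using z(2) t(1) at False by (auto simp: field_simps)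
      ultimately show ?thesis using convexD[OF convex_convex_hull qB z(1), of "a / t" "1 - a / t"] by simp
    qed
  qed
qed

text \<open>The hyperplane where the coordinates over \<open>H\<close> sum to k - 1 cuts the larger
  polytope. The side away from \<open>H\<close> is the hull of \<open>\<B>\<close> by
  \<open>hull_remove_vertex\<close>, the other side is the hull of the sets near \<open>H\<close>,
  and they meet in the common face; the identity is inclusion-exclusion for these two
  pieces.\<close>

lemma relaxation_indicator:
  assumes E: "finite E" and H: "H \<in> k_subsets E k" and k: "1 \<le> k" "k < card E"
    and \<B>: "\<B> \<subseteq> k_subsets E k - {H}" "near_subsets E k H k \<subseteq> insert H \<B>"
  shows "(indicator (convex hull (indicator_vec ` insert H \<B>)) p :: int) =
    indicator (convex hull (indicator_vec ` \<B>)) p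
    + (indicator (convex hull (indicator_vec ` near_subsets E k H k)) p
    - indicator (convex hull (indicator_vec ` near_subsets E k H (k - 1))) p)"
proof -
  define s where "s = (\<Sum>e\<in>H. Poly_Mapping.lookup p e)"
  have H': "H \<subseteq> E" "card H = k" "finite H" using H E finite_subset by (auto simp: k_subsets_def)
  have near_mono: "near_subsets E k H (k - 1) \<subseteq> near_subsets E k H k" by (auto simp: near_subsets_def)
  have "H \<notin> near_subsets E k H (k - 1)" using H' k by (auto simp: near_subsets_def)
  then have F: "near_subsets E k H (k - 1) \<subseteq> \<B>" using near_mono \<B>(2) by blast
  let ?P = "\<lambda>\<B>. convex hull (indicator_vec ` \<B>)"
  have mono: "?P \<A> \<subseteq> ?P \<A>'" if "\<A> \<subseteq> \<A>'" for \<A> \<A>' using that by (intro hull_mono image_mono)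
  have N: "p \<in> ?P (near_subsets E k H k) \<longleftrightarrow> p \<in> ?P (k_subsets E k) \<and> real k - 1 \<le> s \<and> s \<le> real k"
    and Fc: "p \<in> ?P (near_subsets E k H (k - 1)) \<longleftrightarrow> p \<in> ?P (k_subsets E k) \<and> s = real k - 1"
    using k by (auto simp: near_subsets_hull[OF E H k] s_def)
  have K: "p \<in> ?P (k_subsets E k)" if "p \<in> ?P (insert H \<B>)" using that mono \<B>(1) H by blast
  have sk: "s \<le> real k" if "p \<in> ?P (insert H \<B>)"
  proof -
    have "finite B \<and> real (card (B \<inter> H)) \<le> real k" if "B \<in> k_subsets E k" for B
    proof -
      have "finite B" using that E finite_subset by (auto simp: k_subsets_def)
      then show ?thesis using that card_mono[of B "B \<inter> H"] by (auto simp: k_subsets_def)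
    qed
    then show ?thesis unfolding s_def using H'(3) K[OF that] by (rule hull_lookup_sum_le)
  qed
  have sB: "s \<le> real k - 1" if "p \<in> ?P \<B>"
  proof -
    have "finite B \<and> real (card (B \<inter> H)) \<le> real k - 1" if "B \<in> \<B>" for B
      using inter_bound[OF E H] that \<B>(1) by blast
    then show ?thesis unfolding s_def using H'(3) that by (rule hull_lookup_sum_le)
  qed
  have rem: "p \<in> ?P \<B>" if "p \<in> ?P (insert H \<B>)" "s \<le> real k - 1"
    using hull_remove_vertex[OF E H k \<B>(1) F] that by (simp add: s_def)
  have m1: "p \<in> ?P (insert H \<B>)" if "p \<in> ?P \<B>" using that mono[of \<B> "insert H \<B>"] by blast
  have m2: "p \<in> ?P (insert H \<B>)" if "p \<in> ?P (near_subsets E k H k)" using that mono[OF \<B>(2)] by blast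
  have m3: "p \<in> ?P (near_subsets E k H k)" if "p \<in> ?P (near_subsets E k H (k - 1))"
    using that mono[OF near_mono] by blast
  show ?thesis
  proof (cases "p \<in> ?P (insert H \<B>)")
    case False
    then show ?thesis using m1 m2 m3 by (simp add: indicator_def) blast
  next
    case True
    then have *: "p \<in> ?P \<B> \<longleftrightarrow> s \<le> real k - 1" "p \<in> ?P (near_subsets E k H k) \<longleftrightarrow> real k - 1 \<le> s"
      "p \<in> ?P (near_subsets E k H (k - 1)) \<longleftrightarrow> s = real k - 1"
      using rem sB sk K N Fc by blast+
    show ?thesis using True unfolding indicator_def * by auto
  qed
qed

text \<open>The members are put back one at a time. Separation keeps every other member of
  \<open>\<G>\<close> out of \<open>near_subsets E k H k\<close>, so the piece glued on at
  \<open>H\<close> is the same at every stage. The identity concerns hulls of set families, so the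
  induction never leaves polytopes.\<close>

lemma sparse_paving_indicator:
  assumes E: "finite E" and k: "1 \<le> k" "k < card E" and G: "\<G> \<subseteq> k_subsets E k"
    and sep: "\<And>H H'. H \<in> \<G> \<Longrightarrow> H' \<in> \<G> \<Longrightarrow> H \<noteq> H' \<Longrightarrow> card (H \<inter> H') + 2 \<le> k"
  shows "(indicator (convex hull (indicator_vec ` k_subsets E k)) p :: int) =
    indicator (convex hull (indicator_vec ` (k_subsets E k - \<G>))) p
    + (\<Sum>H\<in>\<G>. indicator (convex hull (indicator_vec ` near_subsets E k H k)) p
    - indicator (convex hull (indicator_vec ` near_subsets E k H (k - 1))) p)"
proof -
  have "finite \<G>" using G E finite_subset[of \<G> "Pow E"] by (auto simp: k_subsets_def)
  then show ?thesis using G sep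
  proof (induction \<G> rule: finite_induct)
    case (insert H \<G>)
    have H: "H \<in> k_subsets E k" using insert.prems by simp
    have "near_subsets E k H k \<subseteq> insert H (k_subsets E k - insert H \<G>)"
    proof
      fix B assume B: "B \<in> near_subsets E k H k"
      then have "k \<le> card (B \<inter> H) + 1" "B \<in> k_subsets E k" by (auto simp: near_subsets_def)
      moreover have "B \<notin> \<G>" if "B \<noteq> H"
        using insert.prems(2)[of B H] that \<open>k \<le> card (B \<inter> H) + 1\<close> by auto
      ultimately show "B \<in> insert H (k_subsets E k - insert H \<G>)" by blast
    qed
    note near = this
    have eq: "insert H (k_subsets E k - insert H \<G>) = k_subsets E k - \<G>"
      using H insert.hyps by blast
    have "k_subsets E k - insert H \<G> \<subseteq> k_subsets E k - {H}" by blast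
    then have "(indicator (convex hull (indicator_vec ` (k_subsets E k - \<G>))) p :: int)
      = indicator (convex hull (indicator_vec ` (k_subsets E k - insert H \<G>))) p
      + (indicator (convex hull (indicator_vec ` near_subsets E k H k)) p
      - indicator (convex hull (indicator_vec ` near_subsets E k H (k - 1))) p)"
      using relaxation_indicator[OF E H k _ near, of p] unfolding eq by blast
    then show ?case using insert by simp
  qed simp
qed

lemma matroid_bases_k_subsets:
  assumes "finite E" "0 \<notin> E" "k \<le> card E"
  shows "matroid_bases E (k_subsets E k)"
proof -
  define xs where "xs = sorted_list_of_set E"
  have xs: "distinct xs" "set xs = E" using assms by (simp_all add: xs_def)
  obtain B where "B \<subseteq> E" "card B = k" using obtain_subset_with_card_n[OF assms(3)] by metis
  then have "lp xs (\<lambda>i. if i = length xs then int k else 0) (\<lambda>_. int k) \<noteq> {}"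
    unfolding k_subsets_lp[OF xs(1), symmetric] xs(2) by (auto simp: k_subsets_def)
  then have "matroid_bases (set xs) (lp xs (\<lambda>i. if i = length xs then int k else 0) (\<lambda>_. int k))"
    using assms xs by (intro lp_matroid) auto
  then show ?thesis by (simp add: k_subsets_lp[OF xs(1), symmetric] xs(2))
qed

lemma sum_unit_Plus:
  assumes "finite A" "finite B"
  shows "sum f ({()} <+> (A <+> B)) = f (Inl ()) + (sum (\<lambda>x. f (Inr (Inl x))) A + sum (\<lambda>x. f (Inr (Inr x))) B)"
  using assms by (simp add: sum.Plus)

section \<open>Connectivity of sparse paving matroids\<close>

lemma exists_pairwise_near_subsets:
  assumes E: "finite E" "3 \<le> card E" and r: "1 \<le> r" "r < card E"
  obtains S1 S2 S3 where "S1 \<subseteq> E" "S2 \<subseteq> E" "S3 \<subseteq> E" "card S1 = r" "card S2 = r" "card S3 = r"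
    "S1 \<noteq> S2" "S1 \<noteq> S3" "S2 \<noteq> S3"
    "r \<le> card (S1 \<inter> S2) + 1" "r \<le> card (S1 \<inter> S3) + 1" "r \<le> card (S2 \<inter> S3) + 1"
proof -
  obtain T where T: "T \<subseteq> E" "card T = 3" using obtain_subset_with_card_n[OF E(2)] by metis
  then obtain a b c where abc: "T = {a, b, c}" "a \<noteq> b" "a \<noteq> c" "b \<noteq> c" by (auto simp: card_3_iff)
  have mem: "a \<in> E" "b \<in> E" "c \<in> E" using T abc by auto
  show thesis
  proof (cases "r + 2 \<le> card E")
    case True
    \<comment> \<open>Three one-element extensions of a common set \<open>R\<close>. This needs r +
      2 points; with only r + 1 points the complements of three single points take their
      place.\<close>
    have "r - 1 \<le> card (E - T)" using T E True by (simp add: card_Diff_subset finite_subset)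
    then obtain R where R: "R \<subseteq> E - T" "card R = r - 1" "finite R" by (rule obtain_subset_with_card_n)
    have nR: "a \<notin> R" "b \<notin> R" "c \<notin> R" using R abc by auto
    have I: "insert a R \<inter> insert b R = R" "insert a R \<inter> insert c R = R" "insert b R \<inter> insert c R = R"
      using nR abc by auto
    show thesis
    proof (rule that[of "insert a R" "insert b R" "insert c R"])
      show "insert a R \<subseteq> E" "insert b R \<subseteq> E" "insert c R \<subseteq> E" using R(1) mem by blast+
      show "card (insert a R) = r" "card (insert b R) = r" "card (insert c R) = r" using nR R r by simp_all
      show "insert a R \<noteq> insert b R" "insert a R \<noteq> insert c R" "insert b R \<noteq> insert c R"
        using nR abc by blast+
    qed (simp_all add: I R r)
  next
    case False
    then have cE: "card E = r + 1" using r by simp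
    have "(E - {x}) \<inter> (E - {y}) = E - {x, y}" for x y by blast
    moreover have "card (E - {x, y}) = card E - 2" if "x \<in> E" "y \<in> E" "x \<noteq> y" for x y
      using that by (simp add: card_Diff_subset)
    ultimately have I: "r \<le> card ((E - {x}) \<inter> (E - {y})) + 1" if "x \<in> E" "y \<in> E" "x \<noteq> y" for x y
      using that cE by simp
    show thesis
    proof (rule that[of "E - {a}" "E - {b}" "E - {c}"])
      show "card (E - {a}) = r" "card (E - {b}) = r" "card (E - {c}) = r" using mem cE by simp_all
      show "E - {a} \<noteq> E - {b}" "E - {a} \<noteq> E - {c}" "E - {b} \<noteq> E - {c}" using mem abc by blast+
    qed (use I mem abc in auto)
  qed
qed

text \<open>If \<open>S\<close> extended by \<open>x\<close> and \<open>S\<close> extended by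
  \<open>y\<close> are both bases, then \<open>x\<close> and \<open>y\<close> share a circuit.
  Otherwise every \<open>S\<close> of size k - 1 yields a nonbasis through \<open>x\<close> or
  through \<open>y\<close>. Among three such sets that pairwise differ in one element, two make the
  same choice, and their nonbases meet in k - 1 elements, which \<open>nonbases_intersection\<close>
  forbids. On four points there is no room for three sets, but two already give two distinct
  nonbases.\<close>

lemma sparse_paving_num_components:
  assumes M: "sparse_paving M" and k: "2 \<le> matroid_rank M" "matroid_rank M + 2 \<le> card (ground M)"
    and n: "5 \<le> card (ground M) \<or> card (nonbases M) \<le> 1"
  shows "num_components M = 1"
proof (rule num_components_connected)
  show "ground M \<noteq> {}" using k by auto
  fix x y assume xy: "x \<in> ground M" "y \<in> ground M" "x \<noteq> y"
  define k where "k = matroid_rank M"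
  define E where "E = ground M - {x, y}"
  have E: "finite E" "card E = card (ground M) - 2"
    using xy by (simp_all add: E_def finite_ground card_Diff_subset)
  have fin: "finite (nonbases M)"
    using finite_subset[of "nonbases M" "Pow (ground M)"] finite_ground
    by (auto simp: nonbases_def k_subsets_def)
  show "\<exists>C. circuit M C \<and> x \<in> C \<and> y \<in> C"
  proof (cases "\<exists>S\<subseteq>E. card S = k - 1 \<and> insert x S \<in> bases M \<and> insert y S \<in> bases M")
    case True
    then obtain S where S: "S \<subseteq> E" "insert x S \<in> bases M" "insert y S \<in> bases M" by blast
    have "insert x (insert y S - {y}) = insert x S" "x \<notin> insert y S"
      using S(1) xy by (auto simp: E_def)
    then show ?thesis using common_circuit[of "insert y S" M y x] S by simp
  next
    case False
    have nb: "insert x S \<in> nonbases M \<or> insert y S \<in> nonbases M" if S: "S \<subseteq> E" "card S = k - 1" for S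
    proof -
      have "x \<notin> S" "y \<notin> S" using S by (auto simp: E_def)
      moreover have "finite S" using S E finite_subset by blast
      ultimately have "card (insert x S) = k" "card (insert y S) = k"
        using S k by (simp_all add: k_def)
      moreover have "insert x S \<subseteq> ground M" "insert y S \<subseteq> ground M" using S xy by (auto simp: E_def)
      ultimately show ?thesis using False S by (auto simp: nonbases_def k_subsets_def k_def)
    qed
    have sep: "\<not> (insert z S \<in> nonbases M \<and> insert z S' \<in> nonbases M)"
      if S: "S \<subseteq> E" "S' \<subseteq> E" "S \<noteq> S'" "k - 1 \<le> card (S \<inter> S') + 1" and z: "z = x \<or> z = y" for S S' z
    proof
      assume *: "insert z S \<in> nonbases M \<and> insert z S' \<in> nonbases M"
      have zS: "z \<notin> S" "z \<notin> S'" using S z by (auto simp: E_def)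
      then have ne: "insert z S \<noteq> insert z S'" using S(3) by (simp add: insert_ident)
      have "card (insert z S \<inter> insert z S') + 2 \<le> k"
        using nonbases_intersection[OF M _ _ ne] * unfolding k_def by blast
      moreover have "insert z S \<inter> insert z S' = insert z (S \<inter> S')" by blast
      moreover have "finite (S \<inter> S')" using S E finite_subset by blast
      ultimately show False using zS S(4) by simp
    qed
    have r: "1 \<le> k - 1" "k - 1 < card E" using k E by (auto simp: k_def)
    show ?thesis
    proof (cases "5 \<le> card (ground M)")
      case True
      then have "3 \<le> card E" using E by simp
      then obtain S1 S2 S3 where S: "S1 \<subseteq> E" "S2 \<subseteq> E" "S3 \<subseteq> E" "card S1 = k - 1" "card S2 = k - 1" "card S3 = k - 1"
        "S1 \<noteq> S2" "S1 \<noteq> S3" "S2 \<noteq> S3"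
        "k - 1 \<le> card (S1 \<inter> S2) + 1" "k - 1 \<le> card (S1 \<inter> S3) + 1" "k - 1 \<le> card (S2 \<inter> S3) + 1"
        using exists_pairwise_near_subsets[OF E(1) _ r] by metis
      show ?thesis
        using nb[OF S(1,4)] nb[OF S(2,5)] nb[OF S(3,6)]
          sep[OF S(1,2,7,10) disjI1[OF refl]] sep[OF S(1,2,7,10) disjI2[OF refl]]
          sep[OF S(1,3,8,11) disjI1[OF refl]] sep[OF S(1,3,8,11) disjI2[OF refl]]
          sep[OF S(2,3,9,12) disjI1[OF refl]] sep[OF S(2,3,9,12) disjI2[OF refl]] by argo
    next
      case False
      then have le: "card (nonbases M) \<le> Suc 0" using n by simp
      obtain S where S: "S \<subseteq> E" "card S = k - 1" "finite S"
        using obtain_subset_with_card_n[of "k - 1" E] r(2) by (metis less_imp_le)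
      obtain a where a: "a \<in> S" using S(2) r(1) by fastforce
      have "S \<noteq> E" using S(2) r(2) by auto
      then obtain b where b: "b \<in> E" "b \<notin> S" using S(1) by blast
      define S' where "S' = insert b (S - {a})"
      have S': "S' \<subseteq> E" "card S' = k - 1"
        using S a b r by (auto simp: S'_def card_Diff_singleton)
      obtain H where H: "H \<in> nonbases M" "H = insert x S \<or> H = insert y S" using nb[OF S(1,2)] by blast
      obtain H' where H': "H' \<in> nonbases M" "H' = insert x S' \<or> H' = insert y S'" using nb[OF S'] by blast
      have "b \<in> H'" "b \<notin> H" using H(2) H'(2) b by (auto simp: S'_def E_def)
      then have "H \<noteq> H'" by blast
      then show ?thesis using H(1) H'(1) le fin by (auto simp: card_le_Suc0_iff_eq)
    qed
  qed
qed

text \<open>All circuit-hyperplanes are relaxed in one valuative relation, indexed by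
  \<open>M\<close> itself, the glued pieces \<open>P H\<close> and the common faces
  \<open>F H\<close>. Connectedness of \<open>M\<close> fixes the sign with which \<open>g M\<close>
  enters.\<close>

lemma coeff_speyer_g_sparse_paving:
  assumes g: "speyer_g g" and M: "sparse_paving M" and c: "num_components M = 1"
    and k: "2 \<le> matroid_rank M" "matroid_rank M + 2 \<le> card (ground M)"
  shows "coeff (g M) i =
    int (card {s \<in> cell_paths (card (ground M)) (matroid_rank M). pinch_count (card (ground M)) s = i})
    - (if i = 1 \<or> i = 2 then int (card (nonbases M)) else 0)"
proof -
  define E where "E = ground M"
  define k where "k = matroid_rank M"
  define n where "n = card E"
  define \<H> where "\<H> = nonbases M"
  have E: "finite E" "0 \<notin> E" by (simp_all add: E_def finite_ground zero_notin_ground)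
  have kn: "2 \<le> k" "k + 2 \<le> card E" "1 \<le> k" "k < card E" using k by (simp_all add: k_def E_def)
  have HK: "\<H> \<subseteq> k_subsets E k" by (auto simp: \<H>_def nonbases_def E_def k_def)
  have finH: "finite \<H>" using HK E finite_subset[of \<H> "Pow E"] by (auto simp: k_subsets_def)
  define U where "U = Abs_matroid (E, k_subsets E k)"
  define P where "P H = Abs_matroid (E, near_subsets E k H k)" for H
  define F where "F H = Abs_matroid (E, near_subsets E k H (k - 1))" for H
  have "k \<le> card E" using kn by simp
  then have U: "ground U = E" "bases U = k_subsets E k"
    using matroid_of_bases[OF matroid_bases_k_subsets[OF E]] by (simp_all add: U_def)
  have P: "ground (P H) = E" "bases (P H) = near_subsets E k H k"
    and F: "ground (F H) = E" "bases (F H) = near_subsets E k H (k - 1)" if "H \<in> \<H>" for H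
    using matroid_of_bases[OF near_matroid(1)[OF E _ kn(1,2)]] HK that by (auto simp: P_def F_def)
  define v where "v N = (-1) ^ num_components N * g N" for N
  have val: "valuation v" using g by (simp add: speyer_g_def covaluation_def v_def[abs_def])
  define I where "I = {()} <+> (\<H> <+> \<H>)"
  define Ms where "Ms = case_sum (\<lambda>_::unit. M) (case_sum P F)"
  define a :: "unit + (nat set + nat set) \<Rightarrow> int"
    where "a = case_sum (\<lambda>_. 1) (case_sum (\<lambda>_. 1) (\<lambda>_. - 1))"
  have "v U = (\<Sum>i\<in>I. of_int (a i) * v (Ms i))"
  proof (rule valuation_decomposition[OF val])
    show "finite I" using finH by (simp add: I_def)
    show "ground (Ms i) = ground U" if "i \<in> I" for i
      using that P(1) F(1) U(1) by (auto simp: I_def Ms_def E_def)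
    fix p
    have "(indicator (base_polytope U) p :: int) = indicator (base_polytope M) p
      + (\<Sum>H\<in>\<H>. indicator (base_polytope (P H)) p - indicator (base_polytope (F H)) p)"
    proof -
      have "bases M = k_subsets E k - \<H>" unfolding E_def k_def \<H>_def by (rule bases_eq_diff_nonbases)
      moreover have "card (H \<inter> H') + 2 \<le> k" if "H \<in> \<H>" "H' \<in> \<H>" "H \<noteq> H'" for H H'
        using nonbases_intersection[OF M] that by (simp add: \<H>_def k_def)
      ultimately show ?thesis
        using sparse_paving_indicator[OF E(1) kn(3,4) HK, of p] P(2) F(2)
        by (simp add: base_polytope_def U(2) cong: sum.cong)
    qed
    also have "\<dots> = (\<Sum>i\<in>I. a i * indicator (base_polytope (Ms i)) p)"
      unfolding I_def sum_unit_Plus[OF finH finH] Ms_def a_def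
      by (simp only: sum.case diff_conv_add_uminus sum.distrib sum_negf mult_1 mult_minus1)
    finally show "(indicator (base_polytope U) p :: int) = (\<Sum>i\<in>I. a i * indicator (base_polytope (Ms i)) p)" .
  qed
  also have "\<dots> = v M + ((\<Sum>H\<in>\<H>. v (P H)) - (\<Sum>H\<in>\<H>. v (F H)))"
    unfolding I_def sum_unit_Plus[OF finH finH] Ms_def a_def
    by (simp add: sum_negf)
  also have "(\<Sum>H\<in>\<H>. v (P H)) = (\<Sum>H\<in>\<H>. - monom 1 1)"
    using near_matroid(2)[OF E _ kn(1,2) _ g P] HK by (intro sum.cong) (auto simp: v_def)
  also have "(\<Sum>H\<in>\<H>. v (F H)) = (\<Sum>H\<in>\<H>. monom 1 2)"
  proof (rule sum.cong[OF refl])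
    fix H assume H: "H \<in> \<H>"
    have "k - 1 \<noteq> k" using kn by simp
    then show "v (F H) = monom 1 2"
      using near_matroid(2)[OF E _ kn(1,2) _ g F[OF H]] H HK by (auto simp: v_def)
  qed
  also have "v M = - g M" using c by (simp add: v_def)
  also have "v U = - g U" using uniform_num_components[of U k] U kn by (simp add: v_def)
  \<comment> \<open>In terms of \<open>v\<close>, both \<open>M\<close> and \<open>U\<close> carry a
    minus sign, each \<open>P H\<close> gives -t and each \<open>F H\<close> gives t^2; the latter
    enter with coefficient -1, so both terms are subtracted.\<close>
  finally have "g M = g U + (\<Sum>H\<in>\<H>. - monom 1 1) - (\<Sum>H\<in>\<H>. monom 1 2)" by (simp add: algebra_simps)
  then have "coeff (g M) i = coeff (g U) i + (\<Sum>H\<in>\<H>. - (if 1 = i then 1 else 0)) - (\<Sum>H\<in>\<H>. if 2 = i then 1 else 0)"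
    by (simp only: coeff_add coeff_diff coeff_minus coeff_sum coeff_monom)
  then have "coeff (g M) i = coeff (g U) i - (if i = 1 \<or> i = 2 then int (card \<H>) else 0)" by auto
  moreover have "g U = (\<Sum>s\<in>cell_paths n k. monom 1 (pinch_count n s))"
    using speyer_g_uniform[OF g, of U k] U kn by (simp add: n_def)
  ultimately show ?thesis by (simp only: coeff_cell_sum n_def E_def k_def \<H>_def)
qed

text \<open>Two nonbases are disjoint pairs, hence partition the four points, and the bases are the
  transversals. This is the exceptional sum of two copies of
  \<open>U\<^sub>1\<^sub>,\<^sub>2\<close>, recognised as a common face of
  \<open>near_subsets\<close>, for which \<open>g\<close> is already known.\<close>

lemma two_nonbases_rank_two:
  assumes M: "sparse_paving M" and r: "matroid_rank M = 2" "card (ground M) = 4"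
    and H: "H \<in> nonbases M" "H' \<in> nonbases M" "H \<noteq> H'"
  shows "bases M = near_subsets (ground M) 2 H 1"
proof -
  have H1: "H \<subseteq> ground M" "card H = 2" "H' \<subseteq> ground M" "card H' = 2"
    using H r by (auto simp: nonbases_def k_subsets_def)
  have fin: "finite H" "finite H'" using H1 finite_ground finite_subset by blast+
  have dis: "H \<inter> H' = {}" using nonbases_intersection[OF M H] r fin by simp
  have "card (H \<union> H') = 4" using card_Un_disjoint[OF fin dis] H1 by simp
  then have un: "H \<union> H' = ground M" using card_subset_eq[OF finite_ground, of "H \<union> H'"] H1 r by simp
  have meet: "card (B \<inter> H) = 1" if B: "B \<in> bases M" for B
  proof -
    have cB: "card B = 2" "B \<subseteq> ground M" using card_basis[OF B] r bases_subset_ground[OF B] by simp_all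
    have finB: "finite B" using cB finite_ground finite_subset by blast
    have ne: "B \<noteq> H" "B \<noteq> H'" using B H by (auto simp: nonbases_def)
    have "card (B \<inter> H) \<noteq> 2"
    proof
      assume "card (B \<inter> H) = 2"
      then have "B \<inter> H = H" "B \<inter> H = B"
        using card_subset_eq[OF fin(1), of "B \<inter> H"] card_subset_eq[OF finB, of "B \<inter> H"] H1 cB by auto
      then show False using ne by simp
    qed
    moreover have "card (B \<inter> H) \<noteq> 0"
    proof
      assume "card (B \<inter> H) = 0"
      then have "B \<inter> H = {}" using finB by simp
      then have "B \<subseteq> H'" using cB un by blast
      then show False using card_subset_eq[OF fin(2), of B] cB H1 ne by simp
    qed
    moreover have "card (B \<inter> H) \<le> 2" using card_mono[OF finB, of "B \<inter> H"] cB by simp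
    ultimately show ?thesis by linarith
  qed
  show ?thesis
  proof (intro set_eqI iffI)
    fix B assume "B \<in> bases M"
    then show "B \<in> near_subsets (ground M) 2 H 1"
      using meet[of B] bases_subset_k_subsets[of M] r by (auto simp: near_subsets_def)
  next
    fix B assume B: "B \<in> near_subsets (ground M) 2 H 1"
    then have cB: "B \<subseteq> ground M" "card B = 2" "card (B \<inter> H) = 1"
      by (auto simp: near_subsets_def k_subsets_def)
    show "B \<in> bases M"
    proof (rule ccontr)
      assume "B \<notin> bases M"
      then have "B \<in> nonbases M" using cB r by (simp add: nonbases_def k_subsets_def)
      moreover have "B \<noteq> H" using cB H1 by auto
      ultimately show False using nonbases_intersection[OF M _ H(1), of B] cB r by simp
    qed
  qed
qed

theorem theorem9p20:
  fixes g :: "matroid \<Rightarrow> int poly" and M :: matroid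
  assumes "speyer_g g"
    and "sparse_paving M"
  shows "\<forall>i. coeff (g M) i \<ge> 0"
proof (cases "\<exists>e. loop M e \<or> coloop M e")
  case True
  then have "g M = 0" using assms(1) unfolding speyer_g_def by blast
  then show ?thesis by simp
next
  case False
  define E where "E = ground M"
  define k where "k = matroid_rank M"
  define n where "n = card E"
  have finE: "finite E" by (simp add: E_def finite_ground)
  have bk: "B \<subseteq> E" "card B = k" if "B \<in> bases M" for B
    using that bases_subset_ground card_basis by (auto simp: E_def k_def)
  have no: "\<exists>B\<in>bases M. e \<in> B" "\<exists>B\<in>bases M. e \<notin> B" if "e \<in> E" for e
    using False that by (auto simp: loop_iff coloop_iff E_def)
  show ?thesis
  proof (cases "E = {}")
    case True
    then have "bases M = {{}}" using bk(1) bases_nonempty[of M] by auto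
    then have "bases M = lp [] (\<lambda>_. 0) (\<lambda>_. 0)" by (auto simp: lp_def)
    \<comment> \<open>The empty matroid has no position and no pinch, so the exponent is 0 and
      \<open>g M\<close> is 1.\<close>
    then have "g M = monom 1 (card {i::nat. i < 0 \<and> (0::int) = 0})"
      using speyer_g_lp_valid(1)[OF assms(1), of "[]" "\<lambda>_. 0" "\<lambda>_. 0" M] True
      by (simp add: lp_valid_def E_def)
    then show ?thesis by (simp add: coeff_monom)
  next
    case ne: False
    then obtain e where e: "e \<in> E" by blast
    obtain B B' where B: "B \<in> bases M" "e \<in> B" "B' \<in> bases M" "e \<notin> B'" using no[OF e] by blast
    have fB: "finite B" "finite B'" using bk(1) B finE finite_subset by blast+
    have "0 < k" using bk(2)[OF B(1)] B(2) fB by (auto simp: card_gt_0_iff)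
    moreover have "k < n"
      using psubset_card_mono[OF finE, of B'] bk[OF B(3)] B(4) e by (auto simp: n_def)
    ultimately have k: "0 < k" "k < n" by auto
    show ?thesis
    proof (cases "nonbases M = {}")
      case True
      then have "bases M = k_subsets (ground M) k" using bases_eq_diff_nonbases[of M] by (simp add: k_def)
      then have "g M = (\<Sum>s\<in>cell_paths n k. monom 1 (pinch_count n s))"
        using speyer_g_uniform[OF assms(1)] k by (simp add: n_def E_def)
      then show ?thesis by (simp add: coeff_cell_sum)
    next
      case False
      then obtain H where H: "H \<in> nonbases M" by blast
      have H1: "H \<subseteq> E" "card H = k" "H \<notin> bases M"
        using H by (auto simp: nonbases_def k_subsets_def E_def k_def)
      \<comment> \<open>In rank one a nonbasis would be a loop; in corank one, dually, the point
        outside a nonbasis would be a coloop.\<close>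
      have "k \<noteq> 1"
      proof
        assume k1: "k = 1"
        then obtain x where x: "H = {x}" using H1 card_1_singletonE by metis
        then obtain C where C: "C \<in> bases M" "x \<in> C" using no(1)[of x] H1 by blast
        then have "C = H" using x bk(2)[OF C(1)] k1 by (auto simp: card_1_singleton_iff)
        then show False using C H1 by simp
      qed
      moreover have "k + 1 \<noteq> n"
      proof
        assume kn: "k + 1 = n"
        then obtain x where x: "x \<in> E" "x \<notin> H" using H1 by (metis n_def add.right_neutral add_left_cancel one_neq_zero subsetI subset_antisym)
        then obtain C where C: "C \<in> bases M" "x \<notin> C" using no(2) by blast
        have "C \<subseteq> E - {x}" "H \<subseteq> E - {x}" using bk(1)[OF C(1)] C H1 x by auto
        moreover have "card (E - {x}) = k" using x finE kn by (simp add: n_def)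
        ultimately have "C = E - {x}" "H = E - {x}"
          using card_subset_eq[of "E - {x}"] finE bk(2)[OF C(1)] H1 by auto
        then show False using C H1 by simp
      qed
      ultimately have k2: "2 \<le> k" "k + 2 \<le> n" using k by auto
      have sub: "nonbases M \<subseteq> k_subsets E k" by (auto simp: nonbases_def E_def k_def)
      have fin: "finite (nonbases M)"
        using sub finE finite_subset[of "nonbases M" "Pow E"] by (auto simp: k_subsets_def)
      show ?thesis
      \<comment> \<open>The exceptional matroid has two components, so the sign argument for
        connected \<open>M\<close> fails; its polynomial t^2 is computed directly.\<close>
      proof (cases "n = 4 \<and> 1 < card (nonbases M)")
        case True
        then have "k = 2" using k2 by simp
        obtain H' where H': "H' \<in> nonbases M" "H \<noteq> H'"
          using True H fin by (metis card_le_Suc0_iff_eq One_nat_def not_less)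
        have "bases M = near_subsets E k H (k - 1)"
          using two_nonbases_rank_two[OF assms(2) _ _ H H'] True \<open>k = 2\<close> by (simp add: k_def n_def E_def)
        moreover have "0 \<notin> E" "ground M = E" "H \<in> k_subsets E k" "k + 2 \<le> card E"
          using zero_notin_ground[of M] H sub k2 by (auto simp: E_def n_def)
        ultimately have "g M = monom 1 (if k - 1 = k then 1 else 2)"
          using near_matroid(2)[OF finE _ _ k2(1) _ _ assms(1), of H "k - 1" M] by blast
        then show ?thesis by (simp add: coeff_monom)
      next
        case nd: False
        have "5 \<le> n \<or> card (nonbases M) \<le> 1" using nd k2 by presburger
        then have c: "num_components M = 1"
          using sparse_paving_num_components[OF assms(2)] k2 by (simp add: k_def n_def E_def)
        have "card (nonbases M) < (n - 2) choose (k - 1)"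
        proof (cases "5 \<le> n")
          case True
          then show ?thesis
            using k2 nonbases_intersection[OF assms(2)] unfolding n_def
            by (intro sparse_family_bound[OF finE sub]) (auto simp: k_def)
        next
          case False
          \<comment> \<open>Here binomial(2, 1) = 2 still exceeds the number of nonbases, which is
            at most one outside the exceptional case.\<close>
          then have "n = 4" "k = 2" using k2 by linarith+
          then show ?thesis using nd by simp
        qed
        then have "card (nonbases M) \<le> card {s \<in> cell_paths n k. pinch_count n s = 1}"
          "card (nonbases M) \<le> card {s \<in> cell_paths n k. pinch_count n s = 2}"
          using count_one_pinch[OF k] count_two_pinches[OF k2]
            uniform_coefficient_comparison[OF k2, of "card (nonbases M)"] by linarith+
        then show ?thesis
          using coeff_speyer_g_sparse_paving[OF assms c] k2
          by (auto simp: n_def k_def E_def)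
      qed
    qed
  qed
qed

end
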